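(* Let $m<0$ be an integer. For any $u\in\dot H^1_m$ with $M[u]<\infty$, we have $$E[u]\sim_{M[u]}\|u\|_{\dot H^1_m}^2.$$ In particular, for $m<0$ there is no nontrivial finite energy solution $u$ to the Bogomol'nyi equation $\mathbf{D}_uu=0$.
   Context: Functions are radial parts $u=u(r)$, $r\in(0,\infty)$, of $m$-equivariant functions $u(r)e^{im\theta}$ on $\mathbb{R}^2$; $\int f=2\pi\int_0^\infty f(r)\,r\,dr$. $\dot H^1_m$ is $\dot H^1(\mathbb{R}^2)$ restricted to $m$-equivariant functions, with $\|u\|_{\dot H^1_m}^2=\int|\partial_ru|^2+\frac{m^2}{r^2}|u|^2$. $M[u]=\int|u|^2$, $A_\theta[u](r)=-\frac12\int_0^r|u|^2r'dr'$, $\mathbf{D}_uf=\partial_rf-\frac{m+A_\theta[u]}{r}f$, and $E[u]=\int\frac12|\partial_ru|^2+\frac12\big(\frac{m+A_\theta[u]}r\big)^2|u|^2-\frac14|u|^4=\frac12\int|\mathbf{D}_uu|^2$. "Finite energy" refers to functions in $H^1_m=\dot H^1_m\cap L^2$. $A\sim_{K}B$ means $C(K)^{-1}B\le A\le C(K)B$ with $C(K)$ depending only on $K$ and $m$. *)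

theory Defs
  imports "HOL-Analysis.Analysis"
begin

section \<open>Weak derivatives\<close>

definition locally_integrable_on ::
    "('a::euclidean_space \<Rightarrow> 'b::{banach, second_countable_topology}) \<Rightarrow> 'a set \<Rightarrow> bool"
    (infixr \<open>locally'_integrable'_on\<close> 46) where
  "f locally_integrable_on \<Omega> \<longleftrightarrow> (\<forall>K. compact K \<and> K \<subseteq> \<Omega> \<longrightarrow> set_integrable lborel K f)"

text \<open>Test functions are compactly supported and \<open>C\<^sup>1\<close>. For locally integrable functions this
  gives the same weak derivatives as \<open>C\<^sup>\<infinity>\<close> test functions, by mollification.\<close>

definition test_functions :: "'a::euclidean_space set \<Rightarrow> ('a \<Rightarrow> real) set" where
  "test_functions \<Omega> = {\<phi>.
     (\<forall>x. \<phi> differentiable (at x)) \<and>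
     (\<forall>b\<in>Basis. continuous_on UNIV (\<lambda>x. frechet_derivative \<phi> (at x) b)) \<and>
     compact (closure {x. \<phi> x \<noteq> 0}) \<and> closure {x. \<phi> x \<noteq> 0} \<subseteq> \<Omega>}"

definition has_weak_partial ::
    "'a::euclidean_space set \<Rightarrow> 'a \<Rightarrow> ('a \<Rightarrow> 'b::{banach, second_countable_topology})
      \<Rightarrow> ('a \<Rightarrow> 'b) \<Rightarrow> bool" where
  "has_weak_partial \<Omega> b f g \<longleftrightarrow>
     f locally_integrable_on \<Omega> \<and> g locally_integrable_on \<Omega> \<and>
     (\<forall>\<phi>\<in>test_functions \<Omega>.
        (LINT x:\<Omega>|lborel. frechet_derivative \<phi> (at x) b *\<^sub>R f x)
          = - (LINT x:\<Omega>|lborel. \<phi> x *\<^sub>R g x))"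

section \<open>Equivariant Sobolev spaces\<close>

text \<open>The plane is represented by the type \<^typ>\<open>complex\<close>. No quotient by constants is taken in
  \<open>Hdot1\<close>: for \<open>m \<noteq> 0\<close> the only \<open>m\<close>-equivariant constant is \<open>0\<close>.\<close>

definition Hdot1 :: "(complex \<Rightarrow> complex) set" where
  "Hdot1 = {w. w locally_integrable_on UNIV \<and>
     (\<forall>b\<in>Basis. \<exists>g. has_weak_partial UNIV b w g \<and> integrable lborel (\<lambda>z. (cmod (g z))\<^sup>2))}"

text \<open>A radial part is a function on \<^typ>\<open>real\<close> whose values at \<open>r \<le> 0\<close> are irrelevant.\<close>

definition equivariant_ext :: "int \<Rightarrow> (real \<Rightarrow> complex) \<Rightarrow> complex \<Rightarrow> complex" where
  "equivariant_ext m u z = u (cmod z) * cis (of_int m * Arg z)"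

definition Hdot1_equiv :: "int \<Rightarrow> (real \<Rightarrow> complex) set" where
  "Hdot1_equiv m = {u. equivariant_ext m u \<in> Hdot1}"

definition finite_mass :: "(real \<Rightarrow> complex) \<Rightarrow> bool" where
  "finite_mass u \<longleftrightarrow> set_integrable lborel {0<..} (\<lambda>r. (cmod (u r))\<^sup>2 * r)"

definition H1_equiv :: "int \<Rightarrow> (real \<Rightarrow> complex) set" where
  "H1_equiv m = {u \<in> Hdot1_equiv m. finite_mass u}"

section \<open>Mass, energy and the Bogomol'nyi operator\<close>

definition plane_integral :: "(real \<Rightarrow> real) \<Rightarrow> real" where
  "plane_integral f = 2 * pi * (LINT r:{0<..}|lborel. f r * r)"

text \<open>The weak derivative on the open half-line; it is determined almost everywhere.\<close>

definition radial_deriv :: "(real \<Rightarrow> complex) \<Rightarrow> real \<Rightarrow> complex" where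
  "radial_deriv u = (SOME v. has_weak_partial {0<..} 1 u v)"

definition Hdot1_norm :: "int \<Rightarrow> (real \<Rightarrow> complex) \<Rightarrow> real" where
  "Hdot1_norm m u = sqrt (plane_integral
     (\<lambda>r. (cmod (radial_deriv u r))\<^sup>2 + (of_int m)\<^sup>2 / r\<^sup>2 * (cmod (u r))\<^sup>2))"

definition mass :: "(real \<Rightarrow> complex) \<Rightarrow> real" where
  "mass u = plane_integral (\<lambda>r. (cmod (u r))\<^sup>2)"

definition A_theta :: "(real \<Rightarrow> complex) \<Rightarrow> real \<Rightarrow> real" where
  "A_theta u r = - (1/2) * (LINT s:{0<..<r}|lborel. (cmod (u s))\<^sup>2 * s)"

definition cov_deriv :: "int \<Rightarrow> (real \<Rightarrow> complex) \<Rightarrow> (real \<Rightarrow> complex) \<Rightarrow> real \<Rightarrow> complex" where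
  "cov_deriv m u f r = radial_deriv f r - complex_of_real ((of_int m + A_theta u r) / r) * f r"

definition energy :: "int \<Rightarrow> (real \<Rightarrow> complex) \<Rightarrow> real" where
  "energy m u = plane_integral (\<lambda>r.
     1/2 * (cmod (radial_deriv u r))\<^sup>2
     + 1/2 * ((of_int m + A_theta u r) / r)\<^sup>2 * (cmod (u r))\<^sup>2
     - 1/4 * (cmod (u r)) ^ 4)"

end

theory Submission
  imports Defs
begin

text \<open>Write \<open>B = -(m + A\<^sub>\<theta>) \<ge> |m|\<close>, so that \<open>D\<^sub>u u = u' + (B/r) u\<close>. In the expansion of
  \<open>|D\<^sub>u u|\<^sup>2\<close> the cross term \<open>B (|u|\<^sup>2)'\<close> integrates by parts to \<open>-|u|\<^sup>4 r/2\<close>, hence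
  \<open>E[u] = \<integral>|D\<^sub>u u|\<^sup>2/2\<close>. Pairing \<open>D\<^sub>u u\<close> with \<open>u\<close> gives
  \<open>\<integral> Re (D\<^sub>u u \<cdot> u\<^sup>*) dr = \<integral> B |u|\<^sup>2/r dr \<ge> |m| \<integral> |u|\<^sup>2/r dr\<close>, so \<open>D\<^sub>u u\<close> controls \<open>u/r\<close>, and then
  also \<open>u' = D\<^sub>u u - (B/r) u\<close> because \<open>B \<le> |m| + M[u]/4\<pi>\<close>. The boundary terms vanish because
  \<open>(|u|\<^sup>2)'\<close> and \<open>|u|\<^sup>2/r\<close> are integrable on \<open>(0,\<infinity>)\<close>.

  The weak derivative of \<open>u\<close> on the half-line comes from the weak derivatives \<open>g\<^sub>1, g\<^sub>2\<close> of its
  equivariant extension in the plane: testing \<open>g\<^sub>1 \<plusminus> i g\<^sub>2\<close> against functions with the opposite phase and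
  integrating in polar coordinates identifies \<open>u' \<plusminus> m u/r\<close> with circular averages of square
  integrable functions.\<close>

section \<open>Weak derivatives on the half-line\<close>

text \<open>The sign of m is decisive because \<open>A_theta\<close> is nonpositive: for m < 0 the
  two summands of m + A_theta cannot cancel, whereas for m > 0 they compete. The negative quartic
  term is why E is estimated through D_u u and not term by term. Neither continuity nor decay of u
  is assumed, and \<open>radial_deriv u\<close> is a choice among weak derivatives. All calculus is
  therefore done on a locally absolutely continuous representative, and the results are carried back
  along equality almost everywhere. At both ends, integrability of (|u|^2)' gives |u|^2 a limit, and
  a nonzero limit would make the integral of |u|^2/r diverge. The combinations of g1 and g2 arise
  because \<partial>x + i \<partial>y and \<partial>x - i \<partial>y shift the angular frequency by
  one: on u(r) e^(i m \<theta>) they produce u' - m u/r and u' + m u/r with frequencies m + 1 and m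
  - 1. Since m \<noteq> 0, these two separate u' from u/r.\<close>

lemma integral_Borel_eq_0_if_atMost:
  fixes f :: "real \<Rightarrow> 'b::{banach, second_countable_topology}"
  assumes f: "integrable lborel f"
    and half: "\<And>a. set_lebesgue_integral lborel {..a} f = 0"
    and tot: "integral\<^sup>L lborel f = 0"
    and A: "A \<in> sets borel"
  shows "set_lebesgue_integral lborel A f = 0"
proof -
  have si: "set_integrable lborel A f" if "A \<in> sets borel" for A
    using f that unfolding set_integrable_def by (auto intro: integrable_mult_indicator)
  have UN: "set_lebesgue_integral lborel UNIV f = 0"
    using tot by (simp add: set_lebesgue_integral_def)
  have sets_eq: "sets borel = sigma_sets UNIV (range (\<lambda>a::real. {..a}))"
    by (simp add: borel_eq_atMost)
  \<comment> \<open>The sets over which \<open>f\<close> has integral zero are closed under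
    complements and countable disjoint unions and contain the half-lines, a generator stable under
    intersection.\<close>
  have "Int_stable (range (\<lambda>a::real. {..a}))"
    by (auto simp: Int_stable_def)
  moreover have "range (\<lambda>a::real. {..a}) \<subseteq> Pow UNIV" by simp
  moreover have "A \<in> sigma_sets UNIV (range (\<lambda>a::real. {..a}))"
    using A sets_eq by blast
  ultimately show ?thesis
  proof (induction rule: sigma_sets_induct_disjoint)
    case (basic A) then show ?case using half by auto
  next
    case empty then show ?case by (simp add: set_lebesgue_integral_def)
  next
    case (compl A)
    then have [measurable]: "A \<in> sets borel"
      by (simp add: sets_eq)
    have "set_lebesgue_integral lborel (A \<union> (UNIV - A)) f =
       set_lebesgue_integral lborel A f + set_lebesgue_integral lborel (UNIV - A) f"
      by (rule set_integral_Un) (auto intro: si)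
    then show ?case using compl UN by simp
  next
    case (union A)
    then have m: "A i \<in> sets borel" for i
      by (auto simp: sets_eq)
    have "set_lebesgue_integral lborel (\<Union>i. A i) f = (\<Sum>i. set_lebesgue_integral lborel (A i) f)"
      using m union(1)
      by (intro lebesgue_integral_countable_add) (auto intro!: si simp: disjoint_family_on_def)
    then show ?case using union by simp
  qed
qed

section \<open>Test functions on the half-line and the fundamental lemma of the calculus of
  variations\<close>

lemma frechet_derivative_real_1:
  assumes "(\<phi> has_real_derivative D) (at x)"
  shows "frechet_derivative \<phi> (at x) 1 = D"
proof -
  have "(*) D = frechet_derivative \<phi> (at x)"
    using assms by (intro frechet_derivative_at) (simp add: has_field_derivative_def)
  then have "frechet_derivative \<phi> (at x) 1 = D * 1" by (rule subst) (rule refl)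
  then show ?thesis by simp
qed

text \<open>Compactness inside the open half-line keeps the support away from 0, so one interval
  with positive left end carries the function and its derivative. Later proofs work with the
  explicit derivative instead of \<open>frechet_derivative\<close>.\<close>

lemma test_functions_halfline_iff:
  "\<phi> \<in> test_functions {0<..} \<longleftrightarrow>
    (\<exists>\<phi>' a b. (\<forall>x::real. (\<phi> has_real_derivative \<phi>' x) (at x)) \<and> continuous_on UNIV \<phi>' \<and>
       0 < a \<and> a < b \<and> (\<forall>x. x \<notin> {a<..<b} \<longrightarrow> \<phi> x = 0 \<and> \<phi>' x = 0))" (is "?L \<longleftrightarrow> ?R")
proof
  assume L: ?L
  define \<phi>' where "\<phi>' x = frechet_derivative \<phi> (at x) 1" for x
  have d: "(\<phi> has_real_derivative \<phi>' x) (at x)" for x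
  proof -
    have "\<phi> differentiable (at x)" using L by (auto simp: test_functions_def)
    then obtain D where D: "(\<phi> has_real_derivative D) (at x)"
      by (auto simp: real_differentiable_def)
    with frechet_derivative_real_1[OF D] show ?thesis by (simp add: \<phi>'_def)
  qed
  have cont: "continuous_on UNIV \<phi>'"
    using L by (auto simp: test_functions_def \<phi>'_def)
  define S where "S = closure {x. \<phi> x \<noteq> 0}"
  have S: "compact S" "S \<subseteq> {0<..}" using L by (auto simp: test_functions_def S_def)
  have out: "\<phi> x = 0 \<and> \<phi>' x = 0" if "x \<notin> S" for x
  proof
    show z: "\<phi> x = 0" using that closure_subset[of "{x. \<phi> x \<noteq> 0}"] by (auto simp: S_def)
    have "open (-S)" by (simp add: S_def open_Compl)
    moreover have "\<And>y. y \<in> -S \<Longrightarrow> 0 = \<phi> y" using closure_subset[of "{x. \<phi> x \<noteq> 0}"] by (auto simp: S_def)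
    ultimately have "(\<phi> has_real_derivative 0) (at x)"
      using that by (intro has_field_derivative_transform_within_open[OF DERIV_const]) auto
    then show "\<phi>' x = 0" using d DERIV_unique by blast
  qed
  show ?R
  proof (cases "S = {}")
    case True
    then show ?thesis using d cont out
      by (intro exI[of _ \<phi>'] exI[of _ 1] exI[of _ 2]) auto
  next
    case False
    then obtain p q where p: "p \<in> S" "\<forall>x\<in>S. p \<le> x" and q: "q \<in> S" "\<forall>x\<in>S. x \<le> q"
      using S compact_attains_inf[of S] compact_attains_sup[of S] by blast
    \<comment> \<open>Widening to p/2 and q + 1 puts the whole support strictly inside the open
      interval while the left end stays positive.\<close>
    have "0 < p" using S p by auto
    moreover have "p/2 < q + 1" using p q(2) \<open>0<p\<close> by (auto dest: bspec[of _ _ p])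
    moreover have "\<phi> x = 0 \<and> \<phi>' x = 0" if "x \<notin> {p/2<..<q+1}" for x
      using that p(2) q(2) \<open>0 < p\<close> by (intro out) (auto dest!: bspec[of _ _ x])
    ultimately show ?thesis using d cont
      by (intro exI[of _ \<phi>'] exI[of _ "p/2"] exI[of _ "q+1"]) auto
  qed
next
  assume ?R
  then obtain \<phi>' a b where d: "\<And>x::real. (\<phi> has_real_derivative \<phi>' x) (at x)"
    and c: "continuous_on UNIV \<phi>'" and ab: "0 < a" "a < b"
    and z: "\<And>x. x \<notin> {a<..<b} \<Longrightarrow> \<phi> x = 0"
    by blast
  have "(\<lambda>x. frechet_derivative \<phi> (at x) 1) = \<phi>'"
    using frechet_derivative_real_1[OF d] by blast
  moreover have "closure {x. \<phi> x \<noteq> 0} \<subseteq> {a..b}"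
    using z by (intro closure_minimal closed_atLeastAtMost subsetI)
      (metis (mono_tags) atLeastAtMost_iff greaterThanLessThan_iff less_eq_real_def mem_Collect_eq)
  moreover from this have "compact (closure {x. \<phi> x \<noteq> 0})"
    by (metis closed_closure compact_Icc compact_Int_closed inf.absorb_iff2)
  ultimately show ?L
    using c ab d by (auto simp: test_functions_def real_differentiable_def)
qed

text \<open>A C^1 approximation of the indicator of (a,b): the square of a positive part is C^1, and
  the map taking t to 1 - 1/(1 + n t) sends 0 to 0, stays below 1 for t \<ge> 0 and tends to 1 for
  every t > 0 as n grows.\<close>

definition bump :: "real \<Rightarrow> real \<Rightarrow> nat \<Rightarrow> real \<Rightarrow> real" where
  "bump a b n x = 1 - 1 / (1 + n * (max 0 ((x - a) * (b - x)))\<^sup>2)"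

lemma has_real_derivative_max_0_square:
  "((\<lambda>x::real. (max 0 x)\<^sup>2) has_real_derivative 2 * max 0 x) (at x)"
proof -
  consider "x < 0" | "x > 0" | "x = 0" by linarith
  then show ?thesis
  proof cases
    case 1
    have "((\<lambda>x::real. (max 0 x)\<^sup>2) has_real_derivative 0) (at x)"
      by (rule has_field_derivative_transform_within_open[where S = "{..<0::real}", OF DERIV_const])
        (use 1 in auto)
    with 1 show ?thesis by simp
  next
    case 2
    have "((\<lambda>x::real. x\<^sup>2) has_real_derivative 2 * x) (at x)"
      by (auto intro!: derivative_eq_intros)
    then have "((\<lambda>x::real. (max 0 x)\<^sup>2) has_real_derivative 2 * x) (at x)"
      by (rule has_field_derivative_transform_within_open[where S = "{0::real<..}"]) (use 2 in auto)
    with 2 show ?thesis by simp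
  next
    case 3
    have "((\<lambda>h::real. max 0 h) \<longlongrightarrow> max 0 0) (at 0)"
      by (intro tendsto_intros)
    moreover have "\<forall>\<^sub>F h::real in at 0. max 0 h = ((max 0 (0 + h))\<^sup>2 - (max 0 0)\<^sup>2) / h"
      by (auto simp: eventually_at_filter max_def power2_eq_square)
    ultimately have "((\<lambda>h::real. ((max 0 (0 + h))\<^sup>2 - (max 0 0)\<^sup>2) / h) \<longlongrightarrow> 0) (at 0)"
      by (simp add: tendsto_cong)
    then show ?thesis using 3 by (simp add: DERIV_def)
  qed
qed

lemma bump_test_function:
  assumes "0 < a" "a < b"
  shows "bump a b n \<in> test_functions {0<..}"
proof -
  let ?q = "\<lambda>x. max 0 ((x - a) * (b - x))"
  define D where "D x = n * (2 * ?q x * (a + b - 2 * x)) / (1 + n * (?q x)\<^sup>2)\<^sup>2" for x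
  have pos: "1 + n * (?q x)\<^sup>2 > 0" for x by (simp add: add_pos_nonneg)
  have "(bump a b n has_real_derivative D x) (at x)" for x
  proof -
    have "((\<lambda>x. (x - a) * (b - x)) has_real_derivative (a + b - 2 * x)) (at x)"
      by (auto intro!: derivative_eq_intros)
    from DERIV_chain2[OF has_real_derivative_max_0_square this]
    have q: "((\<lambda>x. (?q x)\<^sup>2) has_real_derivative 2 * ?q x * (a + b - 2 * x)) (at x)" .
    have "((\<lambda>x. 1 - 1 / (1 + n * g x)) has_real_derivative n * g' / (1 + n * g x)\<^sup>2) (at x)"
      if "(g has_real_derivative g') (at x)" "1 + n * g x > 0" for g :: "real \<Rightarrow> real" and g' :: real
      using that by (auto intro!: derivative_eq_intros simp: power2_eq_square mult_ac)
    from this[OF q pos] show ?thesis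
      unfolding bump_def D_def by simp
  qed
  moreover have "continuous_on UNIV D"
    unfolding D_def
    using less_imp_neq[OF zero_less_power[OF pos], symmetric]
    by (intro continuous_intros ballI)
  moreover have "bump a b n x = 0 \<and> D x = 0" if "x \<notin> {a<..<b}" for x
  proof -
    have "(x - a) * (b - x) \<le> 0"
      using that assms by (auto simp: mult_le_0_iff)
    then show ?thesis by (simp add: bump_def D_def)
  qed
  ultimately show ?thesis
    unfolding test_functions_halfline_iff using assms by blast
qed

lemma bump_range: "0 \<le> bump a b n x" "bump a b n x \<le> 1"
proof -
  have "1 \<le> 1 + n * (max 0 ((x - a) * (b - x)))\<^sup>2" by simp
  then show "0 \<le> bump a b n x" "bump a b n x \<le> 1"
    unfolding bump_def by (auto simp: divide_le_eq_1)
qed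

lemma bump_measurable [measurable]: "bump a b n \<in> borel_measurable borel"
  unfolding bump_def by measurable

lemma bump_outside: "a < b \<Longrightarrow> x \<notin> {a<..<b} \<Longrightarrow> bump a b n x = 0"
proof -
  assume "a < b" "x \<notin> {a<..<b}"
  then have "(x - a) * (b - x) \<le> 0" by (auto simp: mult_le_0_iff)
  then show ?thesis by (simp add: bump_def)
qed

lemma bump_LIMSEQ:
  assumes "a < b" shows "(\<lambda>n. bump a b n x) \<longlonglongrightarrow> indicator {a<..<b} x"
proof (cases "x \<in> {a<..<b}")
  case True
  define c where "c = (max 0 ((x - a) * (b - x)))\<^sup>2"
  have "c > 0" using True by (simp add: c_def)
  then have "(\<lambda>n. 1 - 1 / (1 + real n * c)) \<longlonglongrightarrow> 1 - 0"
  proof -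
    have "filterlim (\<lambda>n. c * real n) at_top sequentially"
      using \<open>c > 0\<close> by (intro filterlim_tendsto_pos_mult_at_top[OF tendsto_const _ filterlim_real_sequentially])
    then have "filterlim (\<lambda>n. 1 + c * real n) at_infinity sequentially"
      by (intro filterlim_at_top_imp_at_infinity filterlim_tendsto_add_at_top[OF tendsto_const])
    then have "(\<lambda>n. 1 / (1 + c * real n)) \<longlonglongrightarrow> 0"
      by (rule tendsto_divide_0[OF tendsto_const])
    then show ?thesis by (intro tendsto_diff tendsto_const) (simp add: mult.commute)
  qed
  with True show ?thesis by (simp add: bump_def c_def)
qed (use assms bump_outside in simp)

lemma locally_integrable_halfline_iff:
  "f locally_integrable_on {0::real<..} \<longleftrightarrow> (\<forall>a b. 0 < a \<longrightarrow> set_integrable lborel {a..b} f)"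
proof
  assume "f locally_integrable_on {0::real<..}"
  then show "\<forall>a b. 0 < a \<longrightarrow> set_integrable lborel {a..b} f"
    unfolding locally_integrable_on_def by (metis atLeastAtMost_iff compact_Icc greaterThan_iff less_le_trans subsetI)
next
  assume *: "\<forall>a b. 0 < a \<longrightarrow> set_integrable lborel {a..b} f"
  show "f locally_integrable_on {0::real<..}"
    unfolding locally_integrable_on_def
  proof (intro allI impI)
    fix K assume K: "compact K \<and> K \<subseteq> {0::real<..}"
    show "set_integrable lborel K f"
    proof (cases "K = {}")
      case True
      then show ?thesis by simp
    next
      case False
      then obtain p q where p: "p \<in> K" "\<forall>x\<in>K. p \<le> x" and q: "q \<in> K" "\<forall>x\<in>K. x \<le> q"
        using K compact_attains_inf[of K] compact_attains_sup[of K] by blast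
      then have "set_integrable lborel {p..q} f" using K * by auto
      then show ?thesis
        by (rule set_integrable_subset) (use K p q in \<open>auto simp: compact_imp_closed\<close>)
    qed
  qed
qed

text \<open>Bumps approximate indicators of open intervals, so by dominated convergence
  \<open>f\<close> has integral zero over intervals, hence over all Borel subsets of a compact
  interval, which forces it to vanish almost everywhere there.\<close>

lemma AE_eq_0_if_test_functions:
  fixes f :: "real \<Rightarrow> 'b::{banach, second_countable_topology}"
  assumes f: "f locally_integrable_on {0<..}"
    and test: "\<And>\<phi>. \<phi> \<in> test_functions {0<..} \<Longrightarrow> (LINT x:{0<..}|lborel. \<phi> x *\<^sub>R f x) = 0"
  shows "AE x in lborel. 0 < x \<longrightarrow> f x = 0"
proof -
  have int: "integrable lborel (\<lambda>x. indicator {a..b} x *\<^sub>R f x)" if "0 < a" for a b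
    using f that by (auto simp: locally_integrable_halfline_iff set_integrable_def)
  have zero: "(LINT x|lborel. indicator {a<..<b} x *\<^sub>R f x) = 0" if "0 < a" "a < b" for a b
  proof -
    let ?s = "\<lambda>n x. bump a b n x *\<^sub>R (indicator {a..b} x *\<^sub>R f x)"
    have F[measurable]: "(\<lambda>x. indicator {a..b} x *\<^sub>R f x) \<in> borel_measurable lborel"
      using int[OF that(1), of b] by (rule borel_measurable_integrable)
    have eq: "indicator {a<..<b} x *\<^sub>R (indicator {a..b} x *\<^sub>R f x) = indicator {a<..<b} x *\<^sub>R f x" for x
      by (auto simp: indicator_def)
    have "(\<lambda>n. integral\<^sup>L lborel (?s n)) \<longlonglongrightarrow>
        (LINT x|lborel. indicator {a<..<b} x *\<^sub>R (indicator {a..b} x *\<^sub>R f x))"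
    proof (rule integral_dominated_convergence)
      show "integrable lborel (\<lambda>x. norm (indicator {a..b} x *\<^sub>R f x))"
        using int[OF that(1)] by (rule integrable_norm)
      show "(\<lambda>x. indicator {a<..<b} x *\<^sub>R (indicator {a..b} x *\<^sub>R f x)) \<in> borel_measurable lborel"
        by measurable
      show "?s n \<in> borel_measurable lborel" for n by measurable
      show "AE x in lborel. (\<lambda>n. ?s n x) \<longlonglongrightarrow> indicator {a<..<b} x *\<^sub>R (indicator {a..b} x *\<^sub>R f x)"
        by (intro AE_I2 tendsto_scaleR bump_LIMSEQ that tendsto_const)
      show "AE x in lborel. norm (?s n x) \<le> norm (indicator {a..b} x *\<^sub>R f x)" for n
      proof (intro AE_I2)
        fix x
        have "norm (c *\<^sub>R v) \<le> norm v" if "0 \<le> c" "c \<le> 1" for c and v :: 'b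
          using that by (simp add: mult_left_le_one_le)
        then show "norm (?s n x) \<le> norm (indicator {a..b} x *\<^sub>R f x)"
          using bump_range[of a b n x] by blast
      qed
    qed
    moreover have "integral\<^sup>L lborel (?s n) = 0" for n
    proof -
      have "?s n x = indicator {0<..} x *\<^sub>R (bump a b n x *\<^sub>R f x)" for x
        using that bump_outside[of a b x n] by (cases "x \<in> {a<..<b}") auto
      then have "integral\<^sup>L lborel (?s n) = (LINT x:{0<..}|lborel. bump a b n x *\<^sub>R f x)"
        unfolding set_lebesgue_integral_def by presburger
      then show ?thesis
        using test[OF bump_test_function[OF that, of n]] by simp
    qed
    ultimately show ?thesis unfolding eq by (simp add: LIMSEQ_const_iff)
  qed
  have ab: "AE x in lborel. indicator {a..b} x *\<^sub>R f x = 0" if "0 < a" "a < b" for a b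
  proof (rule sigma_finite_measure.density_zero[OF sigma_finite_lborel int[OF \<open>0 < a\<close>]])
    fix A :: "real set" assume "A \<in> sets lborel"
    let ?F = "\<lambda>x. indicator {a..b} x *\<^sub>R f x"
    have [measurable]: "?F \<in> borel_measurable lborel"
      using int[OF that(1), of b] by (rule borel_measurable_integrable)
    have ne: "AE x in lborel. x \<noteq> a \<and> x \<noteq> c" for c :: real
      using AE_lborel_singleton[of a] AE_lborel_singleton[of c] by auto
    \<comment> \<open>Up to endpoints, which are null, the part of [a,b] below c is the open
      interval from a to \<open>min b c\<close>.\<close>
    have half: "(LINT x|lborel. indicator {..c} x *\<^sub>R ?F x) = 0" for c
    proof (cases "a < c")
      case True
      have m: "(\<lambda>x. indicator {a<..<min b c} x *\<^sub>R ?F x) \<in> borel_measurable lborel"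
        by measurable
      have e: "indicator {a<..<min b c} x *\<^sub>R ?F x = indicator {a<..<min b c} x *\<^sub>R f x" for x
        by (auto simp: indicator_def)
      have "(LINT x|lborel. indicator {..c} x *\<^sub>R ?F x)
          = (LINT x|lborel. indicator {a<..<min b c} x *\<^sub>R f x)"
      proof (intro integral_cong_AE m[unfolded e])
        show "AE x in lborel. indicator {..c} x *\<^sub>R ?F x = indicator {a<..<min b c} x *\<^sub>R f x"
          using ne[of "min b c"]
        proof eventually_elim
          case (elim x)
          then have "indicator {..c} x * indicator {a..b} x = (indicator {a<..<min b c} x :: real)"
            by (auto simp: indicator_def)
          then show ?case by (simp only: scaleR_scaleR)
        qed
      qed measurable
      also have "\<dots> = 0" using True that by (intro zero) auto
      finally show ?thesis .
    next
      case False
      have "(LINT x|lborel. indicator {..c} x *\<^sub>R ?F x) = (LINT x|(lborel::real measure). 0)"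
      proof (rule integral_cong_AE)
        show "AE x in lborel. indicator {..c} x *\<^sub>R ?F x = 0"
          using ne[of a] by (rule eventually_mono) (use False in \<open>auto simp: indicator_def\<close>)
      qed measurable
      then show ?thesis by simp
    qed
    have "(LINT x|lborel. ?F x) = (LINT x|lborel. indicator {..b} x *\<^sub>R ?F x)"
      by (intro Bochner_Integration.integral_cong) (auto simp: indicator_def)
    then have tot: "(LINT x|lborel. ?F x) = 0" using half by simp
    show "set_lebesgue_integral lborel A ?F = 0"
    proof (rule integral_Borel_eq_0_if_atMost[OF int[OF that(1)] _ tot])
      show "set_lebesgue_integral lborel {..c} ?F = 0" for c
        unfolding set_lebesgue_integral_def by (rule half)
      show "A \<in> sets borel" using \<open>A \<in> sets lborel\<close> by simp
    qed
  qed
  \<comment> \<open>These intervals exhaust the half-line; the offsets make them nondegenerate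
    already at n = 0.\<close>
  have "AE x in lborel. \<forall>n. indicator {1 / (real n + 1)..real n + 2} x *\<^sub>R f x = 0"
    unfolding AE_all_countable
  proof
    fix n
    have "1 / (real n + 1) \<le> 1" by (simp add: divide_le_eq_1)
    then have "1 / (real n + 1) < real n + 2" by linarith
    then show "AE x in lborel. indicator {1 / (real n + 1)..real n + 2} x *\<^sub>R f x = 0"
      by (intro ab) auto
  qed
  then show ?thesis
  proof eventually_elim
    case (elim x)
    show ?case
    proof
      assume x: "0 < x"
      obtain n where n: "max x (1 / x) < real n" using reals_Archimedean2 by blast
      then have "1 / x < real n + 1" by simp
      then have "1 / (real n + 1) \<le> x" using x by (simp add: field_simps)
      then have "indicator {1 / (real n + 1)..real n + 2} x = (1::real)" using n by simp
      with elim[rule_format, of n] show "f x = 0" by simp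
    qed
  qed
qed

section \<open>Locally absolutely continuous functions and their product rule\<close>

text \<open>\<open>F\<close> is locally absolutely continuous on \<open>(0,\<infinity>)\<close> with almost everywhere derivative \<open>f\<close>.\<close>

definition has_ac_deriv :: "(real \<Rightarrow> 'b::euclidean_space) \<Rightarrow> (real \<Rightarrow> 'b) \<Rightarrow> bool" where
  "has_ac_deriv F f \<longleftrightarrow> f locally_integrable_on {0<..} \<and>
     (\<forall>a b. 0 < a \<longrightarrow> a \<le> b \<longrightarrow> F b - F a = (LINT x:{a..b}|lborel. f x))"

lemma has_ac_derivD:
  assumes "has_ac_deriv F f" "0 < a"
  shows "set_integrable lborel {a..b} f" "f integrable_on {a..b}"
    "a \<le> b \<Longrightarrow> F b - F a = (LINT x:{a..b}|lborel. f x)"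
    "a \<le> b \<Longrightarrow> F b - F a = integral {a..b} f"
proof -
  show *: "set_integrable lborel {a..b} f"
    using assms by (auto simp: has_ac_deriv_def locally_integrable_halfline_iff)
  then show "f integrable_on {a..b}" by (rule set_borel_integral_eq_integral)
  show "a \<le> b \<Longrightarrow> F b - F a = (LINT x:{a..b}|lborel. f x)"
    using assms by (auto simp: has_ac_deriv_def)
  then show "a \<le> b \<Longrightarrow> F b - F a = integral {a..b} f"
    using set_borel_integral_eq_integral(2)[OF *] by simp
qed

lemma has_ac_deriv_continuous:
  assumes "has_ac_deriv F f"
  shows "continuous_on {0<..} F"
proof (rule continuous_at_imp_continuous_on, rule ballI)
  fix x :: real assume "x \<in> {0<..}"
  then have x: "0 < x/2" "x/2 < x" by auto
  have "continuous_on {x/2..x+1} (\<lambda>y. F (x/2) + integral {x/2..y} f)"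
    using has_ac_derivD(2)[OF assms x(1)] by (intro continuous_intros indefinite_integral_continuous_1)
  moreover have "F (x/2) + integral {x/2..y} f = F y" if "y \<in> {x/2..x+1}" for y
    using has_ac_derivD(4)[OF assms x(1), of y] that by (simp add: algebra_simps)
  ultimately have "continuous_on {x/2..x+1} F" by (rule continuous_on_eq)
  then show "isCont F x"
    using x by (intro continuous_on_interior[of "{x/2..x+1}"]) auto
qed

lemma has_ac_deriv_measurable:
  assumes "has_ac_deriv F f"
  shows "(\<lambda>x. indicator {0<..} x *\<^sub>R F x) \<in> borel_measurable borel"
  using has_ac_deriv_continuous[OF assms]
  by (intro borel_measurable_continuous_on_indicator) auto

lemma ex_has_ac_deriv:
  assumes "f locally_integrable_on {0<..}"
  shows "\<exists>F. has_ac_deriv F f"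
proof -
  \<comment> \<open>The base point is 1 because \<open>f\<close> need not be integrable up to
    0.\<close>
  define F where "F x = (if 1 \<le> x then integral {1..x} f else - integral {x..1} f)" for x
  have si: "set_integrable lborel {a..b} f" if "0 < a" for a b
    using assms that by (auto simp: locally_integrable_halfline_iff)
  have int: "f integrable_on {a..b}" if "0 < a" for a b
    using si[OF that] by (rule set_borel_integral_eq_integral)
  have "F b - F a = (LINT x:{a..b}|lborel. f x)" if "0 < a" "a \<le> b" for a b
  proof -
    have "F b - F a = integral {a..b} f"
    proof -
      consider "1 \<le> a" | "b < 1" | "a < 1" "1 \<le> b" by linarith
      then show ?thesis
      proof cases
        case 1
        then show ?thesis
          using Henstock_Kurzweil_Integration.integral_combine[of 1 a b f] int that by (auto simp: F_def algebra_simps)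
      next
        case 2
        then show ?thesis
          using Henstock_Kurzweil_Integration.integral_combine[of a b 1 f] int that by (auto simp: F_def algebra_simps)
      next
        case 3
        then show ?thesis
          using Henstock_Kurzweil_Integration.integral_combine[of a 1 b f] int that by (auto simp: F_def algebra_simps)
      qed
    qed
    then show ?thesis using set_borel_integral_eq_integral(2)[OF si] that by simp
  qed
  with assms show ?thesis by (auto simp: has_ac_deriv_def)
qed

lemma has_ac_deriv_real:
  assumes "\<And>x. 0 < x \<Longrightarrow> (F has_real_derivative f x) (at x)" "continuous_on {0<..} f"
  shows "has_ac_deriv F f"
  unfolding has_ac_deriv_def locally_integrable_halfline_iff
proof (intro conjI allI impI)
  fix a b :: real assume a: "0 < a"
  have c: "continuous_on {a..b} f"
    using assms(2) by (rule continuous_on_subset) (use a in auto)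
  then show si: "set_integrable lborel {a..b} f"
    by (rule borel_integrable_atLeastAtMost')
  assume ab: "a \<le> b"
  have "(f has_integral F b - F a) {a..b}"
    using a by (intro fundamental_theorem_of_calculus ab)
      (auto simp flip: has_real_derivative_iff_has_vector_derivative intro!: has_field_derivative_at_within assms)
  then show "F b - F a = (LINT x:{a..b}|lborel. f x)"
    using set_borel_integral_eq_integral(2)[OF si] by (simp add: integral_unique)
qed

lemma integrable_scaleR_pair:
  fixes p :: "real \<Rightarrow> real" and q :: "real \<Rightarrow> 'b::euclidean_space"
  assumes p: "integrable lborel p" and q: "integrable lborel q"
  shows "integrable (lborel \<Otimes>\<^sub>M lborel) (\<lambda>(x, y). p x *\<^sub>R q y)"
proof (rule lborel_pair.Fubini_integrable)
  have [measurable]: "p \<in> borel_measurable borel" "q \<in> borel_measurable borel"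
    using p q borel_measurable_integrable by force+
  show "(\<lambda>(x, y). p x *\<^sub>R q y) \<in> borel_measurable (lborel \<Otimes>\<^sub>M lborel)" by measurable
  show "integrable lborel (\<lambda>x. LINT y|lborel. norm (case (x, y) of (x, y) \<Rightarrow> p x *\<^sub>R q y))"
    using p by simp
  show "AE x in lborel. integrable lborel (\<lambda>y. case (x, y) of (x, y) \<Rightarrow> p x *\<^sub>R q y)"
    using q by simp
qed

text \<open>The square \<open>{a..b} \<times> {a..b}\<close> is split along its diagonal and both halves are integrated by
  Fubini's theorem.\<close>

lemma has_ac_deriv_scaleR:
  fixes F :: "real \<Rightarrow> real" and G :: "real \<Rightarrow> 'b::euclidean_space"
  assumes F: "has_ac_deriv F f" and G: "has_ac_deriv G g"
  shows "has_ac_deriv (\<lambda>x. F x *\<^sub>R G x) (\<lambda>x. f x *\<^sub>R G x + F x *\<^sub>R g x)"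
  unfolding has_ac_deriv_def locally_integrable_halfline_iff
proof (intro conjI allI impI)
  fix a b :: real assume a: "0 < a"
  define p where "p x = indicator {a..b} x *\<^sub>R f x" for x
  define q where "q x = indicator {a..b} x *\<^sub>R g x" for x
  have p: "integrable lborel p" and q: "integrable lborel q"
    using has_ac_derivD(1)[OF F a] has_ac_derivD(1)[OF G a] by (simp_all add: p_def[abs_def] q_def[abs_def] set_integrable_def)
  have [measurable]: "p \<in> borel_measurable borel" "q \<in> borel_measurable borel"
    using p q borel_measurable_integrable by force+
  have Fa: "(LINT x|lborel. indicator {..y} x *\<^sub>R p x) = F y - F a" if "y \<in> {a..b}" for y
  proof -
    have "(\<lambda>x. indicator {..y} x *\<^sub>R p x) = (\<lambda>x. indicator {a..y} x *\<^sub>R f x)"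
      using that by (auto simp: p_def indicator_def)
    then show ?thesis using has_ac_derivD(3)[OF F a, of y] that by (simp add: set_lebesgue_integral_def)
  qed
  have Ga: "(LINT y|lborel. indicator {..<x} y *\<^sub>R q y) = G x - G a" if "x \<in> {a..b}" for x
  proof -
    have "(LINT y|lborel. indicator {..<x} y *\<^sub>R q y) = (LINT y|lborel. indicator {a..x} y *\<^sub>R q y)"
    proof (rule integral_cong_AE)
      show "AE y in lborel. indicator {..<x} y *\<^sub>R q y = indicator {a..x} y *\<^sub>R q y"
        using AE_lborel_singleton[of x] by (rule eventually_mono) (auto simp: q_def indicator_def)
    qed measurable
    also have "(\<lambda>y. indicator {a..x} y *\<^sub>R q y) = (\<lambda>y. indicator {a..x} y *\<^sub>R g y)"
      using that by (auto simp: q_def indicator_def)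
    also have "(LINT y|lborel. indicator {a..x} y *\<^sub>R g y) = G x - G a"
      using has_ac_derivD(3)[OF G a, of x] that by (simp add: set_lebesgue_integral_def)
    finally show ?thesis .
  qed
  let ?H = "\<lambda>(x, y). p x *\<^sub>R q y"
  \<comment> \<open>Only \<open>?U\<close> contains the diagonal, so the two triangles add up to
    \<open>?H\<close> at every point.\<close>
  let ?U = "\<lambda>(x, y). indicator {..y} x *\<^sub>R (p x *\<^sub>R q y)"
  let ?L = "\<lambda>(x, y). indicator {..<x} y *\<^sub>R (p x *\<^sub>R q y)"
  have H: "integrable (lborel \<Otimes>\<^sub>M lborel) ?H" by (rule integrable_scaleR_pair[OF p q])
  have U: "integrable (lborel \<Otimes>\<^sub>M lborel) ?U"
    by (rule Bochner_Integration.integrable_bound[OF H]) (auto simp: indicator_def)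
  have L: "integrable (lborel \<Otimes>\<^sub>M lborel) ?L"
    by (rule Bochner_Integration.integrable_bound[OF H]) (auto simp: indicator_def)
  have iU: "integrable lborel (\<lambda>y. LINT x|lborel. ?U (x, y))"
    using lborel_pair.integrable_snd[of "\<lambda>x y. ?U (x, y)"] U by simp
  have iL: "integrable lborel (\<lambda>x. LINT y|lborel. ?L (x, y))"
    using lborel_pair.integrable_fst'[OF L] by simp
  have eU: "(LINT x|lborel. ?U (x, y)) = (F y - F a) *\<^sub>R q y" for y
  proof (cases "y \<in> {a..b}")
    case True
    have "(LINT x|lborel. ?U (x, y)) = (LINT x|lborel. (indicator {..y} x *\<^sub>R p x) *\<^sub>R q y)" by simp
    also have "\<dots> = (LINT x|lborel. indicator {..y} x *\<^sub>R p x) *\<^sub>R q y"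
      using p by (intro integral_scaleR_left integrable_mult_indicator) auto
    finally show ?thesis using Fa[OF True] by simp
  qed (simp add: q_def)
  have eL: "(LINT y|lborel. ?L (x, y)) = p x *\<^sub>R (G x - G a)" for x
  proof (cases "x \<in> {a..b}")
    case True
    have "(LINT y|lborel. ?L (x, y)) = (LINT y|lborel. p x *\<^sub>R (indicator {..<x} y *\<^sub>R q y))"
      by (simp only: case_prod_conv scaleR_left_commute)
    also have "\<dots> = p x *\<^sub>R (LINT y|lborel. (indicator {..<x} y *\<^sub>R q y))"
      by (rule Bochner_Integration.integral_scaleR_right)
    finally show ?thesis using Ga[OF True] by simp
  qed (simp add: p_def)
  have "integral\<^sup>L (lborel \<Otimes>\<^sub>M lborel) ?H = integral\<^sup>L (lborel \<Otimes>\<^sub>M lborel) (\<lambda>z. ?U z + ?L z)"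
    by (intro Bochner_Integration.integral_cong) (auto simp: indicator_def)
  also have "\<dots> = (LINT y|lborel. (F y - F a) *\<^sub>R q y) + (LINT x|lborel. p x *\<^sub>R (G x - G a))"
    using U L lborel_pair.integral_snd[of "\<lambda>x y. ?U (x, y)"] lborel_pair.integral_fst'[OF L] eU eL by simp
  also have "integral\<^sup>L (lborel \<Otimes>\<^sub>M lborel) ?H = (LINT x|lborel. p x) *\<^sub>R (LINT y|lborel. q y)"
    using lborel_pair.integral_fst'[OF H] p by simp
  finally have parts: "(LINT x|lborel. p x) *\<^sub>R (LINT y|lborel. q y) =
     (LINT y|lborel. (F y - F a) *\<^sub>R q y) + (LINT x|lborel. p x *\<^sub>R (G x - G a))" .
  have i1: "integrable lborel (\<lambda>y. (F y - F a) *\<^sub>R q y)" using iU eU by simp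
  have i2: "integrable lborel (\<lambda>x. p x *\<^sub>R (G x - G a))" using iL eL by simp
  \<comment> \<open>Fubini gives integrability of the products with \<open>F x - F a\<close> and
    \<open>G x - G a\<close>; what remains are constants times \<open>p\<close> and
    \<open>q\<close>.\<close>
  have eq: "indicator {a..b} x *\<^sub>R (f x *\<^sub>R G x + F x *\<^sub>R g x) =
     ((F x - F a) *\<^sub>R q x + p x *\<^sub>R (G x - G a)) + (F a *\<^sub>R q x + p x *\<^sub>R G a)" for x
    by (simp add: p_def q_def algebra_simps)
  show "set_integrable lborel {a..b} (\<lambda>x. f x *\<^sub>R G x + F x *\<^sub>R g x)"
    unfolding set_integrable_def eq using i1 i2 p q by simp
  assume ab: "a \<le> b"
  have P: "(LINT x|lborel. p x) = F b - F a" and Q: "(LINT x|lborel. q x) = G b - G a"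
    using has_ac_derivD(3)[OF F a ab] has_ac_derivD(3)[OF G a ab]
    by (simp_all add: p_def q_def set_lebesgue_integral_def)
  have "(LINT x:{a..b}|lborel. f x *\<^sub>R G x + F x *\<^sub>R g x) =
     (LINT y|lborel. (F y - F a) *\<^sub>R q y) + (LINT x|lborel. p x *\<^sub>R (G x - G a)) +
     (F a *\<^sub>R (LINT x|lborel. q x) + (LINT x|lborel. p x) *\<^sub>R G a)"
    unfolding set_lebesgue_integral_def eq using i1 i2 p q by simp
  also have "\<dots> = F b *\<^sub>R G b - F a *\<^sub>R G a"
    unfolding parts[symmetric] P Q by (simp add: algebra_simps)
  finally show "F b *\<^sub>R G b - F a *\<^sub>R G a = (LINT x:{a..b}|lborel. f x *\<^sub>R G x + F x *\<^sub>R g x)" by simp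
qed

section \<open>Weak derivatives as derivatives of absolutely continuous functions\<close>

text \<open>The primitive that vanishes at \<open>a\<close> is constant on either side of the
  support of \<open>\<eta>\<close>; mean zero makes the constant on the right vanish too.\<close>

lemma ex_test_function_antideriv:
  assumes \<eta>: "continuous_on UNIV \<eta>" "0 < a" "a < b" "\<And>x. x \<notin> {a<..<b} \<Longrightarrow> \<eta> x = 0"
    and int: "(LINT x:{0<..}|lborel. \<eta> x) = 0"
  obtains \<psi> where "\<psi> \<in> test_functions {0<..}" "\<And>x. (\<psi> has_real_derivative \<eta> x) (at x)"
proof -
  obtain F where F: "\<And>x::real. (F has_vector_derivative \<eta> x) (at x)"
    using einterval_antiderivative[of "-\<infinity>" \<infinity> \<eta>] \<eta>(1) by (auto simp: continuous_on_eq_continuous_at)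
  define \<psi> where "\<psi> x = F x - F a" for x
  have d: "(\<psi> has_real_derivative \<eta> x) (at x)" for x
    unfolding \<psi>_def using F[of x]
    by (auto simp: has_real_derivative_iff_has_vector_derivative intro!: derivative_eq_intros)
  have ftc: "(\<eta> has_integral \<psi> y - \<psi> x) {x..y}" if "x \<le> y" for x y
    using that d by (intro fundamental_theorem_of_calculus)
      (auto simp flip: has_real_derivative_iff_has_vector_derivative intro: has_field_derivative_at_within)
  have z: "\<psi> y = \<psi> x" if "x \<le> y" "\<And>t. t \<in> {x..y} \<Longrightarrow> \<eta> t = 0" for x y
  proof -
    have "(\<eta> has_integral 0) {x..y}" using that by (intro has_integral_is_0) auto
    with ftc[OF that(1)] show ?thesis by (auto dest: has_integral_unique)
  qed
  have a: "\<psi> a = 0" by (simp add: \<psi>_def)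
  have "set_integrable lborel {a..b} \<eta>"
    using \<eta>(1) by (intro borel_integrable_atLeastAtMost' continuous_on_subset[OF \<eta>(1)]) auto
  then have "(LINT x:{a..b}|lborel. \<eta> x) = \<psi> b - \<psi> a"
    using ftc[of a b] \<eta>(3) by (auto simp: set_borel_integral_eq_integral(2) integral_unique)
  moreover have "(\<lambda>x. indicator {a..b} x *\<^sub>R \<eta> x) = (\<lambda>x. indicator {0<..} x *\<^sub>R \<eta> x)"
  proof
    show "indicator {a..b} x *\<^sub>R \<eta> x = indicator {0<..} x *\<^sub>R \<eta> x" for x
      using \<eta>(2,3) \<eta>(4)[of x] by (cases "x \<in> {a<..<b}") auto
  qed
  ultimately have b: "\<psi> b = 0" using int a by (simp add: set_lebesgue_integral_def)
  have "\<psi> x = 0 \<and> \<eta> x = 0" if "x \<notin> {a<..<b}" for x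
  proof
    show "\<eta> x = 0" using that \<eta> by blast
    consider "x \<le> a" | "b \<le> x" using \<open>x \<notin> {a<..<b}\<close> by force
    then show "\<psi> x = 0"
    proof cases
      case 1 then show ?thesis using z[of x a] a \<eta> by auto
    next
      case 2 then show ?thesis using z[of b x] b \<eta> by auto
    qed
  qed
  then have "\<psi> \<in> test_functions {0<..}"
    unfolding test_functions_halfline_iff using d \<eta>(1-3) by blast
  then show thesis using d that by blast
qed

lemma test_function_integral_by_parts:
  assumes \<psi>: "\<psi> \<in> test_functions {0<..}" "\<And>x. (\<psi> has_real_derivative \<psi>' x) (at x)"
    and U: "has_ac_deriv U v"
  shows "(LINT x:{0<..}|lborel. \<psi>' x *\<^sub>R U x) = - (LINT x:{0<..}|lborel. \<psi> x *\<^sub>R v x)"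
    and "set_integrable lborel {0<..} (\<lambda>x. \<psi>' x *\<^sub>R U x)"
    and "set_integrable lborel {0<..} (\<lambda>x. \<psi> x *\<^sub>R v x)"
proof -
  obtain a b where c: "continuous_on UNIV \<psi>'" and ab: "0 < a" "a < b"
    and z: "\<And>x. x \<notin> {a<..<b} \<Longrightarrow> \<psi> x = 0 \<and> \<psi>' x = 0"
  proof -
    from \<psi>(1) obtain D a b where "\<And>x. (\<psi> has_real_derivative D x) (at x)" "continuous_on UNIV D"
      "0 < a" "a < b" "\<And>x. x \<notin> {a<..<b} \<Longrightarrow> \<psi> x = 0 \<and> D x = 0"
      unfolding test_functions_halfline_iff by blast
    moreover from this(1) \<psi>(2) have "D = \<psi>'" using DERIV_unique by blast
    ultimately show thesis using that by blast
  qed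
  have c\<psi>: "continuous_on UNIV \<psi>" using \<psi>(2) by (intro DERIV_continuous_on) auto
  have ac: "has_ac_deriv (\<lambda>x. \<psi> x *\<^sub>R U x) (\<lambda>x. \<psi>' x *\<^sub>R U x + \<psi> x *\<^sub>R v x)"
    using \<psi>(2) c by (intro has_ac_deriv_scaleR U has_ac_deriv_real) (auto intro: continuous_on_subset)
  have ind: "(\<lambda>x. indicator {0<..} x *\<^sub>R h x) = (\<lambda>x. indicator {a..b} x *\<^sub>R h x)"
    if "\<And>x. x \<notin> {a<..<b} \<Longrightarrow> h x = 0" for h :: "real \<Rightarrow> 'a"
    using that ab by (auto simp: indicator_def fun_eq_iff)
  have s: "set_integrable lborel {0<..} h \<longleftrightarrow> set_integrable lborel {a..b} h"
    "(LINT x:{0<..}|lborel. h x) = (LINT x:{a..b}|lborel. h x)"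
    if "\<And>x. x \<notin> {a<..<b} \<Longrightarrow> h x = 0" for h :: "real \<Rightarrow> 'a"
    using ind[of h, OF that] by (simp_all add: set_integrable_def set_lebesgue_integral_def)
  have "continuous_on {a..b} (\<lambda>x. \<psi>' x *\<^sub>R U x)"
    using ab by (intro continuous_intros continuous_on_subset[OF has_ac_deriv_continuous[OF U]]
       continuous_on_subset[OF c]) auto
  then have i1: "set_integrable lborel {a..b} (\<lambda>x. \<psi>' x *\<^sub>R U x)"
    by (rule borel_integrable_atLeastAtMost')
  \<comment> \<open>Integrability of the second summand is obtained from that of the whole
    derivative, the first summand being continuous.\<close>
  have "set_integrable lborel {a..b} (\<lambda>x. (\<psi>' x *\<^sub>R U x + \<psi> x *\<^sub>R v x) - \<psi>' x *\<^sub>R U x)"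
    using has_ac_derivD(1)[OF ac] ab i1 by (intro set_integral_diff) auto
  then have i2: "set_integrable lborel {a..b} (\<lambda>x. \<psi> x *\<^sub>R v x)" by simp
  show "set_integrable lborel {0<..} (\<lambda>x. \<psi>' x *\<^sub>R U x)"
    "set_integrable lborel {0<..} (\<lambda>x. \<psi> x *\<^sub>R v x)"
    using i1 i2 z by (subst s(1); force)+
  have "(LINT x:{a..b}|lborel. \<psi>' x *\<^sub>R U x) + (LINT x:{a..b}|lborel. \<psi> x *\<^sub>R v x) =
    \<psi> b *\<^sub>R U b - \<psi> a *\<^sub>R U a"
    using has_ac_derivD(3)[OF ac, of a b] ab i1 i2 by simp
  also have "\<dots> = 0" using z[of a] z[of b] by simp
  finally show "(LINT x:{0<..}|lborel. \<psi>' x *\<^sub>R U x) = - (LINT x:{0<..}|lborel. \<psi> x *\<^sub>R v x)"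
    using z by (subst (1 2) s(2)) (auto simp: add_eq_0_iff2)
qed

text \<open>Du Bois-Reymond: the difference \<open>k\<close> of \<open>u\<close> and a primitive of
  \<open>v\<close> is orthogonal to derivatives of test functions, in particular to test functions
  of mean zero. Correcting an arbitrary test function by a multiple of one fixed bump then shows
  that \<open>k\<close> is constant almost everywhere.\<close>

lemma weak_derivative_has_ac_deriv:
  fixes u v :: "real \<Rightarrow> 'b::euclidean_space"
  assumes weak: "has_weak_partial {0<..} 1 u v"
  shows "\<exists>U. has_ac_deriv U v \<and> (AE x in lborel. 0 < x \<longrightarrow> u x = U x)"
proof -
  have u: "u locally_integrable_on {0<..}" and v: "v locally_integrable_on {0<..}"
    using weak by (auto simp: has_weak_partial_def)
  from ex_has_ac_deriv[OF v] obtain V where V: "has_ac_deriv V v" by blast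
  define k where "k x = u x - V x" for x
  have "set_integrable lborel {a..b} V" if "0 < a" for a b
    using that by (intro borel_integrable_atLeastAtMost' continuous_on_subset[OF has_ac_deriv_continuous[OF V]]) auto
  then have k: "k locally_integrable_on {0<..}"
    using u by (auto simp: locally_integrable_halfline_iff k_def[abs_def])
  have mult: "set_integrable lborel {0<..} (\<lambda>x. \<eta> x *\<^sub>R h x)"
    if \<eta>: "continuous_on UNIV \<eta>" "0 < a" "\<And>x. x \<notin> {a<..<b} \<Longrightarrow> \<eta> x = 0"
      and h: "h locally_integrable_on {0<..}"
    for \<eta> :: "real \<Rightarrow> real" and h :: "real \<Rightarrow> 'b" and a b
  proof -
    have "bounded (\<eta> ` {a..b})"
      by (intro compact_imp_bounded compact_continuous_image continuous_on_subset[OF \<eta>(1)]) auto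
    then have "\<exists>B. \<forall>x\<in>{a..b}. \<bar>\<eta> x\<bar> \<le> B" by (simp add: bounded_iff)
    then obtain B where B: "\<And>x. x \<in> {a..b} \<Longrightarrow> \<bar>\<eta> x\<bar> \<le> B" by blast
    have i: "integrable lborel (\<lambda>x. indicator {a..b} x *\<^sub>R h x)"
      using h \<eta>(2) by (auto simp: locally_integrable_halfline_iff set_integrable_def)
    have [measurable]: "\<eta> \<in> borel_measurable borel" using \<eta>(1) by (rule borel_measurable_continuous_onI)
    have [measurable]: "(\<lambda>x. indicator {a..b} x *\<^sub>R h x) \<in> borel_measurable borel" using borel_measurable_integrable[OF i] by simp
    have "integrable lborel (\<lambda>x. \<eta> x *\<^sub>R (indicator {a..b} x *\<^sub>R h x))"
    proof (rule Bochner_Integration.integrable_bound)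
      show "integrable lborel (\<lambda>x. B *\<^sub>R (indicator {a..b} x *\<^sub>R h x))"
        using i by (intro Bochner_Integration.integrable_scaleR_right)
      show "AE x in lborel. norm (\<eta> x *\<^sub>R (indicator {a..b} x *\<^sub>R h x)) \<le> norm (B *\<^sub>R (indicator {a..b} x *\<^sub>R h x))"
      proof (intro AE_I2)
        fix x
        show "norm (\<eta> x *\<^sub>R (indicator {a..b} x *\<^sub>R h x)) \<le> norm (B *\<^sub>R (indicator {a..b} x *\<^sub>R h x))"
          using B[of x] by (auto simp: indicator_def intro!: mult_right_mono)
      qed
    qed measurable
    moreover have "\<eta> x *\<^sub>R (indicator {a..b} x *\<^sub>R h x) = indicator {0<..} x *\<^sub>R (\<eta> x *\<^sub>R h x)" for x
      using \<eta>(2) \<eta>(3)[of x] by (cases "x \<in> {a<..<b}") auto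
    ultimately show ?thesis by (simp only: set_integrable_def)
  qed
  have test: "(LINT x:{0<..}|lborel. \<psi>' x *\<^sub>R k x) = 0"
    if \<psi>: "\<psi> \<in> test_functions {0<..}" "\<And>x. (\<psi> has_real_derivative \<psi>' x) (at x)" for \<psi> \<psi>'
  proof -
    obtain D a b where D: "\<And>x. (\<psi> has_real_derivative D x) (at x)" "continuous_on UNIV D"
      "0 < a" "\<And>x. x \<notin> {a<..<b} \<Longrightarrow> D x = 0"
      using \<psi>(1) unfolding test_functions_halfline_iff by blast
    then have D': "D = \<psi>'" using \<psi>(2) DERIV_unique by blast
    have "frechet_derivative \<psi> (at x) 1 = \<psi>' x" for x
      using \<psi>(2) by (rule frechet_derivative_real_1)
    moreover have "(LINT x:{0<..}|lborel. frechet_derivative \<psi> (at x) 1 *\<^sub>R u x) =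
      - (LINT x:{0<..}|lborel. \<psi> x *\<^sub>R v x)"
      using weak \<psi>(1) unfolding has_weak_partial_def by blast
    ultimately have "(LINT x:{0<..}|lborel. \<psi>' x *\<^sub>R u x) = - (LINT x:{0<..}|lborel. \<psi> x *\<^sub>R v x)"
      by simp
    then show ?thesis
      using test_function_integral_by_parts[OF \<psi> V] mult[OF D(2-4) u]
      by (simp add: k_def scaleR_diff_right D')
  qed
  define \<eta>0 where "\<eta>0 = bump 1 2 1"
  have \<eta>0: "\<eta>0 \<in> test_functions {0<..}" unfolding \<eta>0_def by (rule bump_test_function) auto
  have c\<eta>0: "continuous_on UNIV \<eta>0"
    using \<eta>0 unfolding test_functions_halfline_iff by (auto intro: DERIV_continuous_on)
  have s\<eta>0: "x \<notin> {1<..<2} \<Longrightarrow> \<eta>0 x = 0" for x unfolding \<eta>0_def by (rule bump_outside) auto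
  have int_test: "set_integrable lborel {0<..} \<eta>"
    if \<eta>: "continuous_on UNIV \<eta>" "0 < a" "\<And>x. x \<notin> {a<..<b} \<Longrightarrow> \<eta> x = 0" for \<eta> :: "real \<Rightarrow> real" and a b
  proof -
    have "set_integrable lborel {a..b} \<eta>"
      by (intro borel_integrable_atLeastAtMost' continuous_on_subset[OF \<eta>(1)]) auto
    moreover have "indicator {a..b} x *\<^sub>R \<eta> x = indicator {0<..} x *\<^sub>R \<eta> x" for x
      using \<eta>(2) \<eta>(3)[of x] by (cases "x \<in> {a<..<b}") auto
    ultimately show ?thesis by (simp only: set_integrable_def)
  qed
  define J where "J = (LINT x:{0<..}|lborel. \<eta>0 x)"
  \<comment> \<open>Otherwise the bump would have a test function as primitive; this is
    nondecreasing and zero at both ends, hence zero, although the bump is positive at 3/2.\<close>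
  have "J \<noteq> 0"
  proof
    assume "J = 0"
    obtain \<psi> where \<psi>: "\<psi> \<in> test_functions {0<..}" "\<And>x. (\<psi> has_real_derivative \<eta>0 x) (at x)"
      by (rule ex_test_function_antideriv[OF c\<eta>0 _ _ s\<eta>0]) (use \<open>J = 0\<close> in \<open>auto simp: J_def\<close>)
    obtain D a b where D: "\<And>x. x \<notin> {a<..<b} \<Longrightarrow> \<psi> x = 0" "a < b"
      using \<psi>(1) unfolding test_functions_halfline_iff by blast
    have mono: "\<psi> x \<le> \<psi> y" if "x \<le> y" for x y
      using that \<psi>(2) bump_range(1)[of 1 2 1] by (intro DERIV_nonneg_imp_nondecreasing[OF that]) (auto simp: \<eta>0_def)
    have "\<psi> x = 0" for x
    proof -
      have "\<psi> (min x a) \<le> \<psi> x" "\<psi> x \<le> \<psi> (max x b)" by (auto intro!: mono)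
      then show ?thesis using D(1)[of "min x a"] D(1)[of "max x b"] D(2) by auto
    qed
    then have "(\<psi> has_real_derivative 0) (at (3/2))" by (simp add: \<open>\<And>x. \<psi> x = 0\<close>[THEN ext])
    then have "\<eta>0 (3/2) = 0" using \<psi>(2) DERIV_unique by blast
    then show False by (simp add: \<eta>0_def bump_def)
  qed
  \<comment> \<open>The mean of \<open>k\<close> with weight \<open>\<eta>0\<close>: the only
    possible value if \<open>k\<close> is constant.\<close>
  define c where "c = (1 / J) *\<^sub>R (LINT x:{0<..}|lborel. \<eta>0 x *\<^sub>R k x)"
  have "AE x in lborel. 0 < x \<longrightarrow> k x - c = 0"
  proof (rule AE_eq_0_if_test_functions)
    show "(\<lambda>x. k x - c) locally_integrable_on {0<..}"
      unfolding locally_integrable_halfline_iff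
    proof (intro allI impI set_integral_diff(1))
      show "set_integrable lborel {a..b} k" if "0 < a" for a b
        using k that by (auto simp: locally_integrable_halfline_iff)
      show "set_integrable lborel {a..b} (\<lambda>x. c)" for a b :: real
        by (intro borel_integrable_atLeastAtMost') auto
    qed
    fix \<eta> :: "real \<Rightarrow> real" assume "\<eta> \<in> test_functions {0<..}"
    then obtain D a b where D: "\<And>x. (\<eta> has_real_derivative D x) (at x)" and
      ab: "0 < a" "a < b" and s: "\<And>x. x \<notin> {a<..<b} \<Longrightarrow> \<eta> x = 0"
      unfolding test_functions_halfline_iff by blast
    have c\<eta>: "continuous_on UNIV \<eta>" using D by (intro DERIV_continuous_on) auto
    define I where "I = (LINT x:{0<..}|lborel. \<eta> x)"
    \<comment> \<open>The multiple of \<open>\<eta>0\<close> is chosen to make the mean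
      zero.\<close>
    let ?\<zeta> = "\<lambda>x. \<eta> x - I / J * \<eta>0 x"
    have i: "set_integrable lborel {0<..} \<eta>" "set_integrable lborel {0<..} \<eta>0"
      by (rule int_test[OF c\<eta> ab(1) s], assumption) (rule int_test[OF c\<eta>0 zero_less_one s\<eta>0], assumption)
    have ik: "set_integrable lborel {0<..} (\<lambda>x. \<eta> x *\<^sub>R k x)" "set_integrable lborel {0<..} (\<lambda>x. \<eta>0 x *\<^sub>R k x)"
      by (rule mult[OF c\<eta> ab(1) s k], assumption) (rule mult[OF c\<eta>0 zero_less_one s\<eta>0 k], assumption)
    have "(LINT x:{0<..}|lborel. ?\<zeta> x) = 0"
      using i \<open>J \<noteq> 0\<close> by (simp add: I_def flip: J_def)
    moreover have "continuous_on UNIV ?\<zeta>" by (intro continuous_intros c\<eta> c\<eta>0)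
    moreover have "?\<zeta> x = 0" if "x \<notin> {min a 1<..<max b 2}" for x
    proof -
      have "x \<notin> {a<..<b}" "x \<notin> {1<..<2}" using that by auto
      then show ?thesis using s s\<eta>0 by simp
    qed
    ultimately obtain \<psi> where "\<psi> \<in> test_functions {0<..}" "\<And>x. (\<psi> has_real_derivative ?\<zeta> x) (at x)"
      using ex_test_function_antideriv[of ?\<zeta> "min a 1" "max b 2"] ab by (auto simp: less_max_iff_disj min_less_iff_disj)
    then have "(LINT x:{0<..}|lborel. ?\<zeta> x *\<^sub>R k x) = 0" by (rule test)
    moreover have "?\<zeta> x *\<^sub>R k x = \<eta> x *\<^sub>R k x - (I / J) *\<^sub>R (\<eta>0 x *\<^sub>R k x)" for x
      by (simp add: scaleR_diff_left)
    ultimately have "(LINT x:{0<..}|lborel. \<eta> x *\<^sub>R k x - (I / J) *\<^sub>R (\<eta>0 x *\<^sub>R k x)) = 0"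
      by (simp only:)
    moreover have "(LINT x:{0<..}|lborel. \<eta> x *\<^sub>R k x - (I / J) *\<^sub>R (\<eta>0 x *\<^sub>R k x)) =
      (LINT x:{0<..}|lborel. \<eta> x *\<^sub>R k x) - (I / J) *\<^sub>R (LINT x:{0<..}|lborel. \<eta>0 x *\<^sub>R k x)"
      by (simp only: set_integral_diff(2)[OF ik(1) set_integrable_scaleR_right[OF ik(2)]]
          set_integral_scaleR_right)
    ultimately have "(LINT x:{0<..}|lborel. \<eta> x *\<^sub>R k x) = I *\<^sub>R c"
      by (simp add: c_def)
    moreover have "(LINT x:{0<..}|lborel. \<eta> x *\<^sub>R c) = I *\<^sub>R c"
    proof -
      have "(LINT x:{0<..}|lborel. \<eta> x *\<^sub>R c) = (LINT x|lborel. (indicator {0<..} x *\<^sub>R \<eta> x) *\<^sub>R c)"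
        by (simp add: set_lebesgue_integral_def)
      also have "\<dots> = I *\<^sub>R c"
        unfolding I_def set_lebesgue_integral_def using i(1)
        by (intro integral_scaleR_left) (simp add: set_integrable_def)
      finally show ?thesis .
    qed
    moreover have "set_integrable lborel {0<..} (\<lambda>x. \<eta> x *\<^sub>R c)"
      using i(1) by auto
    ultimately show "(LINT x:{0<..}|lborel. \<eta> x *\<^sub>R (k x - c)) = 0"
      using ik by (simp add: scaleR_diff_right)
  qed
  then have "AE x in lborel. 0 < x \<longrightarrow> u x = V x + c"
    by (rule eventually_mono) (auto simp: k_def algebra_simps)
  moreover have "has_ac_deriv (\<lambda>x. V x + c) v"
    using V by (simp add: has_ac_deriv_def)
  ultimately show ?thesis by blast
qed

text \<open>This determines \<open>radial_deriv\<close>, a choice by \<open>SOME\<close>, almost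
  everywhere. The primitives \<open>V\<close> and \<open>W\<close> provide the integrability for
  subtracting the two test identities.\<close>

lemma weak_derivative_unique:
  fixes u v w :: "real \<Rightarrow> 'b::euclidean_space"
  assumes v: "has_weak_partial {0<..} 1 u v" and w: "has_weak_partial {0<..} 1 u w"
  shows "AE x in lborel. 0 < x \<longrightarrow> v x = w x"
proof -
  from weak_derivative_has_ac_deriv[OF v] obtain V where V: "has_ac_deriv V v"
    by blast
  have vl: "v locally_integrable_on {0<..}" and wl: "w locally_integrable_on {0<..}"
    using v w by (auto simp: has_weak_partial_def)
  from ex_has_ac_deriv[OF wl] obtain W where W: "has_ac_deriv W w" by blast
  have "AE x in lborel. 0 < x \<longrightarrow> v x - w x = 0"
  proof (rule AE_eq_0_if_test_functions)
    show "(\<lambda>x. v x - w x) locally_integrable_on {0<..}"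
      using vl wl by (auto simp: locally_integrable_halfline_iff)
    fix \<phi> :: "real \<Rightarrow> real" assume \<phi>: "\<phi> \<in> test_functions {0<..}"
    then obtain D where D: "\<And>x. (\<phi> has_real_derivative D x) (at x)"
      unfolding test_functions_halfline_iff by blast
    have "(LINT x:{0<..}|lborel. \<phi> x *\<^sub>R v x) = (LINT x:{0<..}|lborel. \<phi> x *\<^sub>R w x)"
      using v w \<phi> by (simp add: has_weak_partial_def)
    then show "(LINT x:{0<..}|lborel. \<phi> x *\<^sub>R (v x - w x)) = 0"
      using test_function_integral_by_parts(3)[OF \<phi> D V] test_function_integral_by_parts(3)[OF \<phi> D W]
      by (simp add: scaleR_diff_right)
  qed
  then show ?thesis by (rule eventually_mono) auto
qed

section \<open>Vanishing of boundary values at 0 and at infinity\<close>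

text \<open>On \<open>[c, 2c]\<close> the function \<open>k\<close> stays close to \<open>k c\<close>, while \<open>1/x\<close> has integral at least
  \<open>1/2\<close>.\<close>

lemma has_ac_deriv_tail_bound:
  fixes k :: "real \<Rightarrow> real"
  assumes k: "has_ac_deriv k k'" and c: "0 < c"
    and i1: "set_integrable lborel {0<..} k'" and i2: "set_integrable lborel {0<..} (\<lambda>x. k x / x)"
  shows "\<bar>k c\<bar> \<le> (LINT x:{c..2*c}|lborel. \<bar>k' x\<bar>) + 2 * (LINT x:{c..2*c}|lborel. \<bar>k x / x\<bar>)"
proof -
  let ?e = "LINT x:{c..2*c}|lborel. \<bar>k' x\<bar>"
  have sub: "set_integrable lborel {c..2*c} (\<lambda>x. \<bar>h x\<bar>)" "set_integrable lborel {c..x} (\<lambda>x. \<bar>h x\<bar>)"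
    "set_integrable lborel {c..x} h"
    if "set_integrable lborel {0<..} h" for h :: "real \<Rightarrow> real" and x
    using c by (auto intro!: set_integrable_abs set_integrable_subset[OF that])
  have near: "\<bar>k c\<bar> - ?e \<le> \<bar>k x\<bar>" if x: "x \<in> {c..2*c}" for x
  proof -
    have "\<bar>k x - k c\<bar> = \<bar>LINT x:{c..x}|lborel. k' x\<bar>"
      using has_ac_derivD(3)[OF k c, of x] x by simp
    also have "\<dots> \<le> (LINT x:{c..x}|lborel. \<bar>k' x\<bar>)"
      using set_integral_norm_bound[OF sub(3)[OF i1]] by simp
    also have "\<dots> \<le> ?e"
      using sub(1)[OF i1] sub(2)[OF i1, of x] x unfolding set_lebesgue_integral_def set_integrable_def
      by (intro integral_mono) (auto simp: indicator_def)
    finally show ?thesis by linarith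
  qed
  have cc: "set_integrable lborel {c..2*c} (\<lambda>x::real. (\<bar>k c\<bar> - ?e) / (2 * c))"
    by (intro borel_integrable_atLeastAtMost') auto
  show ?thesis
  proof (cases "\<bar>k c\<bar> \<le> ?e")
    case True
    have "0 \<le> (LINT x:{c..2*c}|lborel. \<bar>k x / x\<bar>)"
      unfolding set_lebesgue_integral_def by (intro Bochner_Integration.integral_nonneg) auto
    with True show ?thesis by linarith
  next
    case False
    \<comment> \<open>On the window [c, 2c], of length c, the modulus of \<open>k\<close> is at
      least the positive number \<open>\<bar>k c\<bar> - ?e\<close>, and 1/x is at least
      1/(2c).\<close>
    have "(\<bar>k c\<bar> - ?e) / 2 = (LINT x:{c..2*c}|lborel. (\<bar>k c\<bar> - ?e) / (2 * c))"
      using c by (simp add: set_integral_const set_lebesgue_integral_def field_simps)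
    also have "\<dots> \<le> (LINT x:{c..2*c}|lborel. \<bar>k x / x\<bar>)"
    proof (rule set_integral_mono[OF cc sub(1)[OF i2]])
      fix x assume x: "x \<in> {c..2*c}"
      have "(\<bar>k c\<bar> - ?e) / (2 * c) \<le> (\<bar>k c\<bar> - ?e) / x"
        using x c False by (intro divide_left_mono) auto
      also have "\<dots> \<le> \<bar>k x\<bar> / x" using near[OF x] x c by (intro divide_right_mono) auto
      finally show "(\<bar>k c\<bar> - ?e) / (2 * c) \<le> \<bar>k x / x\<bar>" using x c by (simp add: abs_divide)
    qed
    finally have "(\<bar>k c\<bar> - ?e) / 2 \<le> (LINT x:{c..2*c}|lborel. \<bar>k x / x\<bar>)" .
    moreover have "p \<le> e + 2 * q" if "(p - e) / 2 \<le> q" for p e q :: real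
      using that by simp
    ultimately show ?thesis by blast
  qed
qed

text \<open>The tail bound is used on windows [c, 2c] that move to 0 and to infinity. Every fixed
  point eventually leaves them, so the bounds tend to 0 and \<open>k\<close> vanishes in the limit
  at both ends.\<close>

lemma has_ac_deriv_integral_eq_0:
  fixes k :: "real \<Rightarrow> real"
  assumes k: "has_ac_deriv k k'"
    and i1: "set_integrable lborel {0<..} k'" and i2: "set_integrable lborel {0<..} (\<lambda>x. k x / x)"
  shows "(LINT x:{0<..}|lborel. k' x) = 0"
proof -
  \<comment> \<open>Dominated convergence with moving domains; it serves both the escaping windows
    and the intervals that exhaust the half-line.\<close>
  have dc: "(\<lambda>n. LINT x:S n|lborel. h x) \<longlonglongrightarrow> (LINT x:T|lborel. h x)"
    if h: "set_integrable lborel {0<..} h" and S: "\<And>n. S n \<subseteq> {0<..}" "T \<subseteq> {0<..}"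
      and m[measurable]: "\<And>n. S n \<in> sets borel" "T \<in> sets borel"
      and ev: "\<And>x. x > 0 \<Longrightarrow> \<forall>\<^sub>F n in sequentially. x \<in> S n \<longleftrightarrow> x \<in> T" for h :: "real \<Rightarrow> real" and S T
    unfolding set_lebesgue_integral_def
  proof (rule integral_dominated_convergence)
    let ?h = "\<lambda>x. indicator {0<..} x *\<^sub>R h x"
    have i: "integrable lborel ?h" using h by (simp add: set_integrable_def)
    then show "integrable lborel (\<lambda>x. norm (?h x))" by (rule integrable_norm)
    have [measurable]: "?h \<in> borel_measurable borel" using borel_measurable_integrable[OF i] by simp
    have e: "indicator (S n) x *\<^sub>R h x = indicator (S n) x *\<^sub>R ?h x" "indicator T x *\<^sub>R h x = indicator T x *\<^sub>R ?h x" for n x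
      using S by (auto simp: indicator_def)
    show "(\<lambda>x. indicator T x *\<^sub>R h x) \<in> borel_measurable lborel"
      "(\<lambda>x. indicator (S n) x *\<^sub>R h x) \<in> borel_measurable lborel" for n
      unfolding e by measurable
    show "AE x in lborel. norm (indicator (S n) x *\<^sub>R h x) \<le> norm (?h x)" for n
      using S by (intro AE_I2) (auto simp: indicator_def)
    show "AE x in lborel. (\<lambda>n. indicator (S n) x *\<^sub>R h x) \<longlonglongrightarrow> indicator T x *\<^sub>R h x"
    proof (intro AE_I2)
      fix x show "(\<lambda>n. indicator (S n) x *\<^sub>R h x) \<longlonglongrightarrow> indicator T x *\<^sub>R h x"
      proof (cases "0 < x")
        case True
        from ev[OF this] have "\<forall>\<^sub>F n in sequentially. indicator (S n) x *\<^sub>R h x = indicator T x *\<^sub>R h x"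
          by eventually_elim (auto simp: indicator_def)
        then show ?thesis by (rule tendsto_eventually)
      next
        case False
        then have "x \<notin> S n" "x \<notin> T" for n using S by force+
        then show ?thesis by simp
      qed
    qed
  qed
  define a where "a n = 1 / (real n + 1)" for n
  define b where "b n = real n + 1" for n
  have a: "0 < a n" "a n \<le> b n" for n
  proof -
    have "a n \<le> 1" "1 \<le> b n" by (simp_all add: a_def b_def divide_le_eq_1)
    then show "a n \<le> b n" by linarith
  qed (simp add: a_def)
  have b: "0 < b n" for n by (simp add: b_def)
  have a0: "a \<longlonglongrightarrow> 0" unfolding a_def using LIMSEQ_inverse_real_of_nat by (simp add: inverse_eq_divide add.commute)
  have binf: "filterlim b at_top sequentially"
    unfolding b_def using filterlim_tendsto_add_at_top[OF tendsto_const[of 1] filterlim_real_sequentially] by (simp add: add.commute)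
  have eva: "\<forall>\<^sub>F n in sequentially. 2 * a n < x" if "0 < x" for x
    using order_tendstoD(2)[OF tendsto_mult_right_zero[OF a0, of 2] that] .
  have evb: "\<forall>\<^sub>F n in sequentially. x < b n" for x
    using binf by (simp add: filterlim_at_top_dense)
  have lim: "(\<lambda>n. k (c n)) \<longlonglongrightarrow> 0"
    if c: "\<And>n. 0 < c n" and ev: "\<And>x. x > 0 \<Longrightarrow> \<forall>\<^sub>F n in sequentially. x \<notin> {c n..2 * c n}" for c :: "nat \<Rightarrow> real"
  proof (rule Lim_null_comparison)
    show "\<forall>\<^sub>F n in sequentially. norm (k (c n)) \<le>
       (LINT x:{c n..2*c n}|lborel. \<bar>k' x\<bar>) + 2 * (LINT x:{c n..2*c n}|lborel. \<bar>k x / x\<bar>)"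
      using has_ac_deriv_tail_bound[OF k c i1 i2] by simp
    have "(\<lambda>n. LINT x:{c n..2 * c n}|lborel. h x) \<longlonglongrightarrow> (LINT x:{}|lborel. h x)"
      if "set_integrable lborel {0<..} h" for h :: "real \<Rightarrow> real"
    proof (intro dc that)
      show "{c n..2 * c n} \<subseteq> {0<..}" for n using c[of n] by auto
      show "\<forall>\<^sub>F n in sequentially. (x \<in> {c n..2 * c n}) = (x \<in> {})" if "0 < x" for x
        using ev[OF that] by eventually_elim simp
    qed auto
    from this[OF set_integrable_abs[OF i1]] this[OF set_integrable_abs[OF i2]]
    show "(\<lambda>n. (LINT x:{c n..2*c n}|lborel. \<bar>k' x\<bar>) + 2 * (LINT x:{c n..2*c n}|lborel. \<bar>k x / x\<bar>)) \<longlonglongrightarrow> 0"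
      by (auto intro!: tendsto_eq_intros simp: set_lebesgue_integral_def)
  qed
  have "(\<lambda>n. k (b n) - k (a n)) \<longlonglongrightarrow> 0 - 0"
  proof (intro tendsto_diff lim a b)
    fix x :: real assume "0 < x"
    from eva[OF this] show "\<forall>\<^sub>F n in sequentially. x \<notin> {a n..2 * a n}"
      by eventually_elim simp
    from evb[of x] show "\<forall>\<^sub>F n in sequentially. x \<notin> {b n..2 * b n}"
      by eventually_elim simp
  qed
  moreover have "(\<lambda>n. LINT x:{a n..b n}|lborel. k' x) \<longlonglongrightarrow> (LINT x:{0<..}|lborel. k' x)"
  proof (rule dc[OF i1])
    fix x :: real assume "0 < x"
    from eva[OF this] evb[of x] show "\<forall>\<^sub>F n in sequentially. x \<in> {a n..b n} \<longleftrightarrow> x \<in> {0<..}"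
    proof eventually_elim
      case (elim n)
      then show ?case using a(1)[of n] \<open>0 < x\<close> by auto
    qed
  next
    show "{a n..b n} \<subseteq> {0<..}" for n using a(1)[of n] by auto
  qed auto
  moreover have "(LINT x:{a n..b n}|lborel. k' x) = k (b n) - k (a n)" for n
    using has_ac_derivD(3)[OF k a] by simp
  ultimately show ?thesis by (simp add: LIMSEQ_unique)
qed

section \<open>Polar coordinates in the plane\<close>

definition radius_measure :: "real measure" where
  "radius_measure = density lborel (\<lambda>r. ennreal (indicator {0<..} r * r))"

text \<open>The value 1 at the origin keeps \<open>dir\<close> on the unit circle everywhere, so
  radius times direction returns z without exception.\<close>

definition dir :: "complex \<Rightarrow> complex" where
  "dir z = (if z = 0 then 1 else z /\<^sub>R cmod z)"

text \<open>Twice the area of the sector of the unit disc over a set of directions is the arc length.\<close>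

definition circle_measure :: "complex measure" where
  "circle_measure = distr (density lborel (\<lambda>z. 2 * indicator (cball 0 1) z)) borel dir"

lemma dir_measurable [measurable]: "dir \<in> borel_measurable borel"
  unfolding dir_def by measurable

lemma norm_dir [simp]: "cmod (dir z) = 1"
  by (simp add: dir_def)

lemma cmod_scaleR_dir [simp]: "cmod z *\<^sub>R dir z = z"
  by (simp add: dir_def)

lemma dir_scaleR: "0 < r \<Longrightarrow> dir (r *\<^sub>R z) = dir z"
  by (simp add: dir_def)

lemma sets_radius_measure [simp, measurable_cong]: "sets radius_measure = sets borel"
  and space_radius_measure [simp]: "space radius_measure = UNIV"
  and sets_circle_measure [simp, measurable_cong]: "sets circle_measure = sets borel"
  and space_circle_measure [simp]: "space circle_measure = UNIV"
  by (simp_all add: radius_measure_def circle_measure_def)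

lemma emeasure_circle_measure:
  assumes [measurable]: "B \<in> sets borel"
  shows "emeasure circle_measure B = 2 * emeasure lborel (cball 0 1 \<inter> dir -` B)"
proof -
  have [measurable]: "dir -` B \<in> sets borel" by (rule measurable_sets_borel[OF dir_measurable assms])
  have "emeasure circle_measure B = (\<integral>\<^sup>+z. 2 * indicator (cball 0 1) z * indicator (dir -` B) z \<partial>lborel)"
    unfolding circle_measure_def
    by (subst emeasure_distr, simp, simp, subst emeasure_density, measurable) auto
  also have "\<dots> = (\<integral>\<^sup>+z. 2 * indicator (cball 0 1 \<inter> dir -` B) z \<partial>lborel)"
    by (intro nn_integral_cong) (auto simp: indicator_def)
  also have "\<dots> = 2 * emeasure lborel (cball 0 1 \<inter> dir -` B)"
    by (subst nn_integral_cmult_indicator) auto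
  finally show ?thesis .
qed

lemma finite_measure_circle_measure: "finite_measure circle_measure"
proof
  have "emeasure lborel (cball 0 1 :: complex set) < \<infinity>" by (rule emeasure_lborel_cball_finite)
  then show "emeasure circle_measure (space circle_measure) \<noteq> \<infinity>"
    by (simp add: emeasure_circle_measure ennreal_mult_eq_top_iff)
qed

interpretation circle_measure: finite_measure circle_measure
  by (rule finite_measure_circle_measure)

lemma sigma_finite_radius_measure: "sigma_finite_measure radius_measure"
  unfolding radius_measure_def
  by (subst sigma_finite_measure.sigma_finite_iff_density_finite[OF sigma_finite_lborel]) auto

interpretation polar: pair_sigma_finite radius_measure circle_measure
  by (intro pair_sigma_finite.intro sigma_finite_radius_measure circle_measure.sigma_finite_measure_axioms)

lemma emeasure_radius_measure_atMost:
  assumes "0 \<le> R" shows "emeasure radius_measure {..R} = ennreal (R\<^sup>2 / 2)"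
proof -
  have "emeasure radius_measure {..R} = (\<integral>\<^sup>+r. ennreal r * indicator {0..R} r \<partial>lborel)"
    unfolding radius_measure_def
    by (subst emeasure_density) (auto intro!: nn_integral_cong simp: indicator_def)
  also have "\<dots> = ennreal (R\<^sup>2 / 2 - 0\<^sup>2 / 2)"
    using assms by (intro nn_integral_FTC_Icc)
       (auto intro!: derivative_eq_intros)
  finally show ?thesis by simp
qed

lemma emeasure_lborel_scaled:
  fixes A :: "complex set"
  assumes [measurable]: "A \<in> sets borel" and R: "0 < R"
  shows "emeasure lborel {z. z /\<^sub>R R \<in> A} = ennreal (R\<^sup>2) * emeasure lborel A"
proof -
  have m[measurable]: "{z. z /\<^sub>R R \<in> A} \<in> sets borel"
  proof -
    have "(\<lambda>z. z /\<^sub>R R) -` A \<inter> space borel \<in> sets borel"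
      by (rule measurable_sets[of _ borel borel]) auto
    then show ?thesis by (simp add: vimage_def)
  qed
  have "emeasure lborel {z. z /\<^sub>R R \<in> A} = emeasure (density (distr lborel borel (\<lambda>z. 0 + R *\<^sub>R z)) (\<lambda>_. \<bar>R\<bar> ^ DIM(complex))) {z. z /\<^sub>R R \<in> A}"
    using R by (subst lborel_affine[of R 0]) auto
  also have "\<dots> = ennreal (R\<^sup>2) * emeasure lborel ((\<lambda>z. R *\<^sub>R z) -` {z. z /\<^sub>R R \<in> A})"
    using R by (simp add: emeasure_density nn_integral_cmult emeasure_distr)
  also have "(\<lambda>z. R *\<^sub>R z) -` {z. z /\<^sub>R R \<in> A} = A" using R by auto
  finally show ?thesis .
qed

text \<open>It suffices to take \<open>A = {..R}\<close>, where both sides scale like \<open>R\<^sup>2\<close>.\<close>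

lemma polar_emeasure:
  assumes A[measurable]: "A \<in> sets borel" and B[measurable]: "B \<in> sets borel"
  shows "emeasure radius_measure A * emeasure circle_measure B = emeasure lborel {z. cmod z \<in> A \<and> dir z \<in> B}"
proof -
  \<comment> \<open>With \<open>B\<close> fixed, both sides become measures of the set
    \<open>A\<close> of radii.\<close>
  let ?M = "distr (density lborel (indicator (dir -` B))) borel cmod"
  let ?N = "density radius_measure (\<lambda>_. emeasure circle_measure B)"
  have [measurable]: "dir -` B \<in> sets borel" by (rule measurable_sets_borel[OF dir_measurable B])
  have M: "emeasure ?M X = emeasure lborel {z. cmod z \<in> X \<and> dir z \<in> B}" if [measurable]: "X \<in> sets borel" for X
  proof -
    have [measurable]: "cmod -` X \<in> sets borel" by (rule measurable_sets_borel[of cmod borel]) auto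
    have "emeasure ?M X = (\<integral>\<^sup>+z. indicator (dir -` B) z * indicator (cmod -` X) z \<partial>lborel)"
      by (simp add: emeasure_distr emeasure_density)
    also have "\<dots> = (\<integral>\<^sup>+z. indicator (cmod -` X \<inter> dir -` B) z \<partial>lborel)"
      by (intro nn_integral_cong) (auto simp: indicator_def)
    also have "\<dots> = emeasure lborel (cmod -` X \<inter> dir -` B)" by (rule nn_integral_indicator) auto
    also have "cmod -` X \<inter> dir -` B = {z. cmod z \<in> X \<and> dir z \<in> B}" by auto
    finally show ?thesis .
  qed
  have N: "emeasure ?N X = emeasure radius_measure X * emeasure circle_measure B" if [measurable]: "X \<in> sets borel" for X
    by (simp add: emeasure_density nn_integral_multc mult.commute)
  have eq: "emeasure ?M {..R} = emeasure ?N {..R}" for R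
  proof (cases "0 < R")
    case True
    have "{z. cmod z \<in> {..R} \<and> dir z \<in> B} = {z. z /\<^sub>R R \<in> cball 0 1 \<inter> dir -` B}"
      using True dir_scaleR[of "inverse R"] by (auto simp: field_simps)
    then have "emeasure ?M {..R} = ennreal (R\<^sup>2) * emeasure lborel (cball 0 1 \<inter> dir -` B)"
      using emeasure_lborel_scaled[OF _ True, of "cball 0 1 \<inter> dir -` B"] by (subst M) auto
    \<comment> \<open>R^2/2 is the radial mass of [0,R], and the 2 is the normalisation of
      \<open>circle_measure\<close>.\<close>
    also have "ennreal (R\<^sup>2) = ennreal (R\<^sup>2 / 2) * 2"
      by (simp flip: ennreal_numeral ennreal_mult)
    finally show ?thesis
      using True by (subst N) (simp_all add: emeasure_radius_measure_atMost emeasure_circle_measure mult.assoc)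
  next
    \<comment> \<open>For R \<le> 0 at most the radius 0 remains, and both measures give it mass
      zero.\<close>
    case False
    have "emeasure ?M {..R} \<le> emeasure ?M {..0}" using False by (intro emeasure_mono) auto
    also have "\<dots> \<le> emeasure lborel {0::complex}"
      by (subst M, simp, rule emeasure_mono) auto
    finally have "emeasure ?M {..R} = 0" by simp
    moreover have "emeasure radius_measure {..R} \<le> emeasure radius_measure {..0}"
      using False by (intro emeasure_mono) auto
    then have "emeasure radius_measure {..R} = 0" by (simp add: emeasure_radius_measure_atMost)
    ultimately show ?thesis by (simp add: N)
  qed
  have "?M = ?N"
  proof (rule measure_eqI_generator_eq[where E = "range (\<lambda>a::real. {..a})" and \<Omega> = UNIV
        and A = "\<lambda>n. {..real n}"])
    show "Int_stable (range (\<lambda>a::real. {..a}))" by (auto simp: Int_stable_def)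
    show "range (\<lambda>a::real. {..a}) \<subseteq> Pow UNIV" by simp
    show "sets ?M = sigma_sets UNIV (range (\<lambda>a::real. {..a}))"
      "sets ?N = sigma_sets UNIV (range (\<lambda>a::real. {..a}))" by (simp_all add: borel_eq_atMost)
    show "range (\<lambda>n. {..real n}) \<subseteq> range (\<lambda>a::real. {..a})" by auto
    show "(\<Union>n. {..real n}) = UNIV" using real_arch_simple by auto
    show "emeasure ?M {..real n} \<noteq> \<infinity>" for n
    proof -
      have "emeasure ?M {..real n} \<le> emeasure lborel (cball (0::complex) (real n))"
        by (subst M) (auto intro!: emeasure_mono)
      also have "\<dots> < \<infinity>" by (rule emeasure_lborel_cball_finite)
      finally show ?thesis by simp
    qed
  next
    fix X assume "X \<in> range (\<lambda>a::real. {..a})"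
    then show "emeasure ?M X = emeasure ?N X" using eq by blast
  qed
  then show ?thesis using M[OF A] N[OF A] by simp
qed

text \<open>Rectangles identify the product measure as the image of Lebesgue measure under the map
  from z to its modulus and direction; multiplying the two undoes this map. The form with
  \<open>distr\<close> lets integrals be transported by \<open>integral_distr\<close>.\<close>

lemma lborel_polar:
  "lborel = distr (radius_measure \<Otimes>\<^sub>M circle_measure) borel (\<lambda>(r, \<omega>). r *\<^sub>R \<omega>)"
proof -
  let ?f = "\<lambda>z. (cmod z, dir z)"
  have m: "?f \<in> lborel \<rightarrow>\<^sub>M borel \<Otimes>\<^sub>M borel" by measurable
  have s: "sets (borel \<Otimes>\<^sub>M borel) = sets (radius_measure \<Otimes>\<^sub>M circle_measure)"
    by (intro sets_pair_measure_cong) simp_all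
  have "radius_measure \<Otimes>\<^sub>M circle_measure = distr lborel (borel \<Otimes>\<^sub>M borel) ?f"
  proof (rule pair_measure_eqI)
    fix A B assume "A \<in> sets radius_measure" "B \<in> sets circle_measure"
    then have [measurable]: "A \<in> sets borel" "B \<in> sets borel" by simp_all
    have "?f -` (A \<times> B) \<inter> space lborel = {z. cmod z \<in> A \<and> dir z \<in> B}" by auto
    then show "emeasure radius_measure A * emeasure circle_measure B =
        emeasure (distr lborel (borel \<Otimes>\<^sub>M borel) ?f) (A \<times> B)"
      using m by (simp add: emeasure_distr polar_emeasure)
  next
    show "sets (radius_measure \<Otimes>\<^sub>M circle_measure) = sets (distr lborel (borel \<Otimes>\<^sub>M borel) ?f)"
      unfolding sets_distr by (rule s[symmetric])
  qed (rule sigma_finite_radius_measure circle_measure.sigma_finite_measure_axioms)+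
  then have "distr (radius_measure \<Otimes>\<^sub>M circle_measure) borel (\<lambda>(r, \<omega>). r *\<^sub>R \<omega>) =
      distr (distr lborel (borel \<Otimes>\<^sub>M borel) ?f) borel (\<lambda>(r, \<omega>). r *\<^sub>R \<omega>)" by simp
  also have "\<dots> = distr lborel borel ((\<lambda>(r, \<omega>). r *\<^sub>R \<omega>) \<circ> ?f)"
    by (rule distr_distr) (use m in measurable)
  also have "\<dots> = distr lborel borel (\<lambda>z. z)" by (simp add: comp_def)
  also have "\<dots> = lborel" by (rule distr_id2) simp
  finally show ?thesis by simp
qed

text \<open>The length of the circle enters the identities below as a factor, and positivity is what
  allows it to be divided out.\<close>

lemma measure_circle_measure_pos: "0 < measure circle_measure UNIV"
proof -
  have "emeasure lborel (cball 0 1 :: complex set) > 0"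
    by (simp add: emeasure_cball zero_less_iff_neq_zero unit_ball_vol_2)
  then have "emeasure circle_measure UNIV > 0"
    by (simp add: emeasure_circle_measure ennreal_zero_less_mult_iff)
  then show ?thesis
    by (simp add: circle_measure.emeasure_eq_measure)
qed

lemma AE_circle_measure: "AE \<omega> in circle_measure. cmod \<omega> = 1"
  unfolding circle_measure_def by (subst AE_distr_iff) auto

lemma AE_radius_measure: "AE r in radius_measure. 0 < r"
  unfolding radius_measure_def by (subst AE_density) (auto simp: indicator_def)

lemma AE_polar: "AE p in radius_measure \<Otimes>\<^sub>M circle_measure. 0 < fst p \<and> cmod (snd p) = 1"
proof (rule polar.AE_pair_measure)
  show "{x \<in> space (radius_measure \<Otimes>\<^sub>M circle_measure). 0 < fst x \<and> cmod (snd x) = 1}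
      \<in> sets (radius_measure \<Otimes>\<^sub>M circle_measure)"
    by measurable
  show "AE r in radius_measure. AE \<omega> in circle_measure. 0 < fst (r, \<omega>) \<and> cmod (snd (r, \<omega>)) = 1"
    using AE_radius_measure by eventually_elim (use AE_circle_measure in auto)
qed

section \<open>Averages over circles\<close>

text \<open>Averaging projects to angular frequency 0. At radii where \<open>H\<close> is not
  integrable over the circle, the value is the default 0 of the integral.\<close>

definition circle_avg :: "(complex \<Rightarrow> complex) \<Rightarrow> real \<Rightarrow> complex" where
  "circle_avg H r = (LINT \<omega>|circle_measure. H (r *\<^sub>R \<omega>)) /\<^sub>R measure circle_measure UNIV"

lemma circle_avg_measurable [measurable]:
  assumes [measurable]: "H \<in> borel_measurable borel"
  shows "circle_avg H \<in> borel_measurable borel"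
  unfolding circle_avg_def by measurable

lemma circle_avg_radial: "0 < r \<Longrightarrow> (\<lambda>z. h (cmod z)) \<in> borel_measurable borel \<Longrightarrow> circle_avg (\<lambda>z. h (cmod z)) r = h r"
proof -
  assume r: "0 < r" and [measurable]: "(\<lambda>z. h (cmod z)) \<in> borel_measurable borel"
  have "(LINT \<omega>|circle_measure. h (cmod (r *\<^sub>R \<omega>))) = (LINT \<omega>|circle_measure. h r)"
  proof (rule integral_cong_AE)
    have "(\<lambda>\<omega>. h (cmod (r *\<^sub>R \<omega>))) \<in> borel_measurable borel"
      by (rule measurable_compose[of "\<lambda>\<omega>. r *\<^sub>R \<omega>" borel borel]) measurable
    then show "(\<lambda>\<omega>. h (cmod (r *\<^sub>R \<omega>))) \<in> borel_measurable circle_measure" by simp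
    show "AE \<omega> in circle_measure. h (cmod (r *\<^sub>R \<omega>)) = h r"
      using AE_circle_measure by eventually_elim (use r in simp)
  qed simp
  then show ?thesis using measure_circle_measure_pos by (simp add: circle_avg_def)
qed

lemma radius_measure_set_integral:
  fixes f :: "real \<Rightarrow> 'b::{banach, second_countable_topology}"
  assumes [measurable]: "f \<in> borel_measurable borel"
  shows "integrable radius_measure f \<longleftrightarrow> set_integrable lborel {0<..} (\<lambda>r. r *\<^sub>R f r)"
    and "integral\<^sup>L radius_measure f = (LINT r:{0<..}|lborel. r *\<^sub>R f r)"
  unfolding radius_measure_def set_integrable_def set_lebesgue_integral_def
  by (subst integrable_density integral_density; auto simp: indicator_def)+

lemma integral_polar_average:
  assumes [measurable]: "g \<in> borel_measurable borel" "H \<in> borel_measurable borel"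
    and int: "integrable lborel (\<lambda>z. g (cmod z) *\<^sub>R H z)"
  shows "(LINT z|lborel. g (cmod z) *\<^sub>R H z) =
      measure circle_measure UNIV *\<^sub>R (LINT r:{0<..}|lborel. (r * g r) *\<^sub>R circle_avg H r)"
    and "set_integrable lborel {0<..} (\<lambda>r. (r * g r) *\<^sub>R circle_avg H r)"
proof -
  let ?P = "radius_measure \<Otimes>\<^sub>M circle_measure"
  let ?f = "\<lambda>(r, \<omega>). g (cmod (r *\<^sub>R \<omega>)) *\<^sub>R H (r *\<^sub>R \<omega>)"
  let ?F = "\<lambda>(r, \<omega>). g r *\<^sub>R H (r *\<^sub>R \<omega>)"
  have m: "(\<lambda>(r, \<omega>). r *\<^sub>R \<omega>) \<in> ?P \<rightarrow>\<^sub>M (borel :: complex measure)" by measurable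
  have mf: "?f \<in> borel_measurable ?P" and mF: "?F \<in> borel_measurable ?P" by measurable
  \<comment> \<open>Off the null set where r \<le> 0 or \<omega> is not a unit vector, the modulus
    of r \<omega> is r, so the radial factor can leave the angular integral.\<close>
  have ae: "AE p in ?P. ?f p = ?F p"
    using AE_polar by (rule eventually_mono) auto
  have mh: "(\<lambda>z. g (cmod z) *\<^sub>R H z) \<in> borel_measurable borel" by measurable
  have f: "?f = (\<lambda>p. (\<lambda>z. g (cmod z) *\<^sub>R H z) (case p of (r, \<omega>) \<Rightarrow> r *\<^sub>R \<omega>))"
    by (auto simp: fun_eq_iff)
  have "integrable ?P ?f"
    using int integrable_distr_eq[OF m mh] unfolding lborel_polar[symmetric] f by blast
  then have F: "integrable ?P ?F" using integrable_cong_AE[OF mf mF ae] by simp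
  have avg: "(LINT \<omega>|circle_measure. ?F (r, \<omega>)) = measure circle_measure UNIV *\<^sub>R (g r *\<^sub>R circle_avg H r)" for r
    using measure_circle_measure_pos by (simp add: circle_avg_def)
  have "(LINT z|lborel. g (cmod z) *\<^sub>R H z) = integral\<^sup>L ?P ?f"
    using integral_distr[OF m mh] unfolding lborel_polar[symmetric] f .
  also have "\<dots> = integral\<^sup>L ?P ?F" by (rule integral_cong_AE[OF mf mF ae])
  also have "\<dots> = (LINT r|radius_measure. measure circle_measure UNIV *\<^sub>R (g r *\<^sub>R circle_avg H r))"
    unfolding avg[symmetric] by (rule polar.integral_fst'[OF F, symmetric])
  also have "\<dots> = measure circle_measure UNIV *\<^sub>R (LINT r|radius_measure. g r *\<^sub>R circle_avg H r)"
    by (rule Bochner_Integration.integral_scaleR_right)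
  also have "(LINT r|radius_measure. g r *\<^sub>R circle_avg H r) = (LINT r:{0<..}|lborel. (r * g r) *\<^sub>R circle_avg H r)"
    by (simp add: radius_measure_set_integral)
  finally show "(LINT z|lborel. g (cmod z) *\<^sub>R H z) =
      measure circle_measure UNIV *\<^sub>R (LINT r:{0<..}|lborel. (r * g r) *\<^sub>R circle_avg H r)" .
  have "integrable radius_measure (\<lambda>r. measure circle_measure UNIV *\<^sub>R (g r *\<^sub>R circle_avg H r))"
    unfolding avg[symmetric] by (rule polar.integrable_fst'[OF F])
  then have "integrable radius_measure
      (\<lambda>r. (1 / measure circle_measure UNIV) *\<^sub>R (measure circle_measure UNIV *\<^sub>R (g r *\<^sub>R circle_avg H r)))"
    by (rule Bochner_Integration.integrable_scaleR_right)
  then have "integrable radius_measure (\<lambda>r. g r *\<^sub>R circle_avg H r)"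
    using measure_circle_measure_pos by simp
  then show "set_integrable lborel {0<..} (\<lambda>r. (r * g r) *\<^sub>R circle_avg H r)"
    by (simp add: radius_measure_set_integral)
qed

text \<open>Cauchy-Schwarz on each circle, whose length is finite, followed by Tonelli in polar
  coordinates.\<close>

lemma circle_avg_square_integrable:
  assumes [measurable]: "H \<in> borel_measurable borel"
    and int: "integrable lborel (\<lambda>z. (cmod (H z))\<^sup>2)"
  shows "set_integrable lborel {0<..} (\<lambda>r. r * (cmod (circle_avg H r))\<^sup>2)"
proof -
  let ?P = "radius_measure \<Otimes>\<^sub>M circle_measure"
  let ?\<kappa> = "emeasure circle_measure UNIV"
  have CS: "ennreal ((cmod (LINT \<omega>|circle_measure. H (r *\<^sub>R \<omega>)))\<^sup>2) \<le>
      (\<integral>\<^sup>+\<omega>. ennreal ((cmod (H (r *\<^sub>R \<omega>)))\<^sup>2) \<partial>circle_measure) * ?\<kappa>" for r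
  proof -
    have "ennreal (cmod (LINT \<omega>|circle_measure. H (r *\<^sub>R \<omega>))) \<le> (\<integral>\<^sup>+\<omega>. ennreal (cmod (H (r *\<^sub>R \<omega>))) * 1 \<partial>circle_measure)"
    \<comment> \<open>On a circle where \<open>H\<close> is not integrable, the left-hand side is
      the default 0.\<close>
    proof (cases "integrable circle_measure (\<lambda>\<omega>. H (r *\<^sub>R \<omega>))")
      case True
      then show ?thesis using integral_norm_bound_ennreal[OF True] by simp
    qed (simp add: not_integrable_integral_eq)
    then have "(ennreal (cmod (LINT \<omega>|circle_measure. H (r *\<^sub>R \<omega>))))\<^sup>2 \<le> (\<integral>\<^sup>+\<omega>. ennreal (cmod (H (r *\<^sub>R \<omega>))) * 1 \<partial>circle_measure)\<^sup>2"
      by (rule power_mono) simp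
    also have "\<dots> \<le> (\<integral>\<^sup>+\<omega>. (ennreal (cmod (H (r *\<^sub>R \<omega>))))\<^sup>2 \<partial>circle_measure) * (\<integral>\<^sup>+\<omega>. 1\<^sup>2 \<partial>circle_measure)"
      by (rule Cauchy_Schwarz_nn_integral) measurable
    finally show ?thesis by (simp add: ennreal_power)
  qed
  have m: "(\<lambda>(r, \<omega>). r *\<^sub>R \<omega>) \<in> ?P \<rightarrow>\<^sub>M (borel :: complex measure)" by measurable
  have "(\<integral>\<^sup>+r. ennreal ((cmod (LINT \<omega>|circle_measure. H (r *\<^sub>R \<omega>)))\<^sup>2) \<partial>radius_measure) \<le>
      (\<integral>\<^sup>+r. (\<integral>\<^sup>+\<omega>. ennreal ((cmod (H (r *\<^sub>R \<omega>)))\<^sup>2) \<partial>circle_measure) * ?\<kappa> \<partial>radius_measure)"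
    by (intro nn_integral_mono CS)
  also have "\<dots> = (\<integral>\<^sup>+r. (\<integral>\<^sup>+\<omega>. ennreal ((cmod (H (r *\<^sub>R \<omega>)))\<^sup>2) \<partial>circle_measure) \<partial>radius_measure) * ?\<kappa>"
    by (rule nn_integral_multc) measurable
  also have "(\<integral>\<^sup>+r. (\<integral>\<^sup>+\<omega>. ennreal ((cmod (H (r *\<^sub>R \<omega>)))\<^sup>2) \<partial>circle_measure) \<partial>radius_measure) =
      (\<integral>\<^sup>+p. ennreal ((cmod (H (fst p *\<^sub>R snd p)))\<^sup>2) \<partial>?P)"
    by (subst circle_measure.nn_integral_fst[symmetric]) simp_all
  also have "\<dots> = (\<integral>\<^sup>+z. ennreal ((cmod (H z))\<^sup>2) \<partial>lborel)"
    by (subst lborel_polar, subst nn_integral_distr[OF m]) (simp_all add: case_prod_unfold)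
  also have "\<dots> * ?\<kappa> < \<infinity>"
  proof -
    have "(\<integral>\<^sup>+z. ennreal ((cmod (H z))\<^sup>2) \<partial>lborel) < \<infinity>"
      using int by (simp add: integrable_iff_bounded)
    then show ?thesis by (simp add: ennreal_mult_less_top circle_measure.emeasure_eq_measure)
  qed
  finally have "integrable radius_measure (\<lambda>r. (cmod (LINT \<omega>|circle_measure. H (r *\<^sub>R \<omega>)))\<^sup>2)"
    by (intro integrableI_bounded) simp_all
  then have "integrable radius_measure (\<lambda>r. (cmod (LINT \<omega>|circle_measure. H (r *\<^sub>R \<omega>)))\<^sup>2 / (measure circle_measure UNIV)\<^sup>2)"
    by simp
  moreover have "(cmod (circle_avg H r))\<^sup>2 = (cmod (LINT \<omega>|circle_measure. H (r *\<^sub>R \<omega>)))\<^sup>2 / (measure circle_measure UNIV)\<^sup>2" for r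
    by (simp add: circle_avg_def power_mult_distrib divide_inverse power_inverse mult.commute)
  ultimately have "integrable radius_measure (\<lambda>r. (cmod (circle_avg H r))\<^sup>2)" by simp
  then show ?thesis by (simp add: radius_measure_set_integral)
qed

section \<open>Radial parts of equivariant functions\<close>

lemma locally_integrable_UNIV_measurable:
  fixes f :: "'a::euclidean_space \<Rightarrow> 'b::{banach, second_countable_topology}"
  assumes "f locally_integrable_on UNIV"
  shows "f \<in> borel_measurable borel"
proof (rule borel_measurable_LIMSEQ_metric)
  fix n :: nat
  have "set_integrable lborel (cball 0 (real n)) f"
    using assms by (simp add: locally_integrable_on_def)
  then show "(\<lambda>x. indicator (cball 0 (real n)) x *\<^sub>R f x) \<in> borel_measurable borel"
    unfolding set_integrable_def using borel_measurable_integrable by force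
next
  fix x :: 'a
  obtain N where "norm x \<le> real N" using real_arch_simple by blast
  then have "\<forall>\<^sub>F n in sequentially. indicator (cball 0 (real n)) x *\<^sub>R f x = f x"
    unfolding eventually_sequentially by (intro exI[of _ N]) auto
  then show "(\<lambda>n. indicator (cball 0 (real n)) x *\<^sub>R f x) \<longlonglongrightarrow> f x"
    by (rule tendsto_eventually)
qed

lemma integrable_mult_continuous_compact_support:
  fixes \<eta> w :: "complex \<Rightarrow> complex"
  assumes \<eta>: "continuous_on UNIV \<eta>" "\<And>z. b < cmod z \<Longrightarrow> \<eta> z = 0"
    and w: "w locally_integrable_on UNIV"
  shows "integrable lborel (\<lambda>z. \<eta> z * w z)"
proof -
  have [measurable]: "w \<in> borel_measurable borel" by (rule locally_integrable_UNIV_measurable[OF w])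
  have [measurable]: "\<eta> \<in> borel_measurable borel" using \<eta>(1) by (rule borel_measurable_continuous_onI)
  have "bounded (\<eta> ` cball 0 b)"
    by (intro compact_imp_bounded compact_continuous_image continuous_on_subset[OF \<eta>(1)]) auto
  then have "\<exists>B. \<forall>z\<in>cball 0 b. cmod (\<eta> z) \<le> B" by (simp add: bounded_iff)
  then obtain B where B: "\<And>z. z \<in> cball 0 b \<Longrightarrow> cmod (\<eta> z) \<le> B" by blast
  show ?thesis
  proof (rule Bochner_Integration.integrable_bound)
    have "set_integrable lborel (cball 0 b) w" using w by (simp add: locally_integrable_on_def)
    then show "integrable lborel (\<lambda>z. B *\<^sub>R (indicator (cball 0 b) z *\<^sub>R w z))"
      unfolding set_integrable_def by (rule Bochner_Integration.integrable_scaleR_right)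
    show "AE z in lborel. cmod (\<eta> z * w z) \<le> cmod (B *\<^sub>R (indicator (cball 0 b) z *\<^sub>R w z))"
    proof (intro AE_I2)
      fix z
      show "cmod (\<eta> z * w z) \<le> cmod (B *\<^sub>R (indicator (cball 0 b) z *\<^sub>R w z))"
      proof (cases "cmod z \<le> b")
        case True
        then have "cmod (\<eta> z) \<le> \<bar>B\<bar>" using B[of z] by auto
        with True show ?thesis by (simp add: norm_mult mult_right_mono)
      next
        case False
        then show ?thesis using \<eta>(2)[of z] by simp
      qed
    qed
  qed measurable
qed

text \<open>\<open>has_weak_partial\<close> is tested with real functions only. Applying it to real
  and imaginary parts admits complex test functions, which can carry a phase.\<close>

lemma weak_partial_complex_test:
  fixes w g \<eta> :: "complex \<Rightarrow> complex"
  assumes weak: "has_weak_partial UNIV e w g" and e: "e \<in> Basis"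
    and d: "\<And>z. (\<eta> has_derivative \<eta>' z) (at z)"
    and c: "\<And>e. e \<in> Basis \<Longrightarrow> continuous_on UNIV (\<lambda>z. \<eta>' z e)"
    and z: "\<And>z. b < cmod z \<Longrightarrow> \<eta> z = 0"
  shows "(LINT z|lborel. \<eta>' z e * w z) = - (LINT z|lborel. \<eta> z * g z)"
    and "integrable lborel (\<lambda>z. \<eta>' z e * w z)" "integrable lborel (\<lambda>z. \<eta> z * g z)"
proof -
  have w: "w locally_integrable_on UNIV" and g: "g locally_integrable_on UNIV"
    using weak by (auto simp: has_weak_partial_def)
  have c\<eta>: "continuous_on UNIV \<eta>"
    using d by (auto intro!: continuous_at_imp_continuous_on has_derivative_continuous)
  \<comment> \<open>The derivative vanishes outside the closed ball too, because the exterior is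
    open.\<close>
  have z': "\<eta>' z h = 0" if "b < cmod z" for z h
  proof -
    have "open {z. b < cmod z}" by (intro open_Collect_less continuous_intros)
    then have "((\<lambda>_. 0) has_derivative \<eta>' z) (at z)"
      using that assms(5) by (intro has_derivative_transform_within_open[OF d[of z], of "{z. b < cmod z}"]) auto
    moreover have "((\<lambda>_. 0::complex) has_derivative (\<lambda>_. 0)) (at z)" by (rule has_derivative_const)
    ultimately have "\<eta>' z = (\<lambda>_. 0)" by (rule has_derivative_unique)
    then show ?thesis by simp
  qed
  have part: "(LINT z|lborel. L (\<eta>' z e) *\<^sub>R w z) = - (LINT z|lborel. L (\<eta> z) *\<^sub>R g z)"
    "integrable lborel (\<lambda>z. L (\<eta>' z e) *\<^sub>R w z)" "integrable lborel (\<lambda>z. L (\<eta> z) *\<^sub>R g z)"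
    if L: "bounded_linear L" for L :: "complex \<Rightarrow> real"
  proof -
    have dL: "((\<lambda>z. L (\<eta> z)) has_derivative (\<lambda>h. L (\<eta>' z h))) (at z)" for z
      using bounded_linear.has_derivative[OF L d] .
    have cL: "continuous_on UNIV (\<lambda>z. L (f z))" if "continuous_on UNIV f" for f :: "complex \<Rightarrow> complex"
      using bounded_linear.continuous_on[OF L that] .
    have fd: "frechet_derivative (\<lambda>z. L (\<eta> z)) (at z) = (\<lambda>h. L (\<eta>' z h))" for z
      by (rule frechet_derivative_at[OF dL, symmetric])
    have "closure {z. L (\<eta> z) \<noteq> 0} \<subseteq> cball 0 b"
    proof (rule closure_minimal)
      show "{z. L (\<eta> z) \<noteq> 0} \<subseteq> cball 0 b"
      proof
        fix x assume "x \<in> {z. L (\<eta> z) \<noteq> 0}"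
        then have "\<eta> x \<noteq> 0" using linear_simps(3)[OF L] by auto
        then show "x \<in> cball 0 b" using z[of x] by force
      qed
    qed simp
    moreover from this have "compact (closure {z. L (\<eta> z) \<noteq> 0})"
      by (metis closed_closure compact_cball compact_Int_closed inf.absorb_iff2)
    moreover have "(\<lambda>z. L (\<eta> z)) differentiable (at z)" for z
      using dL by (rule differentiableI)
    ultimately have "(\<lambda>z. L (\<eta> z)) \<in> test_functions UNIV"
      using cL[OF c] by (simp add: test_functions_def fd)
    then have "(LINT z:UNIV|lborel. frechet_derivative (\<lambda>z. L (\<eta> z)) (at z) e *\<^sub>R w z) =
        - (LINT z:UNIV|lborel. L (\<eta> z) *\<^sub>R g z)"
      using weak unfolding has_weak_partial_def by blast
    then show "(LINT z|lborel. L (\<eta>' z e) *\<^sub>R w z) = - (LINT z|lborel. L (\<eta> z) *\<^sub>R g z)"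
      unfolding fd by (simp add: set_lebesgue_integral_def)
    have zero: "L 0 = 0" using linear_simps(3)[OF L] .
    show "integrable lborel (\<lambda>z. L (\<eta>' z e) *\<^sub>R w z)"
      using integrable_mult_continuous_compact_support[OF _ _ w, of "\<lambda>z. of_real (L (\<eta>' z e))" b] cL[OF c[OF e]] z' zero
      by (simp add: scaleR_conv_of_real continuous_on_of_real)
    show "integrable lborel (\<lambda>z. L (\<eta> z) *\<^sub>R g z)"
      using integrable_mult_continuous_compact_support[OF _ _ g, of "\<lambda>z. of_real (L (\<eta> z))" b] cL[OF c\<eta>] z zero
      by (simp add: scaleR_conv_of_real continuous_on_of_real)
  qed
  have split: "x * y = Re x *\<^sub>R y + \<i> * (Im x *\<^sub>R y)" for x y :: complex
    by (simp add: complex_eq_iff)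
  note R = part[OF bounded_linear_Re] and I = part[OF bounded_linear_Im]
  have eq1: "(\<lambda>z. \<eta>' z e * w z) = (\<lambda>z. Re (\<eta>' z e) *\<^sub>R w z + \<i> * (Im (\<eta>' z e) *\<^sub>R w z))"
    and eq2: "(\<lambda>z. \<eta> z * g z) = (\<lambda>z. Re (\<eta> z) *\<^sub>R g z + \<i> * (Im (\<eta> z) *\<^sub>R g z))"
    by (rule ext, rule split)+
  note i1 = integrable_mult_right[OF I(2), of \<i>] and i2 = integrable_mult_right[OF I(3), of \<i>]
  show "integrable lborel (\<lambda>z. \<eta>' z e * w z)" "integrable lborel (\<lambda>z. \<eta> z * g z)"
    unfolding eq1 eq2
    by (rule Bochner_Integration.integrable_add[OF R(2) i1] Bochner_Integration.integrable_add[OF R(3) i2])+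
  show "(LINT z|lborel. \<eta>' z e * w z) = - (LINT z|lborel. \<eta> z * g z)"
    unfolding eq1 eq2 Bochner_Integration.integral_add[OF R(2) i1] Bochner_Integration.integral_add[OF R(3) i2]
      integral_mult_right_zero R(1) I(1) by simp
qed

text \<open>The pole at 0 is invisible because \<open>f\<close> vanishes up to a > 0: the quotient
  is zero on one open piece and has no pole on the other, and the two pieces cover the line.\<close>

lemma continuous_on_divide_power_support:
  fixes f :: "real \<Rightarrow> real"
  assumes f: "continuous_on UNIV f" "0 < a" "\<And>x. x \<le> a \<Longrightarrow> f x = 0"
  shows "continuous_on UNIV (\<lambda>x. f x / x ^ k)"
proof -
  have "continuous_on ({..<a} \<union> {0<..}) (\<lambda>x. f x / x ^ k)"
  proof (rule continuous_on_open_Un)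
    have "continuous_on {..<a} (\<lambda>x. 0::real)" by simp
    then show "continuous_on {..<a} (\<lambda>x. f x / x ^ k)"
      by (rule continuous_on_eq) (use f in auto)
    show "continuous_on {0<..} (\<lambda>x. f x / x ^ k)"
      by (intro continuous_intros continuous_on_subset[OF f(1)]) auto
  qed auto
  also have "{..<a} \<union> {0<..} = UNIV" using f(2) by auto
  finally show ?thesis .
qed

lemma has_real_derivative_divide_power_support:
  fixes f :: "real \<Rightarrow> real"
  assumes f: "(f has_real_derivative f') (at x)" "0 < a" "\<And>x. x \<le> a \<Longrightarrow> f x = 0" "x \<le> a \<Longrightarrow> f' = 0"
  shows "((\<lambda>x. f x / x ^ k) has_real_derivative f' / x ^ k - k * f x / x ^ Suc k) (at x)"
proof (cases "x < a")
  case True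
  have "((\<lambda>x. f x / x ^ k) has_real_derivative 0) (at x)"
    by (rule has_field_derivative_transform_within_open[where S = "{..<a}", OF DERIV_const])
      (use True f in auto)
  then show ?thesis using True f by simp
next
  case False
  then have x: "x \<noteq> 0" using f by auto
  have *: "((\<lambda>x. x ^ k) has_real_derivative k * x ^ (k - 1)) (at x)"
    by (auto intro!: derivative_eq_intros)
  have "((\<lambda>x. f x / x ^ k) has_real_derivative (f' * x ^ k - f x * (k * x ^ (k - 1))) / (x ^ k * x ^ k)) (at x)"
    by (rule DERIV_divide[OF f(1) *]) (use x in simp)
  also have "(f' * x ^ k - f x * (k * x ^ (k - 1))) / (x ^ k * x ^ k) = f' / x ^ k - k * f x / x ^ Suc k"
    using x by (cases k) (simp_all add: field_simps)
  finally show ?thesis .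
qed

text \<open>Around the origin, where \<open>cmod\<close> is not differentiable,
  \<open>\<rho>\<close> makes the function vanish identically. At j = 0 the truncated exponent j - 1
  is harmless since its factor is 0.\<close>

lemma radial_times_power_has_derivative:
  assumes \<rho>: "\<And>x. (\<rho> has_real_derivative \<rho>' x) (at x)" and a: "0 < a" "\<And>x. x \<le> a \<Longrightarrow> \<rho> x = 0 \<and> \<rho>' x = 0"
  shows "((\<lambda>z. of_real (\<rho> (cmod z)) * z ^ j) has_derivative
     (\<lambda>h. of_real (\<rho>' (cmod z) / cmod z * (z \<bullet> h)) * z ^ j + of_real (\<rho> (cmod z)) * (of_nat j * z ^ (j - 1) * h))) (at z)"
proof (cases "cmod z < a")
  case True
  have "((\<lambda>z. of_real (\<rho> (cmod z)) * z ^ j) has_derivative (\<lambda>_. 0)) (at z)"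
    by (rule has_derivative_transform_within_open[where s = "ball 0 a" and f = "\<lambda>_. 0"])
      (use True a(2) in auto)
  then show ?thesis using True a(2)[of "cmod z"] by simp
next
  case False
  then have z: "z \<noteq> 0" using a by auto
  have n: "((\<lambda>z. \<rho> (cmod z)) has_derivative (\<lambda>h. \<rho>' (cmod z) * (h \<bullet> sgn z))) (at z)"
    using has_derivative_compose[OF has_derivative_norm[OF z], of \<rho> "(*) (\<rho>' (cmod z))"] \<rho>
    by (simp add: has_field_derivative_def)
  have "((\<lambda>z. z ^ j) has_field_derivative of_nat j * z ^ (j - 1)) (at z)"
    by (auto intro!: derivative_eq_intros)
  then have p: "((\<lambda>z. z ^ j) has_derivative (\<lambda>h. of_nat j * z ^ (j - 1) * h)) (at z)"
    by (simp add: has_field_derivative_def)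
  have "((\<lambda>z. of_real (\<rho> (cmod z)) * z ^ j) has_derivative
     (\<lambda>h. of_real (\<rho> (cmod z)) * (of_nat j * z ^ (j - 1) * h) + of_real (\<rho>' (cmod z) * (h \<bullet> sgn z)) * z ^ j)) (at z)"
    by (rule has_derivative_mult[OF has_derivative_of_real[OF n] p])
  moreover have "\<rho>' (cmod z) * (h \<bullet> sgn z) = \<rho>' (cmod z) / cmod z * (z \<bullet> h)" for h
    by (simp add: sgn_div_norm inner_commute divide_inverse)
  ultimately show ?thesis by (simp add: add.commute)
qed

lemma cis_power_norm:
  "z ^ n * cis (- (real n * Arg z)) = of_real (cmod z ^ n)"
proof (cases "z = 0")
  case True
  then show ?thesis by (cases n) auto
next
  case False
  have "z = of_real (cmod z) * cis (Arg z)"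
    using rcis_cmod_Arg[of z] by (simp add: rcis_def)
  then have "z ^ n = (of_real (cmod z) * cis (Arg z)) ^ n" by (rule arg_cong)
  also have "\<dots> = of_real (cmod z ^ n) * cis (real n * Arg z)"
    by (simp only: power_mult_distrib Complex.DeMoivre of_real_power)
  finally have "z ^ n * cis (- (real n * Arg z)) =
      of_real (cmod z ^ n) * (cis (real n * Arg z) * cis (- (real n * Arg z)))"
    by (simp only: mult.assoc)
  then show ?thesis by (simp add: cis_mult)
qed

text \<open>The test function is \<open>\<psi>(|z|) z\<^sup>j / |z|\<^bsup>j+1\<^esup>\<close>, for \<open>j = n - 1\<close> together with
  \<open>\<partial>\<^sub>x + i \<partial>\<^sub>y\<close> and for \<open>j = n + 1\<close> together with \<open>\<partial>\<^sub>x - i \<partial>\<^sub>y\<close>; both choices produce the phase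
  \<open>z\<^sup>n\<close> that cancels the one of the equivariant function.\<close>

lemma equivariant_weak_radial:
  fixes u :: "real \<Rightarrow> complex" and s :: real
  assumes n: "0 < n"
    and g1: "has_weak_partial UNIV 1 (equivariant_ext (- int n) u) g1"
    and g2: "has_weak_partial UNIV \<i> (equivariant_ext (- int n) u) g2"
    and s: "s = 1 \<and> j = n - 1 \<or> s = - 1 \<and> j = n + 1"
    and \<psi>: "\<psi> \<in> test_functions {0<..}" "\<And>x. (\<psi> has_real_derivative \<psi>' x) (at x)"
    and um: "(\<lambda>z. u (cmod z)) \<in> borel_measurable borel"
  defines "H \<equiv> \<lambda>z. sgn z ^ j * (g1 z + \<i> * (of_real s * g2 z))"
  shows "(LINT r:{0<..}|lborel. (\<psi>' r - s * n * \<psi> r / r) *\<^sub>R u r) = - (LINT r:{0<..}|lborel. \<psi> r *\<^sub>R circle_avg H r)"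
    and "set_integrable lborel {0<..} (\<lambda>r. (\<psi>' r - s * n * \<psi> r / r) *\<^sub>R u r)"
    and "set_integrable lborel {0<..} (\<lambda>r. \<psi> r *\<^sub>R circle_avg H r)"
proof -
  let ?w = "equivariant_ext (- int n) u"
  obtain a b where c: "continuous_on UNIV \<psi>'" and ab: "0 < a" "a < b"
    and z: "\<And>x. x \<notin> {a<..<b} \<Longrightarrow> \<psi> x = 0 \<and> \<psi>' x = 0"
  proof -
    from \<psi>(1) obtain D a b where "\<And>x. (\<psi> has_real_derivative D x) (at x)" "continuous_on UNIV D"
      "0 < a" "a < b" "\<And>x. x \<notin> {a<..<b} \<Longrightarrow> \<psi> x = 0 \<and> D x = 0"
      unfolding test_functions_halfline_iff by blast
    moreover from this(1) \<psi>(2) have "D = \<psi>'" using DERIV_unique by blast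
    ultimately show thesis using that by blast
  qed
  have za: "\<psi> x = 0" "\<psi>' x = 0" if "x \<le> a" for x using z[of x] that by auto
  have zb: "\<psi> x = 0" "\<psi>' x = 0" if "b \<le> x" for x using z[of x] that by auto
  have c\<psi>: "continuous_on UNIV \<psi>" using \<psi>(2) by (intro DERIV_continuous_on) auto
  have [measurable]: "\<psi> \<in> borel_measurable borel" "\<psi>' \<in> borel_measurable borel"
    using c c\<psi> by (auto intro: borel_measurable_continuous_onI)
  \<comment> \<open>One power more than needed to normalise z^j: \<open>\<eta>\<close> becomes a
    phase times \<psi>(r)/r, and this 1/r cancels the polar weight r.\<close>
  define \<rho> where "\<rho> x = \<psi> x / x ^ Suc j" for x
  define \<rho>' where "\<rho>' x = \<psi>' x / x ^ Suc j - Suc j * \<psi> x / x ^ Suc (Suc j)" for x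
  have d\<rho>: "(\<rho> has_real_derivative \<rho>' x) (at x)" for x
    unfolding \<rho>_def \<rho>'_def using za
    by (intro has_real_derivative_divide_power_support[OF \<psi>(2) ab(1)]) auto
  have a\<rho>: "\<rho> x = 0 \<and> \<rho>' x = 0" if "x \<le> a" for x using za[OF that] by (simp add: \<rho>_def \<rho>'_def)
  have b\<rho>: "\<rho> x = 0" if "b < x" for x using zb[of x] that by (simp add: \<rho>_def)
  have cont: "continuous_on UNIV \<rho>" "continuous_on UNIV (\<lambda>x. \<rho>' x / x)"
  proof -
    show "continuous_on UNIV \<rho>" using d\<rho> by (intro DERIV_continuous_on) auto
    have "continuous_on UNIV (\<lambda>x. \<psi>' x / x ^ Suc (Suc j) - Suc j * (\<psi> x / x ^ Suc (Suc (Suc j))))"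
      using za by (intro continuous_intros continuous_on_divide_power_support[OF c ab(1)]
         continuous_on_divide_power_support[OF c\<psi> ab(1)]) auto
    then show "continuous_on UNIV (\<lambda>x. \<rho>' x / x)"
      by (simp add: \<rho>'_def diff_divide_distrib mult_ac)
  qed
  define \<eta> where "\<eta> z = of_real (\<rho> (cmod z)) * z ^ j" for z
  define \<eta>' where "\<eta>' z h = of_real (\<rho>' (cmod z) / cmod z * (z \<bullet> h)) * z ^ j +
      of_real (\<rho> (cmod z)) * (of_nat j * z ^ (j - 1) * h)" for z h
  have d\<eta>: "(\<eta> has_derivative \<eta>' z) (at z)" for z
    unfolding \<eta>_def \<eta>'_def by (rule radial_times_power_has_derivative[OF d\<rho> ab(1) a\<rho>])
  have c\<eta>: "continuous_on UNIV (\<lambda>z. \<eta>' z h)" for h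
    unfolding \<eta>'_def
    by (intro continuous_intros continuous_on_compose2[OF cont(1)] continuous_on_compose2[OF cont(2)]) auto
  have b\<eta>: "\<eta> z = 0" if "b < cmod z" for z using b\<rho>[OF that] by (simp add: \<eta>_def)
  have basis: "1 \<in> (Basis :: complex set)" "\<i> \<in> (Basis :: complex set)" by (simp_all add: Basis_complex_def)
  have P1: "(LINT z|lborel. \<eta>' z 1 * ?w z) = - (LINT z|lborel. \<eta> z * g1 z)"
    "integrable lborel (\<lambda>z. \<eta>' z 1 * ?w z)" "integrable lborel (\<lambda>z. \<eta> z * g1 z)"
    by (rule weak_partial_complex_test[OF g1 basis(1) d\<eta> c\<eta>, of b], rule b\<eta>, assumption)+
  have P2: "(LINT z|lborel. \<eta>' z \<i> * ?w z) = - (LINT z|lborel. \<eta> z * g2 z)"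
    "integrable lborel (\<lambda>z. \<eta>' z \<i> * ?w z)" "integrable lborel (\<lambda>z. \<eta> z * g2 z)"
    by (rule weak_partial_complex_test[OF g2 basis(2) d\<eta> c\<eta>, of b], rule b\<eta>, assumption)+
  \<comment> \<open>The radial factor of (\<partial>x + i s \<partial>y) \<eta> once the phase
    z^n/|z|^n is split off.\<close>
  define G where "G r = (\<psi>' r - s * n * \<psi> r / r) / r" for r
  have lhs: "\<eta>' z 1 * ?w z + \<i> * of_real s * (\<eta>' z \<i> * ?w z) = G (cmod z) *\<^sub>R u (cmod z)" for z
  proof (cases "z = 0")
    case True
    then show ?thesis using za[of 0] ab by (simp add: \<eta>'_def \<rho>_def \<rho>'_def G_def)
  next
    case False
    define r where "r = cmod z"
    have r: "0 < r" using False by (simp add: r_def)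
    have zz: "z * cnj z = of_real (r ^ 2)"
      by (simp only: r_def complex_norm_square)
    have "\<eta>' z 1 + \<i> * of_real s * \<eta>' z \<i> = of_real (G r / r ^ n) * z ^ n"
    proof -
      have inner: "z \<bullet> 1 = Re z" "z \<bullet> \<i> = Im z" by (simp_all add: inner_complex_def)
      consider "s = 1" "n = Suc j" | "s = -1" "j = Suc n" using s n by force
      then show ?thesis
      proof cases
        \<comment> \<open>\<partial>x + i \<partial>y is twice the Wirtinger derivative in the
          conjugate of z and annihilates z^j, so only the radial factor is differentiated.\<close>
        case 1
        have "\<eta>' z 1 + \<i> * of_real s * \<eta>' z \<i> =
            of_real (\<rho>' r / r) * (of_real (Re z) + \<i> * of_real (Im z)) * z ^ j"
          by (simp add: \<eta>'_def inner 1 r_def algebra_simps)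
        also have "of_real (Re z) + \<i> * of_real (Im z) = z" by (simp add: complex_eq_iff)
        also have "\<rho>' r / r = G r / r ^ n"
          using r by (simp add: \<rho>'_def G_def 1 field_simps)
        finally show ?thesis by (simp add: 1)
      next
        \<comment> \<open>\<partial>x - i \<partial>y is twice the derivative in z, so the power
          contributes an extra 2 j z^(j-1), which is 2 j z^n.\<close>
        case 2
        have "\<eta>' z 1 + \<i> * of_real s * \<eta>' z \<i> =
            of_real (\<rho>' r / r) * (of_real (Re z) - \<i> * of_real (Im z)) * z ^ j
            + of_real (2 * j * \<rho> r) * z ^ n"
          by (simp add: \<eta>'_def inner 2 r_def algebra_simps)
        also have "of_real (Re z) - \<i> * of_real (Im z) = cnj z" by (simp add: complex_eq_iff)
        also have "of_real (\<rho>' r / r) * cnj z * z ^ j = of_real (\<rho>' r / r) * (z * cnj z) * z ^ n"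
          by (simp add: 2 mult_ac)
        also have "\<dots> = of_real (\<rho>' r * r) * z ^ n"
          unfolding zz using r by (simp add: power2_eq_square)
        also have "\<dots> + of_real (2 * j * \<rho> r) * z ^ n = of_real (\<rho>' r * r + 2 * j * \<rho> r) * z ^ n"
          by (simp add: distrib_right)
        also have "\<rho>' r * r + 2 * j * \<rho> r = G r / r ^ n"
          using r by (simp add: \<rho>_def \<rho>'_def G_def 2 field_simps)
        finally show ?thesis .
      qed
    qed
    moreover have "\<eta>' z 1 * ?w z + \<i> * of_real s * (\<eta>' z \<i> * ?w z) =
        (\<eta>' z 1 + \<i> * of_real s * \<eta>' z \<i>) * ?w z"
      by (simp only: distrib_right mult.assoc)
    moreover have "?w z = u r * cis (- (real n * Arg z))"
      by (simp add: equivariant_ext_def r_def)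
    ultimately have "\<eta>' z 1 * ?w z + \<i> * of_real s * (\<eta>' z \<i> * ?w z) =
        of_real (G r / r ^ n) * u r * (z ^ n * cis (- (real n * Arg z)))"
      by (simp only: mult_ac)
    also have "\<dots> = G r *\<^sub>R u r"
      unfolding cis_power_norm using r by (simp add: scaleR_conv_of_real r_def)
    finally show ?thesis by (simp add: r_def)
  qed
  have rhs: "\<eta> z * g1 z + \<i> * of_real s * (\<eta> z * g2 z) = (\<psi> (cmod z) / cmod z) *\<^sub>R H z" for z
    by (cases "z = 0") (simp_all add: \<eta>_def \<rho>_def H_def sgn_eq scaleR_conv_of_real field_simps)
  have g1m[measurable]: "g1 \<in> borel_measurable borel" and g2m[measurable]: "g2 \<in> borel_measurable borel"
    using g1 g2 by (auto simp: has_weak_partial_def intro: locally_integrable_UNIV_measurable)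
  have Hm[measurable]: "H \<in> borel_measurable borel" unfolding H_def by measurable
  have Gm[measurable]: "G \<in> borel_measurable borel" unfolding G_def by measurable
  have iL: "integrable lborel (\<lambda>z. G (cmod z) *\<^sub>R u (cmod z))"
    unfolding lhs[symmetric]
    by (intro Bochner_Integration.integrable_add P1(2) integrable_mult_right P2(2))
  have iR: "integrable lborel (\<lambda>z. (\<psi> (cmod z) / cmod z) *\<^sub>R H z)"
    unfolding rhs[symmetric]
    by (intro Bochner_Integration.integrable_add P1(3) integrable_mult_right P2(3))
  have "(LINT z|lborel. G (cmod z) *\<^sub>R u (cmod z)) = - (LINT z|lborel. (\<psi> (cmod z) / cmod z) *\<^sub>R H z)"
  proof -
    have "(LINT z|lborel. G (cmod z) *\<^sub>R u (cmod z)) =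
        (LINT z|lborel. \<eta>' z 1 * ?w z) + \<i> * of_real s * (LINT z|lborel. \<eta>' z \<i> * ?w z)"
      unfolding lhs[symmetric] using P1(2) P2(2) by simp
    also have "\<dots> = - ((LINT z|lborel. \<eta> z * g1 z) + \<i> * of_real s * (LINT z|lborel. \<eta> z * g2 z))"
      unfolding P1(1) P2(1) by simp
    also have "(LINT z|lborel. \<eta> z * g1 z) + \<i> * of_real s * (LINT z|lborel. \<eta> z * g2 z) =
        (LINT z|lborel. (\<psi> (cmod z) / cmod z) *\<^sub>R H z)"
      unfolding rhs[symmetric] using P1(3) P2(3) by simp
    finally show ?thesis .
  qed
  moreover note L = integral_polar_average[OF Gm um iL]
  moreover have "(\<lambda>r. \<psi> r / r) \<in> borel_measurable borel" by measurable
  note R = integral_polar_average[OF this Hm iR]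
  moreover have eqL: "indicator {0<..} r *\<^sub>R ((r * G r) *\<^sub>R circle_avg (\<lambda>z. u (cmod z)) r) =
      indicator {0<..} r *\<^sub>R ((\<psi>' r - s * n * \<psi> r / r) *\<^sub>R u r)" for r
    by (cases "0 < r") (simp_all add: circle_avg_radial[OF _ um] G_def)
  moreover have eqR: "indicator {0<..} r *\<^sub>R ((r * (\<psi> r / r)) *\<^sub>R circle_avg H r) =
      indicator {0<..} r *\<^sub>R (\<psi> r *\<^sub>R circle_avg H r)" for r
    by (cases "0 < r") simp_all
  ultimately have "measure circle_measure UNIV *\<^sub>R (LINT r:{0<..}|lborel. (\<psi>' r - s * n * \<psi> r / r) *\<^sub>R u r) =
      measure circle_measure UNIV *\<^sub>R (- (LINT r:{0<..}|lborel. \<psi> r *\<^sub>R circle_avg H r))"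
    unfolding set_lebesgue_integral_def eqL eqR by (simp only: scaleR_minus_right)
  then show "(LINT r:{0<..}|lborel. (\<psi>' r - s * n * \<psi> r / r) *\<^sub>R u r) = - (LINT r:{0<..}|lborel. \<psi> r *\<^sub>R circle_avg H r)"
    using measure_circle_measure_pos by (simp only: scaleR_cancel_left) simp
  show "set_integrable lborel {0<..} (\<lambda>r. (\<psi>' r - s * n * \<psi> r / r) *\<^sub>R u r)"
    using L(2) unfolding set_integrable_def eqL .
  show "set_integrable lborel {0<..} (\<lambda>r. \<psi> r *\<^sub>R circle_avg H r)"
    using R(2) unfolding set_integrable_def eqR .
qed

section \<open>Regularity and integrability of the radial part\<close>

text \<open>On [a,b] the weight r is at least a, and |f| \<le> 1 + |f|^2.\<close>

lemma locally_integrable_if_weighted_square: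
  fixes f :: "real \<Rightarrow> complex"
  assumes [measurable]: "f \<in> borel_measurable borel"
    and f: "set_integrable lborel {0<..} (\<lambda>r. r * (cmod (f r))\<^sup>2)"
  shows "f locally_integrable_on {0<..}"
  unfolding locally_integrable_halfline_iff
proof (intro allI impI)
  fix a b :: real assume a: "0 < a"
  have "set_integrable lborel {a..b} (\<lambda>r. r * (cmod (f r))\<^sup>2)"
    by (rule set_integrable_subset[OF f]) (use a in auto)
  then have "set_integrable lborel {a..b} (\<lambda>r. 1 + 1 / a * (r * (cmod (f r))\<^sup>2))"
    using borel_integrable_atLeastAtMost'[of a b "\<lambda>_. 1::real"]
    by (intro set_integral_add(1) set_integrable_mult_right) auto
  then show "set_integrable lborel {a..b} f"
  proof (rule set_integrable_bound)
    show "set_borel_measurable lborel {a..b} f" by (simp add: set_borel_measurable_def)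
    show "AE r in lborel. r \<in> {a..b} \<longrightarrow> cmod (f r) \<le> norm (1 + 1 / a * (r * (cmod (f r))\<^sup>2))"
    proof (intro AE_I2 impI)
      fix r assume r: "r \<in> {a..b}"
      have "0 \<le> (cmod (f r) - 1)\<^sup>2" by simp
      then have "2 * cmod (f r) \<le> 1 + (cmod (f r))\<^sup>2" by (simp add: power2_diff)
      then have "cmod (f r) \<le> 1 + 1 * (cmod (f r))\<^sup>2" using norm_ge_zero[of "f r"] by linarith
      also have "\<dots> \<le> 1 + (r / a) * (cmod (f r))\<^sup>2"
        using r a by (intro add_left_mono mult_right_mono) auto
      also have "\<dots> = 1 + 1 / a * (r * (cmod (f r))\<^sup>2)" by simp
      finally show "cmod (f r) \<le> norm (1 + 1 / a * (r * (cmod (f r))\<^sup>2))" by simp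
    qed
  qed
qed

lemma equivariant_ext_real: "0 \<le> r \<Longrightarrow> equivariant_ext m u (of_real r) = u r"
  by (cases "r = 0") (simp_all add: equivariant_ext_def Arg_of_real Arg_zero)

text \<open>\<open>u\<close> is read off from its extension on the nonnegative real axis, where the
  phase is 1. The axis is a null set, but Borel measurability is not a statement up to null sets and
  survives this composition.\<close>

lemma equivariant_radial_measurable:
  assumes "equivariant_ext m u locally_integrable_on UNIV"
  shows "(\<lambda>z. u (cmod z)) \<in> borel_measurable borel"
    and "(\<lambda>r. indicator {0<..} r *\<^sub>R u r) \<in> borel_measurable borel"
proof -
  have w: "equivariant_ext m u \<in> borel_measurable borel"
    by (rule locally_integrable_UNIV_measurable[OF assms])
  have "(\<lambda>z. equivariant_ext m u (of_real (cmod z))) \<in> borel_measurable borel"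
    by (rule measurable_compose[OF _ w]) measurable
  then show "(\<lambda>z. u (cmod z)) \<in> borel_measurable borel" by (simp add: equivariant_ext_real)
  have "(\<lambda>r. equivariant_ext m u (of_real r)) \<in> borel_measurable borel"
    by (rule measurable_compose[OF _ w]) measurable
  then have "(\<lambda>r. indicator {0<..} r *\<^sub>R equivariant_ext m u (of_real r)) \<in> borel_measurable borel"
    by measurable
  also have "(\<lambda>r. indicator {0<..} r *\<^sub>R equivariant_ext m u (of_real r)) = (\<lambda>r. indicator {0<..} r *\<^sub>R u r)"

  proof
    show "indicator {0<..} r *\<^sub>R equivariant_ext m u (of_real r) = indicator {0<..} r *\<^sub>R u r" for r
      by (cases "0 < r") (simp_all add: equivariant_ext_real)
  qed
  finally show "(\<lambda>r. indicator {0<..} r *\<^sub>R u r) \<in> borel_measurable borel" .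
qed

lemma equivariant_radial_locally_integrable:
  assumes w: "equivariant_ext m u locally_integrable_on UNIV"
  shows "u locally_integrable_on {0<..}"
  unfolding locally_integrable_halfline_iff
proof (intro allI impI)
  fix a b :: real assume a: "0 < a"
  note um = equivariant_radial_measurable(1)[OF w]
  \<comment> \<open>The factor 1/r cancels the polar weight, so \<open>r * g r\<close> is the
    indicator of [a,b] for r > 0, while \<open>g\<close> is at most 1/a.\<close>
  define g where "g r = indicator {a..b} r / r" for r :: real
  have [measurable]: "g \<in> borel_measurable borel" unfolding g_def by measurable
  have m: "(\<lambda>z. g (cmod z) *\<^sub>R u (cmod z)) \<in> borel_measurable borel" using um by measurable
  have "set_integrable lborel (cball 0 b) (equivariant_ext m u)"
    using w by (simp add: locally_integrable_on_def)
  then have "integrable lborel (\<lambda>z. (1 / a) *\<^sub>R (indicator (cball 0 b) z *\<^sub>R equivariant_ext m u z))"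
    unfolding set_integrable_def by (rule Bochner_Integration.integrable_scaleR_right)
  then have "integrable lborel (\<lambda>z. g (cmod z) *\<^sub>R u (cmod z))"
  proof (rule Bochner_Integration.integrable_bound)
    show "AE z in lborel. cmod (g (cmod z) *\<^sub>R u (cmod z)) \<le>
        cmod ((1 / a) *\<^sub>R (indicator (cball 0 b) z *\<^sub>R equivariant_ext m u z))"
    proof (intro AE_I2)
      fix z :: complex
      show "cmod (g (cmod z) *\<^sub>R u (cmod z)) \<le>
          cmod ((1 / a) *\<^sub>R (indicator (cball 0 b) z *\<^sub>R equivariant_ext m u z))"
      proof (cases "cmod z \<in> {a..b}")
        case True
        then have "1 / cmod z \<le> 1 / a" using a by (simp add: frac_le)
        then have "1 / cmod z * cmod (u (cmod z)) \<le> 1 / a * cmod (u (cmod z))"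
          by (rule mult_right_mono) simp
        with True a show ?thesis by (simp add: g_def equivariant_ext_def norm_mult)
      qed (simp add: g_def)
    qed
  qed (use m in simp)
  from integral_polar_average(2)[OF _ um this]
  have "set_integrable lborel {0<..} (\<lambda>r. (r * g r) *\<^sub>R circle_avg (\<lambda>z. u (cmod z)) r)" by simp
  moreover have "indicator {0<..} r *\<^sub>R ((r * g r) *\<^sub>R circle_avg (\<lambda>z. u (cmod z)) r) = indicator {a..b} r *\<^sub>R u r" for r
    using a by (cases "0 < r") (auto simp: circle_avg_radial[OF _ um] g_def)
  ultimately show "set_integrable lborel {a..b} u" by (simp only: set_integrable_def)
qed

text \<open>With n = -m, the averages \<open>p\<close> and \<open>q\<close> are u' + n u/r and u' -
  n u/r in the weak sense. Half their sum is u', and their difference divided by 2 n is u/r; both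
  inherit square integrability from the gradient in the plane.\<close>

lemma Hdot1_equiv_radial:
  assumes u: "u \<in> Hdot1_equiv m" and m: "m < 0"
  shows "\<exists>v. v \<in> borel_measurable borel \<and> has_weak_partial {0<..} 1 u v \<and>
      set_integrable lborel {0<..} (\<lambda>r. r * (cmod (v r))\<^sup>2)"
    and "set_integrable lborel {0<..} (\<lambda>r. (cmod (u r))\<^sup>2 / r)"
proof -
  obtain n where n: "m = - int n" "0 < n"
    using m by (metis neg_int_cases of_nat_0_less_iff neg_0_less_iff_less zero_less_imp_eq_int)
  let ?w = "equivariant_ext (- int n) u"
  have w: "?w locally_integrable_on UNIV"
    using u by (simp add: Hdot1_equiv_def Hdot1_def n)
  obtain g1 g2 where g1: "has_weak_partial UNIV 1 ?w g1" "integrable lborel (\<lambda>z. (cmod (g1 z))\<^sup>2)"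
    and g2: "has_weak_partial UNIV \<i> ?w g2" "integrable lborel (\<lambda>z. (cmod (g2 z))\<^sup>2)"
    using u by (auto simp: Hdot1_equiv_def Hdot1_def n Basis_complex_def)
  have [measurable]: "g1 \<in> borel_measurable borel" "g2 \<in> borel_measurable borel"
    using g1 g2 by (auto simp: has_weak_partial_def intro: locally_integrable_UNIV_measurable)
  note um = equivariant_radial_measurable[OF w]
  have u_loc: "u locally_integrable_on {0<..}" by (rule equivariant_radial_locally_integrable[OF w])
  define H where "H s j z = sgn z ^ j * (g1 z + \<i> * (of_real s * g2 z))" for s :: real and j z
  have H_fold: "(\<lambda>z. sgn z ^ j * (g1 z + \<i> * (of_real s * g2 z))) = H s j" for s j
    by (simp add: H_def[abs_def])
  have Hm[measurable]: "H s j \<in> borel_measurable borel" for s j unfolding H_def by measurable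
  have H2: "integrable lborel (\<lambda>z. (cmod (H s j z))\<^sup>2)" if "\<bar>s\<bar> = 1" for s j
  proof (rule Bochner_Integration.integrable_bound)
    show "integrable lborel (\<lambda>z. 2 * (cmod (g1 z))\<^sup>2 + 2 * (cmod (g2 z))\<^sup>2)"
      using g1(2) g2(2) by simp
    show "AE z in lborel. norm ((cmod (H s j z))\<^sup>2) \<le> norm (2 * (cmod (g1 z))\<^sup>2 + 2 * (cmod (g2 z))\<^sup>2)"
    proof (intro AE_I2)
      fix z
      have "cmod (H s j z) \<le> 1 * cmod (g1 z + \<i> * (of_real s * g2 z))"
        unfolding H_def norm_mult norm_power by (intro mult_right_mono power_le_one) (simp_all add: norm_sgn)
      also have "\<dots> \<le> cmod (g1 z) + cmod (g2 z)"
        using norm_triangle_ineq[of "g1 z" "\<i> * (of_real s * g2 z)"] that by (simp add: norm_mult)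
      finally have "(cmod (H s j z))\<^sup>2 \<le> (cmod (g1 z) + cmod (g2 z))\<^sup>2" by (rule power_mono) simp
      also have "\<dots> \<le> 2 * (cmod (g1 z))\<^sup>2 + 2 * (cmod (g2 z))\<^sup>2"
        using sum_squares_bound[of "cmod (g1 z)" "cmod (g2 z)"] by (simp add: power2_sum)
      finally show "norm ((cmod (H s j z))\<^sup>2) \<le> norm (2 * (cmod (g1 z))\<^sup>2 + 2 * (cmod (g2 z))\<^sup>2)" by simp
    qed
  qed measurable
  define p where "p = circle_avg (H 1 (n - 1))"
  define q where "q = circle_avg (H (- 1) (n + 1))"
  have [measurable]: "p \<in> borel_measurable borel" "q \<in> borel_measurable borel"
    unfolding p_def q_def by measurable
  have p2: "set_integrable lborel {0<..} (\<lambda>r. r * (cmod (p r))\<^sup>2)"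
    and q2: "set_integrable lborel {0<..} (\<lambda>r. r * (cmod (q r))\<^sup>2)"
    unfolding p_def q_def by (rule circle_avg_square_integrable[OF Hm H2]; simp)+
  have comb: "set_integrable lborel {0<..} (\<lambda>r. r * (cmod (c *\<^sub>R p r + d *\<^sub>R q r))\<^sup>2)" for c d
  proof -
    have "set_integrable lborel {0<..} (\<lambda>r. (2 * c\<^sup>2) * (r * (cmod (p r))\<^sup>2) + (2 * d\<^sup>2) * (r * (cmod (q r))\<^sup>2))"
      using p2 q2 by (intro set_integral_add(1) set_integrable_mult_right)
    then show ?thesis
    proof (rule set_integrable_bound)
      show "set_borel_measurable lborel {0<..} (\<lambda>r. r * (cmod (c *\<^sub>R p r + d *\<^sub>R q r))\<^sup>2)"
        unfolding set_borel_measurable_def by measurable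
      show "AE r in lborel. r \<in> {0<..} \<longrightarrow> norm (r * (cmod (c *\<^sub>R p r + d *\<^sub>R q r))\<^sup>2) \<le>
          norm ((2 * c\<^sup>2) * (r * (cmod (p r))\<^sup>2) + (2 * d\<^sup>2) * (r * (cmod (q r))\<^sup>2))"
      proof (intro AE_I2 impI)
        fix r :: real assume r: "r \<in> {0<..}"
        have "(cmod (c *\<^sub>R p r + d *\<^sub>R q r))\<^sup>2 \<le> (\<bar>c\<bar> * cmod (p r) + \<bar>d\<bar> * cmod (q r))\<^sup>2"
          using norm_triangle_ineq[of "c *\<^sub>R p r" "d *\<^sub>R q r"] by (intro power_mono) auto
        also have "\<dots> \<le> 2 * c\<^sup>2 * (cmod (p r))\<^sup>2 + 2 * d\<^sup>2 * (cmod (q r))\<^sup>2"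
          using sum_squares_bound[of "\<bar>c\<bar> * cmod (p r)" "\<bar>d\<bar> * cmod (q r)"]
          by (simp add: power2_sum power_mult_distrib)
        finally have "r * (cmod (c *\<^sub>R p r + d *\<^sub>R q r))\<^sup>2 \<le>
            r * (2 * c\<^sup>2 * (cmod (p r))\<^sup>2 + 2 * d\<^sup>2 * (cmod (q r))\<^sup>2)"
          using r by (intro mult_left_mono) auto
        moreover have "0 \<le> r * (cmod (c *\<^sub>R p r + d *\<^sub>R q r))\<^sup>2" using r by simp
        ultimately show "norm (r * (cmod (c *\<^sub>R p r + d *\<^sub>R q r))\<^sup>2) \<le>
          norm ((2 * c\<^sup>2) * (r * (cmod (p r))\<^sup>2) + (2 * d\<^sup>2) * (r * (cmod (q r))\<^sup>2))"
          by (simp add: algebra_simps)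
      qed
    qed
  qed
  have loc: "(\<lambda>r. c *\<^sub>R p r + d *\<^sub>R q r) locally_integrable_on {0<..}" for c d
    by (rule locally_integrable_if_weighted_square[OF _ comb]) measurable
  have I: "(LINT r:{0<..}|lborel. \<psi>' r *\<^sub>R u r) = - (LINT r:{0<..}|lborel. \<psi> r *\<^sub>R ((1/2) *\<^sub>R p r + (1/2) *\<^sub>R q r))"
      "(LINT r:{0<..}|lborel. \<psi> r *\<^sub>R (u r /\<^sub>R r - ((1 / (2 * n)) *\<^sub>R p r + (- 1 / (2 * n)) *\<^sub>R q r))) = 0"
    if \<psi>: "\<psi> \<in> test_functions {0<..}" "\<And>x. (\<psi> has_real_derivative \<psi>' x) (at x)" for \<psi> \<psi>'
  proof -
    have j: "(1::real) = 1 \<and> n - 1 = n - 1 \<or> (1::real) = - 1 \<and> n - 1 = n + 1"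
      "(- 1::real) = 1 \<and> n + 1 = n - 1 \<or> (- 1::real) = - 1 \<and> n + 1 = n + 1" by simp_all
    note P = equivariant_weak_radial[OF n(2) g1(1) g2(1) j(1) \<psi> um(1), unfolded H_fold, folded p_def]
    note Q = equivariant_weak_radial[OF n(2) g1(1) g2(1) j(2) \<psi> um(1), unfolded H_fold, folded q_def]
    let ?L = "\<lambda>(s::real) r. (\<psi>' r - s * n * \<psi> r / r) *\<^sub>R u r"
    have "\<psi>' r *\<^sub>R u r = (1/2) *\<^sub>R (?L 1 r + ?L (-1) r)" for r
      by (simp flip: scaleR_left_distrib)
    then have "(LINT r:{0<..}|lborel. \<psi>' r *\<^sub>R u r) = (LINT r:{0<..}|lborel. (1/2) *\<^sub>R (?L 1 r + ?L (-1) r))"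
      by (simp only:)
    also have "\<dots> = (1/2) *\<^sub>R (- (LINT r:{0<..}|lborel. \<psi> r *\<^sub>R p r) - (LINT r:{0<..}|lborel. \<psi> r *\<^sub>R q r))"
      unfolding set_integral_scaleR_right set_integral_add(2)[OF P(2) Q(2)] P(1) Q(1) by simp
    also have "\<dots> = - (1/2) *\<^sub>R (LINT r:{0<..}|lborel. \<psi> r *\<^sub>R p r + \<psi> r *\<^sub>R q r)"
      unfolding set_integral_add(2)[OF P(3) Q(3)] by (simp add: algebra_simps)
    also have "\<dots> = - (LINT r:{0<..}|lborel. (1/2) *\<^sub>R (\<psi> r *\<^sub>R p r + \<psi> r *\<^sub>R q r))"
      unfolding set_integral_scaleR_right by simp
    also have "(\<lambda>r. (1/2) *\<^sub>R (\<psi> r *\<^sub>R p r + \<psi> r *\<^sub>R q r)) = (\<lambda>r. \<psi> r *\<^sub>R ((1/2) *\<^sub>R p r + (1/2) *\<^sub>R q r))"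
      by (simp add: algebra_simps)
    finally show "(LINT r:{0<..}|lborel. \<psi>' r *\<^sub>R u r) = - (LINT r:{0<..}|lborel. \<psi> r *\<^sub>R ((1/2) *\<^sub>R p r + (1/2) *\<^sub>R q r))" .
    \<comment> \<open>Subtracting the two identities cancels \<open>\<psi>'\<close> and leaves 2 n
      \<psi> u/r against \<psi> (p - q).\<close>
    let ?K = "\<lambda>r. ?L (-1) r - ?L 1 r - (\<psi> r *\<^sub>R p r - \<psi> r *\<^sub>R q r)"
    have "(LINT r:{0<..}|lborel. ?K r) = 0"
      by (simp only: set_integral_diff[OF Q(2) P(2)] set_integral_diff[OF P(3) Q(3)]
         set_integral_diff[OF set_integral_diff(1)[OF Q(2) P(2)] set_integral_diff(1)[OF P(3) Q(3)]] P(1) Q(1)) simp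
    moreover have "\<psi> r *\<^sub>R (u r /\<^sub>R r - ((1 / (2 * n)) *\<^sub>R p r + (- 1 / (2 * n)) *\<^sub>R q r)) = (1 / (2 * n)) *\<^sub>R ?K r" for r
      using n(2) by (simp add: scaleR_conv_of_real field_simps)
    ultimately show "(LINT r:{0<..}|lborel. \<psi> r *\<^sub>R (u r /\<^sub>R r - ((1 / (2 * n)) *\<^sub>R p r + (- 1 / (2 * n)) *\<^sub>R q r))) = 0"
      by (simp only: set_integral_scaleR_right scaleR_zero_right)
  qed
  let ?v = "\<lambda>r. (1/2) *\<^sub>R p r + (1/2) *\<^sub>R q r"
  have "has_weak_partial {0<..} 1 u ?v"
    unfolding has_weak_partial_def
  proof (intro conjI ballI u_loc loc)
    fix \<psi> :: "real \<Rightarrow> real" assume \<psi>: "\<psi> \<in> test_functions {0<..}"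
    then obtain D where D: "\<And>x. (\<psi> has_real_derivative D x) (at x)"
      unfolding test_functions_halfline_iff by blast
    then have "frechet_derivative \<psi> (at x) 1 = D x" for x by (rule frechet_derivative_real_1)
    with I(1)[OF \<psi> D] show "(LINT x:{0<..}|lborel. frechet_derivative \<psi> (at x) 1 *\<^sub>R u x) =
        - (LINT x:{0<..}|lborel. \<psi> x *\<^sub>R ?v x)" by simp
  qed
  moreover have "?v \<in> borel_measurable borel" by measurable
  ultimately show "\<exists>v. v \<in> borel_measurable borel \<and> has_weak_partial {0<..} 1 u v \<and>
      set_integrable lborel {0<..} (\<lambda>r. r * (cmod (v r))\<^sup>2)"
    using comb by blast
  let ?q = "\<lambda>r. (1 / (2 * n)) *\<^sub>R p r + (- 1 / (2 * n)) *\<^sub>R q r"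
  \<comment> \<open>The identity for u/r holds against every test function, hence almost everywhere,
    which carries the square bound from the averages over to u/r.\<close>
  have ae: "AE r in lborel. 0 < r \<longrightarrow> u r /\<^sub>R r - ?q r = 0"
  proof (rule AE_eq_0_if_test_functions)
    have "set_integrable lborel {a..b} (\<lambda>r. u r /\<^sub>R r)" if a: "0 < a" for a b
    proof (rule set_integrable_bound)
      have ui: "set_integrable lborel {a..b} u" using u_loc a by (simp add: locally_integrable_halfline_iff)
      then show "set_integrable lborel {a..b} (\<lambda>r. (1 / a) *\<^sub>R u r)" by (rule set_integrable_scaleR_right)
      have "(\<lambda>r. inverse r *\<^sub>R (indicator {a..b} r *\<^sub>R u r)) \<in> borel_measurable lborel"
        using borel_measurable_integrable[OF ui[unfolded set_integrable_def]] by measurable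
      then show "set_borel_measurable lborel {a..b} (\<lambda>r. u r /\<^sub>R r)"
        unfolding set_borel_measurable_def by (simp add: mult.commute)
      show "AE r in lborel. r \<in> {a..b} \<longrightarrow> cmod (u r /\<^sub>R r) \<le> cmod ((1 / a) *\<^sub>R u r)"
      proof (intro AE_I2 impI)
        fix r assume "r \<in> {a..b}"
        then have "inverse r \<le> 1 / a" "0 < r" using a by (auto simp: field_simps)
        then show "cmod (u r /\<^sub>R r) \<le> cmod ((1 / a) *\<^sub>R u r)" using a mult_right_mono[of "inverse r" "1 / a" "cmod (u r)"] by simp
      qed
    qed
    then show "(\<lambda>r. u r /\<^sub>R r - ?q r) locally_integrable_on {0<..}"
      using loc unfolding locally_integrable_halfline_iff by (intro allI impI set_integral_diff(1)) blast+
    fix \<psi> :: "real \<Rightarrow> real" assume \<psi>: "\<psi> \<in> test_functions {0<..}"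
    then obtain D where D: "\<And>x. (\<psi> has_real_derivative D x) (at x)"
      unfolding test_functions_halfline_iff by blast
    show "(LINT r:{0<..}|lborel. \<psi> r *\<^sub>R (u r /\<^sub>R r - ?q r)) = 0" by (rule I(2)[OF \<psi> D])
  qed
  show "set_integrable lborel {0<..} (\<lambda>r. (cmod (u r))\<^sup>2 / r)"
    unfolding set_integrable_def
  proof (rule integrable_cong_AE_imp[OF comb[unfolded set_integrable_def]])
    have "(\<lambda>r. (cmod (indicator {0<..} r *\<^sub>R u r))\<^sup>2 / r) \<in> borel_measurable lborel"
      using um(2) by measurable
    also have "(\<lambda>r. (cmod (indicator {0<..} r *\<^sub>R u r))\<^sup>2 / r) = (\<lambda>r. indicator {0<..} r *\<^sub>R ((cmod (u r))\<^sup>2 / r))"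
      by (auto simp: indicator_def)
    finally show "(\<lambda>r. indicator {0<..} r *\<^sub>R ((cmod (u r))\<^sup>2 / r)) \<in> borel_measurable lborel" .
    show "AE r in lborel. indicator {0<..} r *\<^sub>R (r * (cmod (?q r))\<^sup>2) = indicator {0<..} r *\<^sub>R ((cmod (u r))\<^sup>2 / r)"
      using ae
    proof eventually_elim
      case (elim r)
      show ?case
      proof (cases "0 < r")
        case True
        then have "?q r = u r /\<^sub>R r" using elim by simp
        then show ?thesis using True by (simp only:) (simp add: power_mult_distrib power2_eq_square field_simps)
      qed simp
    qed
  qed
qed

section \<open>Energy\<close>

lemma has_ac_deriv_linear:
  fixes F :: "real \<Rightarrow> 'a::euclidean_space" and L :: "'a \<Rightarrow> 'b::euclidean_space"
  assumes F: "has_ac_deriv F f" and L: "bounded_linear L"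
  shows "has_ac_deriv (\<lambda>x. L (F x)) (\<lambda>x. L (f x))"
  unfolding has_ac_deriv_def locally_integrable_halfline_iff
proof (intro conjI allI impI)
  fix a b :: real assume a: "0 < a"
  have i: "integrable lborel (\<lambda>x. indicator {a..b} x *\<^sub>R f x)"
    using has_ac_derivD(1)[OF F a] by (simp add: set_integrable_def)
  have e: "indicator {a..b} x *\<^sub>R L (f x) = L (indicator {a..b} x *\<^sub>R f x)" for x
    by (rule linear_simps(5)[OF L, symmetric])
  show "set_integrable lborel {a..b} (\<lambda>x. L (f x))"
    unfolding set_integrable_def e by (rule integrable_bounded_linear[OF L i])
  assume "a \<le> b"
  then show "L (F b) - L (F a) = (LINT x:{a..b}|lborel. L (f x))"
    using has_ac_derivD(3)[OF F a, of b] linear_simps(2)[OF L, of "F b" "F a"]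
    unfolding set_lebesgue_integral_def e integral_bounded_linear[OF L i] by simp
qed

lemma has_ac_deriv_add:
  assumes F: "has_ac_deriv F f" and G: "has_ac_deriv G g"
  shows "has_ac_deriv (\<lambda>x. F x + G x) (\<lambda>x. f x + g x)"
  unfolding has_ac_deriv_def locally_integrable_halfline_iff
proof (intro conjI allI impI)
  fix a b :: real assume a: "0 < a"
  note i = has_ac_derivD(1)[OF F a] has_ac_derivD(1)[OF G a]
  show "set_integrable lborel {a..b} (\<lambda>x. f x + g x)" by (rule set_integral_add(1)[OF i])
  assume "a \<le> b"
  then have "(F b - F a) + (G b - G a) = (LINT x:{a..b}|lborel. f x + g x)"
    using has_ac_derivD(3)[OF F a, of b] has_ac_derivD(3)[OF G a, of b]
    unfolding set_integral_add(2)[OF i] by simp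
  then show "F b + G b - (F a + G a) = (LINT x:{a..b}|lborel. f x + g x)"
    by (simp only: add_diff_add)
qed

text \<open>The product rule above has one real factor, so |F|^2 is split into the squares of real
  and imaginary part.\<close>

lemma has_ac_deriv_norm_square:
  fixes F :: "real \<Rightarrow> complex"
  assumes "has_ac_deriv F f"
  shows "has_ac_deriv (\<lambda>x. (cmod (F x))\<^sup>2) (\<lambda>x. 2 * (f x \<bullet> F x))"
proof -
  note Re = has_ac_deriv_linear[OF assms bounded_linear_Re] and Im = has_ac_deriv_linear[OF assms bounded_linear_Im]
  have "has_ac_deriv (\<lambda>x. Re (F x) * Re (F x) + Im (F x) * Im (F x)) (\<lambda>x. 2 * (f x \<bullet> F x))"
    using has_ac_deriv_add[OF has_ac_deriv_scaleR[OF Re Re] has_ac_deriv_scaleR[OF Im Im]]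
    by (simp add: inner_complex_def algebra_simps)
  then show ?thesis unfolding cmod_power2 by (simp add: power2_eq_square)
qed

lemma has_ac_deriv_bounded:
  fixes k :: "real \<Rightarrow> real"
  assumes k: "has_ac_deriv k k'" and i: "set_integrable lborel {0<..} k'"
  shows "\<exists>C. \<forall>r>0. \<bar>k r\<bar> \<le> C"
proof -
  define I where "I = (LINT x:{0<..}|lborel. \<bar>k' x\<bar>)"
  have near: "\<bar>k b - k a\<bar> \<le> I" if a: "0 < a" and ab: "a \<le> b" for a b
  proof -
    have s: "set_integrable lborel {a..b} k'" by (rule set_integrable_subset[OF i]) (use a in auto)
    have "\<bar>k b - k a\<bar> \<le> (LINT x:{a..b}|lborel. \<bar>k' x\<bar>)"
      using has_ac_derivD(3)[OF k a ab] set_integral_norm_bound[OF s] by simp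
    also have "\<dots> \<le> I"
      using set_integrable_abs[OF s] set_integrable_abs[OF i] a
      unfolding I_def set_lebesgue_integral_def set_integrable_def
      by (intro integral_mono) (auto simp: indicator_def)
    finally show ?thesis .
  qed
  have "\<bar>k r\<bar> \<le> \<bar>k 1\<bar> + I" if "0 < r" for r
    using near[of r 1] near[of 1 r] that by (cases "r \<le> 1") auto
  then show ?thesis by blast
qed

text \<open>Nothing is known about \<open>f\<close> at r \<le> 0, so measurability is stated on the
  restricted space, where \<open>f\<close> is the limit of its truncations to compact
  intervals.\<close>

lemma locally_integrable_halfline_measurable:
  fixes f :: "real \<Rightarrow> 'b::{banach, second_countable_topology}"
  assumes "f locally_integrable_on {0<..}"
  shows "f \<in> borel_measurable (restrict_space lborel {0<..})"
proof -
  have "(\<lambda>x. indicator {0<..} x *\<^sub>R f x) \<in> borel_measurable borel"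
  proof (rule borel_measurable_LIMSEQ_metric)
    fix n :: nat
    have "set_integrable lborel {1 / (real n + 1)..real n} f"
      using assms by (simp add: locally_integrable_halfline_iff)
    then show "(\<lambda>x. indicator {1 / (real n + 1)..real n} x *\<^sub>R f x) \<in> borel_measurable borel"
      unfolding set_integrable_def using borel_measurable_integrable by force
  next
    fix x :: real
    show "(\<lambda>n. indicator {1 / (real n + 1)..real n} x *\<^sub>R f x) \<longlonglongrightarrow> indicator {0<..} x *\<^sub>R f x"
    proof (cases "0 < x")
      case True
      obtain N where N: "max x (1 / x) \<le> real N" using real_arch_simple by blast
      have "indicator {1 / (real n + 1)..real n} x = (1::real)" if "N \<le> n" for n
      proof -
        have "1 / x \<le> real n + 1" "x \<le> real n" using N that by auto
        then show ?thesis using True by (simp add: indicator_def field_simps)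
      qed
      then have "\<forall>\<^sub>F n in sequentially. indicator {1 / (real n + 1)..real n} x *\<^sub>R f x = indicator {0<..} x *\<^sub>R f x"
        unfolding eventually_sequentially using True by (intro exI[of _ N]) auto
      then show ?thesis by (rule tendsto_eventually)
    next
      case False
      have "x \<notin> {1 / (real n + 1)..real n}" for n
      proof -
        have "0 < 1 / (real n + 1)" by simp
        then have "x < 1 / (real n + 1)" using False by linarith
        then show ?thesis by simp
      qed
      then show ?thesis using False by simp
    qed
  qed
  then show ?thesis by (simp add: borel_measurable_restrict_space_iff)
qed

text \<open>The source of the quadratic identities below: c = B expands D_u u, c = B - |m| gives the
  lower bound for D_u u, and c = 2 B gives the bound for u'.\<close>

lemma norm_linear_combination_square:
  fixes x y :: "'a::real_inner"
  assumes "0 < r"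
  shows "(norm (r *\<^sub>R x + c *\<^sub>R y))\<^sup>2 / r = r * (norm x)\<^sup>2 + 2 * c * (x \<bullet> y) + c\<^sup>2 * ((norm y)\<^sup>2 / r)"
proof -
  have "(norm (r *\<^sub>R x + c *\<^sub>R y))\<^sup>2 = r\<^sup>2 * (norm x)\<^sup>2 + 2 * r * c * (x \<bullet> y) + c\<^sup>2 * (norm y)\<^sup>2"
    unfolding power2_norm_eq_inner by (simp add: inner_simps inner_commute power2_eq_square algebra_simps)
  then show ?thesis using assms by (simp add: add_divide_distrib power2_eq_square)
qed

section \<open>Integrability for a fixed function of negative equivariance and finite mass\<close>

locale equivariant_H1 =
  fixes m :: int and u :: "real \<Rightarrow> complex"
  assumes m: "m < 0" and u: "u \<in> Hdot1_equiv m" and fin: "finite_mass u"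
begin

abbreviation (input) "M \<equiv> restrict_space lborel {0::real<..}"
abbreviation (input) "v \<equiv> radial_deriv u"
abbreviation (input) "B r \<equiv> - (of_int m + A_theta u r)"
text \<open>The 4 pi combines the 1/2 in \<open>A_theta\<close> with the 2 pi in
  \<open>mass\<close>.\<close>

abbreviation (input) "B_max \<equiv> \<bar>of_int m\<bar> + mass u / (4 * pi)"

lemma integral_M:
  fixes f :: "real \<Rightarrow> 'b::{banach, second_countable_topology}"
  shows "integral\<^sup>L M f = (LINT r:{0<..}|lborel. f r)"
    and "integrable M f \<longleftrightarrow> set_integrable lborel {0<..} f"
  by (simp_all add: integral_restrict_space integrable_restrict_space set_lebesgue_integral_def set_integrable_def)

lemma AE_M: "(AE r in M. P r) \<longleftrightarrow> (AE r in lborel. 0 < r \<longrightarrow> P r)"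
  by (simp add: AE_restrict_space_iff)

lemma radial_deriv_weak: "has_weak_partial {0<..} 1 u v"
proof -
  from Hdot1_equiv_radial(1)[OF u m] have "\<exists>w. has_weak_partial {0<..} 1 u w" by blast
  then show ?thesis unfolding radial_deriv_def by (rule someI_ex)
qed

lemma measurable_u_v [measurable]: "u \<in> borel_measurable M" "v \<in> borel_measurable M"
  using radial_deriv_weak unfolding has_weak_partial_def
  by (blast intro: locally_integrable_halfline_measurable)+

lemma measurable_id_M [measurable]: "(\<lambda>r. r) \<in> borel_measurable M"
  by (rule measurable_restrict_space1) simp

lemma integrable_v: "integrable M (\<lambda>r. r * (cmod (v r))\<^sup>2)"
proof -
  obtain v' where v': "has_weak_partial {0<..} 1 u v'" and i: "integrable M (\<lambda>r. r * (cmod (v' r))\<^sup>2)"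
    using Hdot1_equiv_radial(1)[OF u m] by (auto simp: integral_M)
  \<comment> \<open>The square bound is known for one particular weak derivative; uniqueness passes
    it to the chosen one.\<close>
  have "AE r in M. v' r = v r"
    unfolding AE_M by (rule weak_derivative_unique[OF v' radial_deriv_weak])
  then show ?thesis
    by (intro integrable_cong_AE_imp[OF i]) auto
qed

lemma integrable_u: "integrable M (\<lambda>r. (cmod (u r))\<^sup>2 / r)" "integrable M (\<lambda>r. (cmod (u r))\<^sup>2 * r)"
  using Hdot1_equiv_radial(2)[OF u m] fin by (simp_all add: integral_M finite_mass_def)

lemma integrable_u_mult: "integrable M (\<lambda>r. c * ((cmod (u r))\<^sup>2 / r))"
  using integrable_u(1) by (rule integrable_mult_right)

text \<open>Weighted AM-GM: 2 |v| |u| \<le> r |v|^2 + |u|^2/r.\<close>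

lemma integrable_inner: "integrable M (\<lambda>r. v r \<bullet> u r)"
proof (rule Bochner_Integration.integrable_bound)
  show "integrable M (\<lambda>r. r * (cmod (v r))\<^sup>2 + (cmod (u r))\<^sup>2 / r)"
    using integrable_v integrable_u(1) by simp
  show "AE r in M. norm (v r \<bullet> u r) \<le> norm (r * (cmod (v r))\<^sup>2 + (cmod (u r))\<^sup>2 / r)"
  proof (intro AE_I2)
    fix r assume "r \<in> space M"
    then have r: "0 < r" by (simp add: space_restrict_space)
    have "\<bar>v r \<bullet> u r\<bar> \<le> cmod (v r) * cmod (u r)" by (rule Cauchy_Schwarz_ineq2)
    moreover have "0 \<le> (r * cmod (v r) - cmod (u r))\<^sup>2 / r" using r by simp
    then have "2 * (cmod (v r) * cmod (u r)) \<le> r * (cmod (v r))\<^sup>2 + (cmod (u r))\<^sup>2 / r"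
      using r by (simp add: power2_eq_square field_simps)
    moreover have "0 \<le> cmod (v r) * cmod (u r)" by simp
    ultimately show "norm (v r \<bullet> u r) \<le> norm (r * (cmod (v r))\<^sup>2 + (cmod (u r))\<^sup>2 / r)"
      by simp
  qed
qed measurable

lemma has_ac_deriv_B: "has_ac_deriv (\<lambda>r. B r) (\<lambda>r. (cmod (u r))\<^sup>2 * r / 2)"
  unfolding has_ac_deriv_def locally_integrable_halfline_iff
proof (intro conjI allI impI)
  let ?W = "\<lambda>r. (cmod (u r))\<^sup>2 * r"
  have W: "set_integrable lborel S ?W" if "S \<in> sets borel" "S \<subseteq> {0<..}" for S
    using fin that by (auto simp: finite_mass_def intro: set_integrable_subset)
  fix a b :: real assume a: "0 < a"
  show "set_integrable lborel {a..b} (\<lambda>r. (cmod (u r))\<^sup>2 * r / 2)"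
  proof -
    have "{a..b} \<subseteq> {0<..}" using a by auto
    then show ?thesis using W[of "{a..b}"] by simp
  qed
  assume ab: "a \<le> b"
  have "(LINT s:{0<..<a} \<union> {a..<b}|lborel. ?W s) = (LINT s:{0<..<a}|lborel. ?W s) + (LINT s:{a..<b}|lborel. ?W s)"
    by (rule set_integral_Un) (use a in \<open>auto intro!: W\<close>)
  also have "{0<..<a} \<union> {a..<b} = {0<..<b}" using a ab by auto
  also have "(LINT s:{a..<b}|lborel. ?W s) = (LINT s:{a..b}|lborel. ?W s)"
    unfolding set_lebesgue_integral_def
  proof (rule integral_cong_AE)
    show "(\<lambda>x. indicator {a..<b} x *\<^sub>R ?W x) \<in> borel_measurable lborel"
      "(\<lambda>x. indicator {a..b} x *\<^sub>R ?W x) \<in> borel_measurable lborel"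
    proof -
      have "{a..<b} \<subseteq> {0<..}" "{a..b} \<subseteq> {0<..}" using a by auto
      from W[OF _ this(1)] W[OF _ this(2)]
      have i: "integrable lborel (\<lambda>x. indicator {a..<b} x *\<^sub>R ?W x)" "integrable lborel (\<lambda>x. indicator {a..b} x *\<^sub>R ?W x)"
        by (simp_all add: set_integrable_def)
      show "(\<lambda>x. indicator {a..<b} x *\<^sub>R ?W x) \<in> borel_measurable lborel"
        by (rule borel_measurable_integrable[OF i(1)])
      show "(\<lambda>x. indicator {a..b} x *\<^sub>R ?W x) \<in> borel_measurable lborel"
        by (rule borel_measurable_integrable[OF i(2)])
    qed
    show "AE x in lborel. indicator {a..<b} x *\<^sub>R ?W x = indicator {a..b} x *\<^sub>R ?W x"
      using AE_lborel_singleton[of b] by eventually_elim (auto simp: indicator_def)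
  qed
  finally show "B b - B a = (LINT r:{a..b}|lborel. (cmod (u r))\<^sup>2 * r / 2)"
    unfolding A_theta_def set_integral_divide_zero by linarith
qed

lemma B_bounds: "\<bar>of_int m\<bar> \<le> B r" "B r \<le> B_max"
proof -
  let ?W = "\<lambda>r. (cmod (u r))\<^sup>2 * r"
  have W: "set_integrable lborel {0<..} ?W" "set_integrable lborel {0<..<r} ?W"
    using fin by (auto simp: finite_mass_def intro: set_integrable_subset)
  have "0 \<le> (LINT s:{0<..<r}|lborel. ?W s)"
    unfolding set_lebesgue_integral_def by (intro Bochner_Integration.integral_nonneg) (auto simp: indicator_def)
  then show "\<bar>of_int m\<bar> \<le> B r" using m by (simp add: A_theta_def)
  have "(LINT s:{0<..<r}|lborel. ?W s) \<le> (LINT s:{0<..}|lborel. ?W s)"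
    using W unfolding set_lebesgue_integral_def set_integrable_def
    by (intro integral_mono) (auto simp: indicator_def)
  then show "B r \<le> B_max" using m by (simp add: A_theta_def mass_def plane_integral_def)
qed

lemma B_measurable [measurable]: "(\<lambda>r. B r) \<in> borel_measurable M" "A_theta u \<in> borel_measurable M"
proof -
  show B: "(\<lambda>r. B r) \<in> borel_measurable M"
    using has_ac_deriv_measurable[OF has_ac_deriv_B] by (simp add: borel_measurable_restrict_space_iff)
  have "(\<lambda>r. - B r - of_int m) \<in> borel_measurable M" using B by measurable
  then show "A_theta u \<in> borel_measurable M" by simp
qed

lemma integrable_B_mult:
  fixes f :: "real \<Rightarrow> real"
  assumes "integrable M f" shows "integrable M (\<lambda>r. B r * f r)"
proof (rule Bochner_Integration.integrable_bound)
  show "integrable M (\<lambda>r. B_max * f r)" using assms by simp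
  show "(\<lambda>r. B r * f r) \<in> borel_measurable M" using borel_measurable_integrable[OF assms] by measurable
  have "\<bar>B r\<bar> \<le> \<bar>B_max\<bar>" for r using B_bounds[of r] by linarith
  then show "AE r in M. norm (B r * f r) \<le> norm (B_max * f r)"
    unfolding real_norm_def abs_mult by (intro AE_I2 mult_right_mono) auto
qed

text \<open>The first and the last claim integrate the derivatives of \<open>|u|\<^sup>2\<close> and of \<open>B |u|\<^sup>2\<close>.\<close>

lemma boundary_terms:
  shows "(LINT r|M. v r \<bullet> u r) = 0"
    and "integrable M (\<lambda>r. (cmod (u r)) ^ 4 * r)"
    and "(LINT r|M. (cmod (u r)) ^ 4 * r / 2 + 2 * (B r * (v r \<bullet> u r))) = 0"
proof -
  obtain U where U: "has_ac_deriv U v" and "AE r in lborel. 0 < r \<longrightarrow> u r = U r"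
    using weak_derivative_has_ac_deriv[OF radial_deriv_weak] by blast
  then have ae: "AE r in M. u r = U r" by (simp add: AE_M)
  have [measurable]: "U \<in> borel_measurable M"
    using has_ac_deriv_measurable[OF U] by (simp add: borel_measurable_restrict_space_iff)
  note h = has_ac_deriv_norm_square[OF U]
  have ih: "integrable M (\<lambda>r. 2 * (v r \<bullet> U r))"
    by (rule integrable_cong_AE_imp[where g = "\<lambda>r. 2 * (v r \<bullet> u r)"]) (use integrable_inner ae in auto)
  have ihr: "integrable M (\<lambda>r. (cmod (U r))\<^sup>2 / r)"
    by (rule integrable_cong_AE_imp[OF integrable_u(1)]) (use ae in auto)
  have "(LINT r|M. v r \<bullet> u r) = (LINT r|M. 1 / 2 * (2 * (v r \<bullet> U r)))"
    by (rule integral_cong_AE) (use ae in auto)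
  also have "\<dots> = 1 / 2 * (LINT r|M. 2 * (v r \<bullet> U r))" by (rule integral_mult_right_zero)
  also have "(LINT r|M. 2 * (v r \<bullet> U r)) = 0"
    using has_ac_deriv_integral_eq_0[OF h] ih ihr by (simp only: integral_M)
  finally show "(LINT r|M. v r \<bullet> u r) = 0" by simp
  \<comment> \<open>|U|^2 is bounded because its derivative is integrable. This reduces |u|^4 r to a
    multiple of |u|^2 r, which is integrable by finite mass.\<close>
  obtain C where C: "\<And>r. 0 < r \<Longrightarrow> \<bar>(cmod (U r))\<^sup>2\<bar> \<le> C"
    using has_ac_deriv_bounded[OF h] ih by (auto simp: integral_M)
  have i4': "integrable M (\<lambda>r. ((cmod (u r))\<^sup>2 * r) * (cmod (U r))\<^sup>2)"
  proof (rule Bochner_Integration.integrable_bound)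
    show "integrable M (\<lambda>r. C * ((cmod (u r))\<^sup>2 * r))" using integrable_u(2) by simp
    show "AE r in M. norm (((cmod (u r))\<^sup>2 * r) * (cmod (U r))\<^sup>2) \<le> norm (C * ((cmod (u r))\<^sup>2 * r))"
    proof (intro AE_I2)
      fix r assume "r \<in> space M"
      then have r: "0 < r" by (simp add: space_restrict_space)
      from C[OF r] have "(cmod (U r))\<^sup>2 \<le> \<bar>C\<bar>" by linarith
      then have "\<bar>(cmod (u r))\<^sup>2 * r\<bar> * (cmod (U r))\<^sup>2 \<le> \<bar>(cmod (u r))\<^sup>2 * r\<bar> * \<bar>C\<bar>"
        by (rule mult_left_mono) simp
      then show "norm (((cmod (u r))\<^sup>2 * r) * (cmod (U r))\<^sup>2) \<le> norm (C * ((cmod (u r))\<^sup>2 * r))"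
        unfolding real_norm_def abs_mult by (simp add: mult_ac)
    qed
  qed measurable
  show i4: "integrable M (\<lambda>r. (cmod (u r)) ^ 4 * r)"
  proof (rule integrable_cong_AE_imp[OF i4'])
    show "AE r in M. (cmod (u r))\<^sup>2 * r * (cmod (U r))\<^sup>2 = (cmod (u r)) ^ 4 * r"
      using ae by eventually_elim (simp add: power2_eq_square power4_eq_xxxx)
  qed measurable
  \<comment> \<open>The derivative of B |U|^2; its first summand comes from B' = |u|^2 r/2 and
    becomes the quartic term.\<close>
  let ?k' = "\<lambda>r. ((cmod (u r))\<^sup>2 * r / 2) * (cmod (U r))\<^sup>2 + B r * (2 * (v r \<bullet> U r))"
  have k: "has_ac_deriv (\<lambda>r. B r * (cmod (U r))\<^sup>2) ?k'"
    using has_ac_deriv_scaleR[OF has_ac_deriv_B h] by simp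
  have ik: "integrable M ?k'"
    using i4' integrable_B_mult[OF ih] by simp
  have ikr: "integrable M (\<lambda>r. B r * (cmod (U r))\<^sup>2 / r)"
    using integrable_B_mult[OF ihr] by simp
  have "(LINT r|M. (cmod (u r)) ^ 4 * r / 2 + 2 * (B r * (v r \<bullet> u r))) = (LINT r|M. ?k' r)"
  proof (rule integral_cong_AE)
    show "AE r in M. (cmod (u r)) ^ 4 * r / 2 + 2 * (B r * (v r \<bullet> u r)) = ?k' r"
      using ae by eventually_elim (simp add: power2_eq_square power4_eq_xxxx)
  qed measurable
  also have "\<dots> = 0"
    using has_ac_deriv_integral_eq_0[OF k] ik ikr by (simp only: integral_M)
  finally show "(LINT r|M. (cmod (u r)) ^ 4 * r / 2 + 2 * (B r * (v r \<bullet> u r))) = 0" .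
qed

lemma integrable_z: "integrable M (\<lambda>r. (cmod (u r)) ^ 4 * r / 2 + 2 * (B r * (v r \<bullet> u r)))"
  by (intro Bochner_Integration.integrable_add integrable_divide integrable_mult_right
      boundary_terms(2) integrable_B_mult[OF integrable_inner])

section \<open>Energy identity and coercivity\<close>

text \<open>The last product is nested as B times (B times ...) so that
  \<open>integrable_B_mult\<close> applies twice.\<close>

lemma cov_deriv_square:
  assumes "0 < r"
  shows "r * (cmod (cov_deriv m u u r))\<^sup>2 =
     r * (cmod (v r))\<^sup>2 + 2 * (B r * (v r \<bullet> u r)) + B r * (B r * ((cmod (u r))\<^sup>2 / r))"
proof -
  have "cov_deriv m u u r = v r + (B r / r) *\<^sub>R u r"
  proof -
    have "B r / r = - ((of_int m + A_theta u r) / r)"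
      by (rule minus_divide_left[symmetric])
    then show ?thesis
      by (simp only: cov_deriv_def scaleR_conv_of_real of_real_minus mult_minus_left diff_conv_add_uminus)
  qed
  then have "r *\<^sub>R cov_deriv m u u r = r *\<^sub>R v r + B r *\<^sub>R u r"
    using assms by (simp only: scaleR_add_right scaleR_scaleR) simp
  then have "(norm (r *\<^sub>R cov_deriv m u u r))\<^sup>2 / r =
      r * (cmod (v r))\<^sup>2 + 2 * B r * (v r \<bullet> u r) + (B r)\<^sup>2 * ((cmod (u r))\<^sup>2 / r)"
    by (simp only: norm_linear_combination_square[OF assms])
  moreover have "(norm (r *\<^sub>R cov_deriv m u u r))\<^sup>2 / r = r * (cmod (cov_deriv m u u r))\<^sup>2"
    using assms by (simp add: power_mult_distrib power2_eq_square)
  ultimately show ?thesis by (simp only: power2_eq_square[of "B r"] mult.assoc)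
qed

lemma integrable_cov_deriv: "integrable M (\<lambda>r. r * (cmod (cov_deriv m u u r))\<^sup>2)"
proof -
  have "integrable M (\<lambda>r. r * (cmod (v r))\<^sup>2 + 2 * (B r * (v r \<bullet> u r)) + B r * (B r * ((cmod (u r))\<^sup>2 / r)))"
    using integrable_v integrable_B_mult[OF integrable_inner] integrable_B_mult[OF integrable_B_mult[OF integrable_u(1)]] by simp
  also have "?this \<longleftrightarrow> ?thesis"
    by (rule Bochner_Integration.integrable_cong) (simp_all add: cov_deriv_square space_restrict_space)
  finally show ?thesis .
qed

text \<open>Pointwise, the energy density is half of |D_u u|^2 minus half of the integrand that
  integrates to zero by \<open>boundary_terms\<close>. The 1/2 and the 2 pi of the plane integral
  leave pi.\<close>

lemma energy_eq: "energy m u = pi * (LINT r|M. r * (cmod (cov_deriv m u u r))\<^sup>2)"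
proof -
  let ?e = "\<lambda>r. (1/2 * (cmod (v r))\<^sup>2 + 1/2 * ((of_int m + A_theta u r) / r)\<^sup>2 * (cmod (u r))\<^sup>2 - 1/4 * (cmod (u r)) ^ 4) * r"
  let ?z = "\<lambda>r. (cmod (u r)) ^ 4 * r / 2 + 2 * (B r * (v r \<bullet> u r))"
  have "(LINT r|M. ?e r) = (LINT r|M. 1/2 * (r * (cmod (cov_deriv m u u r))\<^sup>2) - 1/2 * ?z r)"
  proof (rule Bochner_Integration.integral_cong)
    fix r assume "r \<in> space M"
    then have r: "0 < r" by (simp add: space_restrict_space)
    show "?e r = 1/2 * (r * (cmod (cov_deriv m u u r))\<^sup>2) - 1/2 * ?z r"
      unfolding cov_deriv_square[OF r] using r by (simp add: field_simps power2_eq_square power4_eq_xxxx)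
  qed simp
  also have "\<dots> = 1/2 * (LINT r|M. r * (cmod (cov_deriv m u u r))\<^sup>2) - 1/2 * (LINT r|M. ?z r)"
    by (simp only: integral_mult_right_zero Bochner_Integration.integral_diff[OF
        integrable_mult_right[OF integrable_cov_deriv] integrable_mult_right[OF integrable_z]])
  also have "(LINT r|M. ?z r) = 0" by (rule boundary_terms(3))
  finally show ?thesis by (simp add: energy_def plane_integral_def integral_M)
qed

lemma Hdot1_norm_square: "(Hdot1_norm m u)\<^sup>2 =
    2 * pi * ((LINT r|M. r * (cmod (v r))\<^sup>2) + (of_int m)\<^sup>2 * (LINT r|M. (cmod (u r))\<^sup>2 / r))"
proof -
  let ?f = "\<lambda>r. ((cmod (v r))\<^sup>2 + (of_int m)\<^sup>2 / r\<^sup>2 * (cmod (u r))\<^sup>2) * r"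
  have "(LINT r|M. ?f r) = (LINT r|M. r * (cmod (v r))\<^sup>2 + (of_int m)\<^sup>2 * ((cmod (u r))\<^sup>2 / r))"
    by (rule Bochner_Integration.integral_cong) (simp_all add: space_restrict_space field_simps power2_eq_square)
  also have "\<dots> = (LINT r|M. r * (cmod (v r))\<^sup>2) + (of_int m)\<^sup>2 * (LINT r|M. (cmod (u r))\<^sup>2 / r)"
    by (simp only: Bochner_Integration.integral_add[OF integrable_v integrable_u_mult] integral_mult_right_zero)
  finally have eq: "plane_integral (\<lambda>r. (cmod (v r))\<^sup>2 + (of_int m)\<^sup>2 / r\<^sup>2 * (cmod (u r))\<^sup>2) =
      2 * pi * ((LINT r|M. r * (cmod (v r))\<^sup>2) + (of_int m)\<^sup>2 * (LINT r|M. (cmod (u r))\<^sup>2 / r))"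
    by (simp add: plane_integral_def integral_M)
  have "0 \<le> (LINT r|M. r * (cmod (v r))\<^sup>2)" "0 \<le> (LINT r|M. (cmod (u r))\<^sup>2 / r)"
    by (intro integral_nonneg_AE AE_I2; simp add: space_restrict_space)+
  then show ?thesis unfolding Hdot1_norm_def eq by simp
qed

text \<open>The first bound is Young's inequality for the pairing of D_u u with u, integrated so
  that the term v \<bullet> u drops out. The second is |v|^2 \<le> 2 |D_u u|^2 + 2 |B u/r|^2. The
  third holds because the cross term, which balances the quartic one, has a nonpositive
  integral.\<close>

lemma coercivity:
  shows "(of_int m)\<^sup>2 * (LINT r|M. (cmod (u r))\<^sup>2 / r) \<le> (LINT r|M. r * (cmod (cov_deriv m u u r))\<^sup>2)" (is "_ * ?X \<le> ?Y")
    and "(LINT r|M. r * (cmod (v r))\<^sup>2) \<le>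
      2 * (LINT r|M. r * (cmod (cov_deriv m u u r))\<^sup>2) + 2 * B_max\<^sup>2 * (LINT r|M. (cmod (u r))\<^sup>2 / r)"
    and "(LINT r|M. r * (cmod (cov_deriv m u u r))\<^sup>2) \<le>
      (LINT r|M. r * (cmod (v r))\<^sup>2) + B_max\<^sup>2 * (LINT r|M. (cmod (u r))\<^sup>2 / r)"
proof -
  let ?m = "\<bar>of_int m\<bar> :: real"
  have r: "0 < r" if "r \<in> space M" for r using that by (simp add: space_restrict_space)
  have p: "2 * ?m * (v r \<bullet> u r) + 2 * ?m\<^sup>2 * ((cmod (u r))\<^sup>2 / r) \<le>
      r * (cmod (cov_deriv m u u r))\<^sup>2 + ?m\<^sup>2 * ((cmod (u r))\<^sup>2 / r)" if r: "0 < r" for r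
  proof -
    define b where "b = B r"
    define n where "n = (cmod (u r))\<^sup>2 / r"
    have "(norm (r *\<^sub>R v r + (b - ?m) *\<^sub>R u r))\<^sup>2 / r =
        r * (cmod (v r))\<^sup>2 + 2 * (b - ?m) * (v r \<bullet> u r) + (b - ?m)\<^sup>2 * n"
      unfolding norm_linear_combination_square[OF r] n_def by (simp add: power2_eq_square)
    moreover have "0 \<le> (norm (r *\<^sub>R v r + (b - ?m) *\<^sub>R u r))\<^sup>2 / r" using r by simp
    \<comment> \<open>Since b^2 - m^2 = (b - |m|)^2 + 2 |m| (b - |m|), the claim is the complete
      square above plus this term, nonnegative by b \<ge> |m|.\<close>
    moreover have "0 \<le> 2 * (?m * ((b - ?m) * n))"
      using B_bounds(1)[of r] r by (simp add: b_def n_def)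
    ultimately show ?thesis
      unfolding cov_deriv_square[OF r] b_def[symmetric] n_def[symmetric]
      by (simp add: algebra_simps power2_eq_square)
  qed
  have "(LINT r|M. 2 * ?m * (v r \<bullet> u r) + 2 * ?m\<^sup>2 * ((cmod (u r))\<^sup>2 / r)) \<le>
      (LINT r|M. r * (cmod (cov_deriv m u u r))\<^sup>2 + ?m\<^sup>2 * ((cmod (u r))\<^sup>2 / r))"
    by (rule integral_mono[OF Bochner_Integration.integrable_add[OF integrable_mult_right[OF integrable_inner] integrable_u_mult]
        Bochner_Integration.integrable_add[OF integrable_cov_deriv integrable_u_mult] p[OF r]])
  then have "2 * ?m\<^sup>2 * ?X \<le> ?Y + ?m\<^sup>2 * ?X"
    by (simp only: boundary_terms(1) integral_mult_right_zero mult_zero_right add_0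
        Bochner_Integration.integral_add[OF integrable_mult_right[OF integrable_inner] integrable_u_mult]
        Bochner_Integration.integral_add[OF integrable_cov_deriv integrable_u_mult])
  then show "(of_int m)\<^sup>2 * ?X \<le> ?Y" by simp
  have B2: "(B r)\<^sup>2 \<le> B_max\<^sup>2" for r
    using B_bounds[of r] by (intro power_mono) linarith+
  \<comment> \<open>Here x, p, q stand for r |v|^2, B (v \<bullet> u) and B^2 |u|^2/r; the first
    hypothesis is the square of v + 2 (B/r) u, and t is q with B replaced by its upper
    bound.\<close>
  have comb: "x \<le> 2 * (x + 2 * p + q) + 2 * t" if "0 \<le> x + 4 * p + 4 * q" "q \<le> t" for x p q t :: real
    using that by argo
  have "(LINT r|M. r * (cmod (v r))\<^sup>2) \<le>
      (LINT r|M. 2 * (r * (cmod (cov_deriv m u u r))\<^sup>2) + 2 * B_max\<^sup>2 * ((cmod (u r))\<^sup>2 / r))"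
  proof (rule integral_mono[OF integrable_v
        Bochner_Integration.integrable_add[OF integrable_mult_right[OF integrable_cov_deriv] integrable_u_mult]])
    fix r assume "r \<in> space M"
    then have r: "0 < r" by (rule r)
    define b where "b = B r"
    define n where "n = (cmod (u r))\<^sup>2 / r"
    have "0 \<le> (norm (r *\<^sub>R v r + (2 * b) *\<^sub>R u r))\<^sup>2 / r" using r by simp
    also have "\<dots> = r * (cmod (v r))\<^sup>2 + 4 * (b * (v r \<bullet> u r)) + 4 * (b * (b * n))"
      unfolding norm_linear_combination_square[OF r] n_def by (simp add: power2_eq_square)
    finally have "0 \<le> r * (cmod (v r))\<^sup>2 + 4 * (b * (v r \<bullet> u r)) + 4 * (b * (b * n))" .
    moreover have "b * (b * n) \<le> B_max\<^sup>2 * n"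
      using mult_right_mono[OF B2[of r], of n] r by (simp add: n_def b_def power2_eq_square mult.assoc)
    ultimately show "r * (cmod (v r))\<^sup>2 \<le> 2 * (r * (cmod (cov_deriv m u u r))\<^sup>2) + 2 * B_max\<^sup>2 * ((cmod (u r))\<^sup>2 / r)"
      unfolding cov_deriv_square[OF r] b_def[symmetric] n_def[symmetric] mult.assoc[of 2] by (rule comb)
  qed
  then show "(LINT r|M. r * (cmod (v r))\<^sup>2) \<le> 2 * ?Y + 2 * B_max\<^sup>2 * ?X"
    by (simp only: integral_mult_right_zero
        Bochner_Integration.integral_add[OF integrable_mult_right[OF integrable_cov_deriv] integrable_u_mult])
  \<comment> \<open>Adding this integrand leaves the integral unchanged and supplies the cross term;
    its quartic part only enlarges the right-hand side.\<close>
  let ?z = "\<lambda>r. (cmod (u r)) ^ 4 * r / 2 + 2 * (B r * (v r \<bullet> u r))"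
  have "(LINT r|M. r * (cmod (cov_deriv m u u r))\<^sup>2) \<le>
      (LINT r|M. r * (cmod (v r))\<^sup>2 + B_max\<^sup>2 * ((cmod (u r))\<^sup>2 / r) + ?z r)"
  proof (rule integral_mono[OF integrable_cov_deriv Bochner_Integration.integrable_add[OF
        Bochner_Integration.integrable_add[OF integrable_v integrable_u_mult] integrable_z]])
    fix r assume "r \<in> space M"
    then have r: "0 < r" by (rule r)
    have "B r * (B r * ((cmod (u r))\<^sup>2 / r)) \<le> B_max\<^sup>2 * ((cmod (u r))\<^sup>2 / r)"
      using mult_right_mono[OF B2[of r], of "(cmod (u r))\<^sup>2 / r"] r by (simp add: power2_eq_square mult.assoc)
    moreover have "0 \<le> (cmod (u r)) ^ 4 * r / 2" using r by simp
    ultimately show "r * (cmod (cov_deriv m u u r))\<^sup>2 \<le> r * (cmod (v r))\<^sup>2 + B_max\<^sup>2 * ((cmod (u r))\<^sup>2 / r) + ?z r"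
      unfolding cov_deriv_square[OF r] by linarith
  qed
  also have "\<dots> = (LINT r|M. r * (cmod (v r))\<^sup>2) + B_max\<^sup>2 * ?X + (LINT r|M. ?z r)"
    by (simp only: integral_mult_right_zero Bochner_Integration.integral_add[OF
        Bochner_Integration.integrable_add[OF integrable_v integrable_u_mult] integrable_z]
        Bochner_Integration.integral_add[OF integrable_v integrable_u_mult])
  finally show "?Y \<le> (LINT r|M. r * (cmod (v r))\<^sup>2) + B_max\<^sup>2 * ?X"
    by (simp only: boundary_terms(3))
qed

lemma square_integrals_bounds:
  "0 \<le> (LINT r|M. (cmod (u r))\<^sup>2 / r)"
  "0 \<le> (LINT r|M. r * (cmod (v r))\<^sup>2)"
  "(LINT r|M. (cmod (u r))\<^sup>2 / r) \<le> (of_int m)\<^sup>2 * (LINT r|M. (cmod (u r))\<^sup>2 / r)"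
proof -
  show X: "0 \<le> (LINT r|M. (cmod (u r))\<^sup>2 / r)" and "0 \<le> (LINT r|M. r * (cmod (v r))\<^sup>2)"
    by (intro integral_nonneg_AE AE_I2; simp add: space_restrict_space)+
  have "(1::real) \<le> \<bar>of_int m\<bar>" using m by linarith
  then have "(1::real) \<le> (of_int m)\<^sup>2" using abs_le_square_iff[of 1 "of_int m :: real"] by simp
  then have "1 * (LINT r|M. (cmod (u r))\<^sup>2 / r) \<le> (of_int m)\<^sup>2 * (LINT r|M. (cmod (u r))\<^sup>2 / r)"
    using X by (rule mult_right_mono)
  then show "(LINT r|M. (cmod (u r))\<^sup>2 / r) \<le> (of_int m)\<^sup>2 * (LINT r|M. (cmod (u r))\<^sup>2 / r)" by simp
qed

lemma energy_comparison:
  "(Hdot1_norm m u)\<^sup>2 \<le> (6 + 4 * B_max\<^sup>2) * energy m u"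
  "energy m u \<le> (6 + 4 * B_max\<^sup>2) * (Hdot1_norm m u)\<^sup>2"
proof -
  define X where "X = (LINT r|M. (cmod (u r))\<^sup>2 / r)"
  define V where "V = (LINT r|M. r * (cmod (v r))\<^sup>2)"
  define Y where "Y = (LINT r|M. r * (cmod (cov_deriv m u u r))\<^sup>2)"
  define c where "c = B_max\<^sup>2"
  define q where "q = (of_int m)\<^sup>2 * X"
  have c: "0 \<le> c" by (simp add: c_def)
  have q: "q \<le> Y" "0 \<le> X" "0 \<le> V" "X \<le> q"
    using coercivity(1) square_integrals_bounds by (simp_all add: X_def Y_def V_def q_def)
  have V: "V \<le> 2 * Y + 2 * (c * X)" "Y \<le> V + c * X"
    using coercivity(2,3) unfolding X_def Y_def V_def c_def by (simp_all only: mult.assoc)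
  have E: "energy m u = pi * Y" unfolding Y_def by (rule energy_eq)
  have N: "(Hdot1_norm m u)\<^sup>2 = pi * (2 * (V + q))"
    using Hdot1_norm_square unfolding V_def q_def X_def by (simp only: mult_ac)
  have "c * X \<le> c * Y" "c * X \<le> c * q" using q c by (auto intro: mult_left_mono)
  moreover have "0 \<le> c * V" "0 \<le> c * q" using q c by auto
  \<comment> \<open>Origin of the constant: 2 (V + q) \<le> 2 (2 Y + 2 c X + Y) = 6 Y + 4 c X, and X
    \<le> q \<le> Y. The same constant generously covers the other direction.\<close>
  ultimately have "2 * (V + q) \<le> (6 + 4 * c) * Y" "Y \<le> (6 + 4 * c) * (2 * (V + q))"
    using V q by (simp_all add: algebra_simps)
  then have "pi * (2 * (V + q)) \<le> pi * ((6 + 4 * c) * Y)" "pi * Y \<le> pi * ((6 + 4 * c) * (2 * (V + q)))"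
    by (auto intro: mult_left_mono)
  then show "(Hdot1_norm m u)\<^sup>2 \<le> (6 + 4 * B_max\<^sup>2) * energy m u"
    "energy m u \<le> (6 + 4 * B_max\<^sup>2) * (Hdot1_norm m u)\<^sup>2"
    unfolding E N c_def[symmetric] by (simp_all only: mult_ac)
qed

text \<open>Coercivity bounds the integral of |u|^2/r by that of r |D_u u|^2, so for a solution the
  nonnegative function |u|^2/r has integral zero.\<close>

lemma cov_deriv_eq_0_imp:
  assumes "AE r in lborel. 0 < r \<longrightarrow> cov_deriv m u u r = 0"
  shows "AE r in lborel. 0 < r \<longrightarrow> u r = 0"
proof -
  have "AE r in M. r * (cmod (cov_deriv m u u r))\<^sup>2 = 0"
    using assms unfolding AE_M[symmetric] by eventually_elim simp
  then have "(LINT r|M. r * (cmod (cov_deriv m u u r))\<^sup>2) = 0" by (rule integral_eq_zero_AE)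
  then have "(LINT r|M. (cmod (u r))\<^sup>2 / r) = 0"
    using coercivity(1) square_integrals_bounds by linarith
  moreover have "AE r in M. 0 \<le> (cmod (u r))\<^sup>2 / r"
    by (intro AE_I2) (simp add: space_restrict_space)
  ultimately have "AE r in M. (cmod (u r))\<^sup>2 / r = 0"
    using integral_nonneg_eq_0_iff_AE[OF integrable_u(1)] by simp
  then show ?thesis unfolding AE_M by eventually_elim auto
qed

end

theorem lemma3p1:
  fixes m :: int
  assumes "m < 0"
  shows "(\<exists>C :: real \<Rightarrow> real. (\<forall>K. 0 < C K) \<and>
           (\<forall>u \<in> Hdot1_equiv m. finite_mass u \<longrightarrow>
              inverse (C (mass u)) * (Hdot1_norm m u)\<^sup>2 \<le> energy m u \<and>
              energy m u \<le> C (mass u) * (Hdot1_norm m u)\<^sup>2)) \<and>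
         \<not> (\<exists>u \<in> H1_equiv m.
              (AE r in lborel. 0 < r \<longrightarrow> cov_deriv m u u r = 0) \<and>
              \<not> (AE r in lborel. 0 < r \<longrightarrow> u r = 0))"
proof (intro conjI exI ballI impI allI notI)
  \<comment> \<open>The constant of \<open>energy_comparison\<close> with the mass replaced by K;
    the square keeps it positive for every real K, including negative ones.\<close>
  let ?C = "\<lambda>K. 6 + 4 * (\<bar>of_int m\<bar> + K / (4 * pi))\<^sup>2 :: real"
  show C: "0 < ?C K" for K by (simp add: add_pos_nonneg)
  fix u assume "u \<in> Hdot1_equiv m" "finite_mass u"
  then interpret equivariant_H1 m u using assms by unfold_locales
  show "inverse (?C (mass u)) * (Hdot1_norm m u)\<^sup>2 \<le> energy m u"
  proof -
    have "inverse (?C (mass u)) * (Hdot1_norm m u)\<^sup>2 \<le> inverse (?C (mass u)) * (?C (mass u) * energy m u)"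
      using energy_comparison(1) less_imp_le[OF C] by (intro mult_left_mono) (auto simp del: inverse_eq_divide)
    also have "\<dots> = energy m u"
      using C[of "mass u"] by (simp only: mult.assoc[symmetric] left_inverse[OF less_imp_neq[OF C, symmetric]] mult_1)
    finally show ?thesis .
  qed
  show "energy m u \<le> ?C (mass u) * (Hdot1_norm m u)\<^sup>2" by (rule energy_comparison(2))
next
  assume "\<exists>u\<in>H1_equiv m. (AE r in lborel. 0 < r \<longrightarrow> cov_deriv m u u r = 0) \<and>
              \<not> (AE r in lborel. 0 < r \<longrightarrow> u r = 0)"
  then obtain u where u: "u \<in> Hdot1_equiv m" "finite_mass u"
    and D: "AE r in lborel. 0 < r \<longrightarrow> cov_deriv m u u r = 0"
    and nz: "\<not> (AE r in lborel. 0 < r \<longrightarrow> u r = 0)"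
    by (auto simp: H1_equiv_def)
  interpret equivariant_H1 m u using assms u by unfold_locales
  from cov_deriv_eq_0_imp[OF D] nz show False by blast
qed

end
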